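(* Let $\mathbb{K}$ be a field, let $G$ be a unicyclic graph with vertex set $\{x_1,\ldots,x_m\}$ whose unique cycle is $C_n$ (a cycle of length $n$), with $n\neq 3,5$, and let $J(G)\subset S=\mathbb{K}[x_1,\ldots,x_m]$ be its vertex cover ideal. If $G$ is vertex decomposable, then all symbolic powers $J(G)^{(s)}$, $s\ge 1$, are componentwise linear.
   Context: All graphs are finite and simple. A unicyclic graph is a connected graph containing exactly one cycle. The vertex cover ideal of $G$ is $J(G)=\bigcap_{\{x_i,x_j\}\in E(G)}\langle x_i,x_j\rangle\subset S$. For a squarefree monomial ideal $I$ with irredundant primary decomposition $I=\mathfrak{p}_1\cap\cdots\cap\mathfrak{p}_r$, each $\mathfrak{p}_i$ generated by variables, the $s$-th symbolic power ($s\ge1$) is $I^{(s)}=\mathfrak{p}_1^s\cap\cdots\cap\mathfrak{p}_r^s$; thus $J(G)^{(s)}=\bigcap_{\{x_i,x_j\}\in E(G)}\langle x_i,x_j\rangle^s$. The ring $S$ is standard graded. A finitely generated graded $S$-module $M$ has a linear resolution if for some integer $d$ its graded Betti numbers $\beta_{i,j}(M)=\dim_{\mathbb{K}}\operatorname{Tor}_i^S(M,\mathbb{K})_j$ satisfy $\beta_{i,i+b}(M)=0$ for all $i$ and all $b\ne d$. For a graded ideal $I\subset S$, $I_{<j>}$ denotes the ideal generated by all degree $j$ elements of $I$; $I$ is componentwise linear if $I_{<j>}$ has a linear resolution for all $j$. Vertex decomposable graphs: for a vertex $x$ of a graph $H$, $N_H(x)$ is the set of vertices adjacent to $x$, and $N_H[x]=N_H(x)\cup\{x\}$.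 For $K\subset V(H)$, $H\setminus K$ is the induced subgraph on $V(H)\setminus K$. A graph $H$ is (recursively) called vertex decomposable if it has no edges, or there is a vertex $x$ of $H$ such that (i) $H\setminus\{x\}$ and $H\setminus N_H[x]$ are vertex decomposable, and (ii) for every independent set $C$ in $H\setminus N_H[x]$ there exists $y\in N_H(x)$ such that $C\cup\{y\}$ is independent in $H\setminus\{x\}$. *)

theory Defs
  imports Complex_Main "HOL-Library.Poly_Mapping" "HOL-Library.Function_Algebras"
begin

section \<open>Finite simple graphs\<close>

text \<open>A graph is given by its vertex set \<open>V\<close> and its set \<open>E\<close> of two-element edges.\<close>

definition simple_graph :: "'v set \<Rightarrow> 'v set set \<Rightarrow> bool" where
  "simple_graph V E \<longleftrightarrow> finite V \<and> (\<forall>e\<in>E. \<exists>u\<in>V. \<exists>v\<in>V. u \<noteq> v \<and> e = {u, v})"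

definition connected_graph :: "'v set \<Rightarrow> 'v set set \<Rightarrow> bool" where
  "connected_graph V E \<longleftrightarrow> V \<noteq> {} \<and> (\<forall>u\<in>V. \<forall>v\<in>V. (u, v) \<in> {(a, b). {a, b} \<in> E}\<^sup>*)"

text \<open>Cycles are subgraphs, represented by their edge sets, so that rotating or reversing the
  list of vertices does not change the cycle.\<close>

definition cycle_edges :: "'v list \<Rightarrow> 'v set set" where
  "cycle_edges vs = {{vs ! i, vs ! (Suc i mod length vs)} | i. i < length vs}"

definition is_cycle :: "'v set set \<Rightarrow> nat \<Rightarrow> 'v set set \<Rightarrow> bool" where
  "is_cycle E n C \<longleftrightarrow>
     (\<exists>vs. distinct vs \<and> length vs = n \<and> n \<ge> 3 \<and> C = cycle_edges vs) \<and> C \<subseteq> E"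

definition unicyclic :: "'v set \<Rightarrow> 'v set set \<Rightarrow> bool" where
  "unicyclic V E \<longleftrightarrow>
     simple_graph V E \<and> connected_graph V E \<and> (\<exists>!C. \<exists>n. is_cycle E n C)"

definition nbhd :: "'v set set \<Rightarrow> 'v \<Rightarrow> 'v set" where
  "nbhd E x = {y. {x, y} \<in> E}"

definition closed_nbhd :: "'v set set \<Rightarrow> 'v \<Rightarrow> 'v set" where
  "closed_nbhd E x = insert x (nbhd E x)"

definition induced_edges :: "'v set set \<Rightarrow> 'v set \<Rightarrow> 'v set set" where
  "induced_edges E W = {e \<in> E. e \<subseteq> W}"

definition independent_set :: "'v set \<Rightarrow> 'v set set \<Rightarrow> 'v set \<Rightarrow> bool" where
  "independent_set V E C \<longleftrightarrow> C \<subseteq> V \<and> (\<forall>e\<in>E. \<not> e \<subseteq> C)"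

inductive vertex_decomposable :: "'v set \<Rightarrow> 'v set set \<Rightarrow> bool" where
  no_edges: "vertex_decomposable V {}"
| shedding: "vertex_decomposable V E"
    if "x \<in> V"
      and "vertex_decomposable (V - {x}) (induced_edges E (V - {x}))"
      and "vertex_decomposable (V - closed_nbhd E x) (induced_edges E (V - closed_nbhd E x))"
      and "\<And>C. independent_set (V - closed_nbhd E x) (induced_edges E (V - closed_nbhd E x)) C \<Longrightarrow>
             \<exists>y\<in>nbhd E x. independent_set (V - {x}) (induced_edges E (V - {x})) (insert y C)"


section \<open>The polynomial ring and its ideals\<close>

text \<open>\<open>('v, 'k) mpoly\<close> is the polynomial ring over \<open>'k\<close> with one variable for every element of
  \<open>'v\<close>: an element of \<open>'v \<Rightarrow>\<^sub>0 nat\<close> is the exponent vector of a monomial.\<close>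

type_synonym ('v, 'k) mpoly = "('v \<Rightarrow>\<^sub>0 nat) \<Rightarrow>\<^sub>0 'k"

definition Var :: "'v \<Rightarrow> ('v, 'k::field) mpoly" where
  "Var v = Poly_Mapping.single (Poly_Mapping.single v 1) 1"

definition mon_degree :: "('v::finite \<Rightarrow>\<^sub>0 nat) \<Rightarrow> nat" where
  "mon_degree m = (\<Sum>v\<in>UNIV. Poly_Mapping.lookup m v)"

text \<open>Degrees are integers, since shifts of free modules may be negative; the only homogeneous
  polynomial of negative degree is \<open>0\<close>.\<close>

definition homogeneous :: "int \<Rightarrow> ('v::finite, 'k::field) mpoly \<Rightarrow> bool" where
  "homogeneous j p \<longleftrightarrow> (\<forall>m\<in>Poly_Mapping.keys p. int (mon_degree m) = j)"

definition ideal_gen :: "'a::comm_ring_1 set \<Rightarrow> 'a set" where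
  "ideal_gen = module.span (*)"

lemma module_times: "module ((*) :: 'a::comm_ring_1 \<Rightarrow> 'a \<Rightarrow> 'a)"
  by unfold_locales (simp_all add: algebra_simps)

lemmas ideal_gen_base = module.span_base[OF module_times, folded ideal_gen_def]
  and ideal_gen_scale = module.span_scale[OF module_times, folded ideal_gen_def]
  and ideal_gen_mono = module.span_mono[OF module_times, folded ideal_gen_def]
  and ideal_gen_induct =
    module.span_induct_alt[OF module_times, folded ideal_gen_def, consumes 1, case_names base step]

definition ideal_mult :: "'a::comm_ring_1 set \<Rightarrow> 'a set \<Rightarrow> 'a set" where
  "ideal_mult I J = ideal_gen {a * b | a b. a \<in> I \<and> b \<in> J}"

primrec ideal_power :: "'a::comm_ring_1 set \<Rightarrow> nat \<Rightarrow> 'a set" where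
  "ideal_power I 0 = UNIV"
| "ideal_power I (Suc s) = ideal_mult I (ideal_power I s)"

definition var_ideal :: "'v set \<Rightarrow> ('v, 'k::field) mpoly set" where
  "var_ideal A = ideal_gen (Var ` A)"

definition vertex_cover_ideal :: "'v set set \<Rightarrow> ('v, 'k::field) mpoly set" where
  "vertex_cover_ideal E = (\<Inter>e\<in>E. var_ideal e)"


section \<open>Symbolic powers of squarefree monomial ideals\<close>

text \<open>A decomposition of \<open>I\<close> into primes generated by variables is recorded by the family of
  the generating sets of variables.  For a squarefree monomial ideal there is exactly one
  irredundant one.\<close>

definition irredundant_decomposition :: "('v, 'k::field) mpoly set \<Rightarrow> 'v set set \<Rightarrow> bool" where
  "irredundant_decomposition I P \<longleftrightarrow>
     finite P \<and> I = (\<Inter>A\<in>P. var_ideal A) \<and> (\<forall>A\<in>P. (\<Inter>B\<in>P - {A}. var_ideal B) \<noteq> I)"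

definition symbolic_power :: "('v, 'k::field) mpoly set \<Rightarrow> nat \<Rightarrow> ('v, 'k) mpoly set" where
  "symbolic_power I s = (\<Inter>A\<in>(THE P. irredundant_decomposition I P). ideal_power (var_ideal A) s)"

lemma monomial_in_var_ideal:
  fixes A :: "'v set" and m :: "'v \<Rightarrow>\<^sub>0 nat"
  shows "Poly_Mapping.single m (1::'k::field) \<in> var_ideal A \<longleftrightarrow> Poly_Mapping.keys m \<inter> A \<noteq> {}"
proof
  have *: "\<forall>t\<in>Poly_Mapping.keys p. Poly_Mapping.keys t \<inter> A \<noteq> {}"
    if "p \<in> var_ideal A" for p :: "('v, 'k) mpoly"
    using that[unfolded var_ideal_def]
  proof (induction p rule: ideal_gen_induct)
    case base
    then show ?case by simp
  next
    case (step c x y)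
    then obtain v where v: "v \<in> A" "x = Var v" by blast
    have "Poly_Mapping.keys t \<inter> A \<noteq> {}" if t: "t \<in> Poly_Mapping.keys (c * x)" for t
    proof -
      obtain b where "t = b + Poly_Mapping.single v 1"
        using keys_mult[of c x] t v by (auto simp: Var_def split: if_splits)
      then have "Poly_Mapping.lookup t v \<noteq> 0" by (simp add: lookup_add lookup_single)
      then show ?thesis using v(1) by (auto simp: in_keys_iff)
    qed
    then show ?case
      using step.IH keys_add[of "c * x" y] by blast
  qed
  assume "Poly_Mapping.single m (1::'k) \<in> var_ideal A"
  from *[OF this] show "Poly_Mapping.keys m \<inter> A \<noteq> {}" by simp
next
  assume "Poly_Mapping.keys m \<inter> A \<noteq> {}"
  then obtain v where v: "v \<in> A" "Poly_Mapping.lookup m v \<noteq> 0" by (auto simp: in_keys_iff)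
  have "(m - Poly_Mapping.single v 1) + Poly_Mapping.single v 1 = m"
    using v(2) by (intro poly_mapping_eqI) (auto simp: lookup_add lookup_minus lookup_single when_def)
  then have "Poly_Mapping.single m (1::'k) = Poly_Mapping.single (m - Poly_Mapping.single v 1) 1 * Var v"
    by (simp add: Var_def mult_single)
  then show "Poly_Mapping.single m (1::'k) \<in> var_ideal A"
    unfolding var_ideal_def using v(1) by (simp add: ideal_gen_scale ideal_gen_base)
qed

lemma var_ideal_mono: "A \<subseteq> B \<Longrightarrow> var_ideal A \<subseteq> var_ideal B"
  unfolding var_ideal_def by (intro ideal_gen_mono image_mono)

lemma ex_monomial_with_keys: "\<exists>m :: 'v::finite \<Rightarrow>\<^sub>0 nat. Poly_Mapping.keys m = A"
proof -
  have "Poly_Mapping.keys (Poly_Mapping.Abs_poly_mapping (\<lambda>v. if v \<in> A then 1 else 0 :: nat)) = A"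
    by (auto simp: in_keys_iff Poly_Mapping.Abs_poly_mapping_inverse split: if_splits)
  then show ?thesis by blast
qed

lemma Inter_var_ideal_subset:
  assumes "(\<Inter>A\<in>P. var_ideal A :: ('v::finite, 'k::field) mpoly set) \<subseteq> var_ideal B"
  shows "\<exists>A\<in>P. A \<subseteq> B"
proof (rule ccontr)
  assume neg: "\<not> ?thesis"
  obtain m :: "'v \<Rightarrow>\<^sub>0 nat" where m: "Poly_Mapping.keys m = - B"
    using ex_monomial_with_keys by blast
  have "Poly_Mapping.single m (1::'k) \<in> (\<Inter>A\<in>P. var_ideal A)"
    using neg by (auto simp: monomial_in_var_ideal m)
  with assms have "Poly_Mapping.single m (1::'k) \<in> var_ideal B" by blast
  then show False by (simp add: monomial_in_var_ideal m)
qed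

lemma irredundant_decomposition_antichain:
  assumes "irredundant_decomposition (I :: ('v::finite, 'k::field) mpoly set) P"
    and "A \<in> P" "B \<in> P" "A \<subseteq> B"
  shows "A = B"
proof (rule ccontr)
  assume "A \<noteq> B"
  then have "(\<Inter>C\<in>P - {B}. var_ideal C :: ('v, 'k) mpoly set) \<subseteq> var_ideal B"
    using assms(2,4) var_ideal_mono[of A B] by blast
  then have "(\<Inter>C\<in>P - {B}. var_ideal C :: ('v, 'k) mpoly set) = (\<Inter>C\<in>P. var_ideal C)"
    by blast
  then show False using assms(1,3) unfolding irredundant_decomposition_def by blast
qed

lemma irredundant_decomposition_unique:
  assumes "irredundant_decomposition (I :: ('v::finite, 'k::field) mpoly set) P"
    and "irredundant_decomposition I Q"
  shows "P = Q"
proof -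
  have *: "A \<in> Q'"
    if P: "irredundant_decomposition I P'" and Q: "irredundant_decomposition I Q'" and A: "A \<in> P'"
    for P' Q' A
  proof -
    have eqs: "I = (\<Inter>C\<in>P'. var_ideal C)" "I = (\<Inter>C\<in>Q'. var_ideal C)"
      using P Q unfolding irredundant_decomposition_def by blast+
    obtain B where B: "B \<in> Q'" "B \<subseteq> A"
      using Inter_var_ideal_subset[of Q' A] eqs A by blast
    obtain A' where A': "A' \<in> P'" "A' \<subseteq> B"
      using Inter_var_ideal_subset[of P' B] eqs B by blast
    have "A' = A" using irredundant_decomposition_antichain[OF P A'(1) A] A'(2) B(2) by blast
    then have "B = A" using A'(2) B(2) by (simp add: subset_antisym)
    then show ?thesis using B(1) by simp
  qed
  show ?thesis using *[OF assms] *[OF assms(2,1)] by blast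
qed

lemma irredundant_decomposition_vertex_cover_ideal:
  assumes "simple_graph (UNIV :: 'v::finite set) E"
  shows "irredundant_decomposition (vertex_cover_ideal E :: ('v, 'k::field) mpoly set) E"
  unfolding irredundant_decomposition_def
proof (intro conjI ballI)
  show "vertex_cover_ideal E = (\<Inter>e\<in>E. var_ideal e :: ('v, 'k) mpoly set)"
    by (simp add: vertex_cover_ideal_def)
next
  fix e assume e: "e \<in> E"
  show "(\<Inter>f\<in>E - {e}. var_ideal f) \<noteq> (vertex_cover_ideal E :: ('v, 'k) mpoly set)"
  proof
    assume "(\<Inter>f\<in>E - {e}. var_ideal f) = (vertex_cover_ideal E :: ('v, 'k) mpoly set)"
    then have "(\<Inter>f\<in>E - {e}. var_ideal f :: ('v, 'k) mpoly set) \<subseteq> var_ideal e"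
      using e by (auto simp: vertex_cover_ideal_def)
    from Inter_var_ideal_subset[OF this] obtain f where f: "f \<in> E" "f \<noteq> e" "f \<subseteq> e"
      by blast
    have card: "card g = 2" if "g \<in> E" for g
    proof -
      obtain u v where "u \<noteq> v" "g = {u, v}"
        using assms \<open>g \<in> E\<close> unfolding simple_graph_def by blast
      then show ?thesis by simp
    qed
    have "f = e"
      by (rule card_subset_eq) (simp_all add: f e card)
    then show False using f(2) by simp
  qed
qed simp

lemma symbolic_power_vertex_cover_ideal:
  assumes "simple_graph (UNIV :: 'v::finite set) E"
  shows "symbolic_power (vertex_cover_ideal E :: ('v, 'k::field) mpoly set) s
       = (\<Inter>e\<in>E. ideal_power (var_ideal e) s)"
proof -
  have "(THE P. irredundant_decomposition (vertex_cover_ideal E :: ('v, 'k) mpoly set) P) = E"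
  proof (rule the_equality)
    show dec: "irredundant_decomposition (vertex_cover_ideal E :: ('v, 'k) mpoly set) E"
      by (rule irredundant_decomposition_vertex_cover_ideal[OF assms])
    show "P = E" if "irredundant_decomposition (vertex_cover_ideal E :: ('v, 'k) mpoly set) P" for P
      by (rule irredundant_decomposition_unique[OF that dec])
  qed
  then show ?thesis
    by (simp add: symbolic_power_def)
qed


section \<open>Graded free resolutions, Tor and graded Betti numbers\<close>

text \<open>A vector \<open>c\<close> of a free module of rank \<open>r\<close> is a function on the natural numbers vanishing
  from \<open>r\<close> on.  Row \<open>k\<close> of a matrix \<open>M\<close> is the image of the basis vector \<open>k\<close>.\<close>

definition free_vectors :: "nat \<Rightarrow> (nat \<Rightarrow> 'a::zero) set" where
  "free_vectors r = {c. \<forall>k\<ge>r. c k = 0}"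

definition mat_apply :: "nat \<Rightarrow> (nat \<Rightarrow> nat \<Rightarrow> 'a::comm_ring_1) \<Rightarrow> (nat \<Rightarrow> 'a) \<Rightarrow> nat \<Rightarrow> 'a" where
  "mat_apply r M c = (\<lambda>l. \<Sum>k<r. c k * M k l)"

text \<open>A complex \<open>\<dots> \<rightarrow> F 2 \<rightarrow> F 1 \<rightarrow> F 0 \<rightarrow> S\<close> of free modules of finite rank over the polynomial
  ring \<open>S\<close>: the module \<open>F i\<close> has rank \<open>rnk i\<close>, its \<open>k\<close>-th basis vector lies in degree
  \<open>shft i k\<close>, \<open>diff i\<close> is the matrix of the map from \<open>F (i + 1)\<close> to \<open>F i\<close>, and \<open>aug k\<close> is
  the image in \<open>S\<close> of the \<open>k\<close>-th basis vector of \<open>F 0\<close>.\<close>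

record (overloaded) ('v, 'k) free_complex =
  rnk :: "nat \<Rightarrow> nat"
  shft :: "nat \<Rightarrow> nat \<Rightarrow> int"
  diff :: "nat \<Rightarrow> nat \<Rightarrow> nat \<Rightarrow> ('v, 'k) mpoly"
  aug :: "nat \<Rightarrow> ('v, 'k) mpoly"

definition augmentation :: "('v, 'k::field) free_complex \<Rightarrow> (nat \<Rightarrow> ('v, 'k) mpoly) \<Rightarrow> ('v, 'k) mpoly"
  where "augmentation F c = (\<Sum>k<rnk F 0. c k * aug F k)"

definition differential ::
  "('v, 'k::field) free_complex \<Rightarrow> nat \<Rightarrow> (nat \<Rightarrow> ('v, 'k) mpoly) \<Rightarrow> nat \<Rightarrow> ('v, 'k) mpoly"
  where "differential F i = mat_apply (rnk F (Suc i)) (diff F i)"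

definition graded_free_resolution ::
  "('v::finite, 'k::field) mpoly set \<Rightarrow> ('v, 'k) free_complex \<Rightarrow> bool" where
  "graded_free_resolution I F \<longleftrightarrow>
     (\<forall>k<rnk F 0. homogeneous (shft F 0 k) (aug F k)) \<and>
     (\<forall>i. \<forall>k<rnk F (Suc i). \<forall>l<rnk F i. homogeneous (shft F (Suc i) k - shft F i l) (diff F i k l)) \<and>
     (\<forall>i. \<forall>k<rnk F (Suc i). \<forall>l\<ge>rnk F i. diff F i k l = 0) \<and>
     augmentation F ` free_vectors (rnk F 0) = I \<and>
     {c \<in> free_vectors (rnk F 0). augmentation F c = 0}
       = differential F 0 ` free_vectors (rnk F 1) \<and>
     (\<forall>i. {c \<in> free_vectors (rnk F (Suc i)). differential F i c = 0}
       = differential F (Suc i) ` free_vectors (rnk F (Suc (Suc i))))"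

text \<open>Tensoring with \<open>'k = S / (variables)\<close> replaces every matrix entry by its constant
  coefficient.  \<open>tensor_strand F i j\<close> is the degree \<open>j\<close> part of \<open>F i \<otimes> 'k\<close>.\<close>

definition tensor_strand :: "('v, 'k::field) free_complex \<Rightarrow> nat \<Rightarrow> int \<Rightarrow> (nat \<Rightarrow> 'k) set" where
  "tensor_strand F i j = {c \<in> free_vectors (rnk F i). \<forall>k. shft F i k \<noteq> j \<longrightarrow> c k = 0}"

definition tensor_differential ::
  "('v, 'k::field) free_complex \<Rightarrow> nat \<Rightarrow> (nat \<Rightarrow> 'k) \<Rightarrow> nat \<Rightarrow> 'k" where
  "tensor_differential F i =
     mat_apply (rnk F (Suc i)) (\<lambda>k l. Poly_Mapping.lookup (diff F i k l) 0)"

definition tensor_cycles :: "('v, 'k::field) free_complex \<Rightarrow> nat \<Rightarrow> int \<Rightarrow> (nat \<Rightarrow> 'k) set" where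
  "tensor_cycles F i j =
     {c \<in> tensor_strand F i j. \<forall>i'. i = Suc i' \<longrightarrow> tensor_differential F i' c = 0}"

definition tensor_boundaries :: "('v, 'k::field) free_complex \<Rightarrow> nat \<Rightarrow> int \<Rightarrow> (nat \<Rightarrow> 'k) set" where
  "tensor_boundaries F i j = tensor_differential F i ` tensor_strand F (Suc i) j"

definition vec_dim :: "(nat \<Rightarrow> 'k::field) set \<Rightarrow> nat" where
  "vec_dim = vector_space.dim (\<lambda>(a::'k) c k. a * c k)"

lemma vector_space_vectors: "vector_space (\<lambda>(a::'k::field) (c::nat \<Rightarrow> 'k) k. a * c k)"
  by unfold_locales (simp_all add: algebra_simps fun_eq_iff)

definition tensor_homology_dim :: "('v, 'k::field) free_complex \<Rightarrow> nat \<Rightarrow> int \<Rightarrow> nat" where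
  "tensor_homology_dim F i j = vec_dim (tensor_cycles F i j) - vec_dim (tensor_boundaries F i j)"

text \<open>The dimension of the degree \<open>j\<close> part of \<open>Tor i (I, 'k)\<close>, computed from a graded free
  resolution of \<open>I\<close>.  Every homogeneous ideal has one, and by the comparison theorem the
  dimension does not depend on which one is chosen.\<close>

definition graded_betti :: "('v::finite, 'k::field) mpoly set \<Rightarrow> nat \<Rightarrow> int \<Rightarrow> nat" where
  "graded_betti I i j = tensor_homology_dim (SOME F. graded_free_resolution I F) i j"

definition has_linear_resolution :: "('v::finite, 'k::field) mpoly set \<Rightarrow> bool" where
  "has_linear_resolution I \<longleftrightarrow>
     (\<exists>d::int. \<forall>i. \<forall>b. b \<noteq> d \<longrightarrow> graded_betti I i (int i + b) = 0)"

definition degree_component_ideal ::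
  "('v::finite, 'k::field) mpoly set \<Rightarrow> int \<Rightarrow> ('v, 'k) mpoly set" where
  "degree_component_ideal I j = ideal_gen {f \<in> I. homogeneous j f}"

definition componentwise_linear :: "('v::finite, 'k::field) mpoly set \<Rightarrow> bool" where
  "componentwise_linear I \<longleftrightarrow> (\<forall>j. has_linear_resolution (degree_component_ideal I j))"

end

theory Submission
  imports Defs
begin

text \<open>
A monomial lies in the symbolic power of \<open>J(G)\<close> of order \<open>s\<close> when its exponent vector \<open>a\<close> satisfies
\<open>a u + a v \<ge> s\<close> on every edge \<open>{u, v}\<close>, so the ideal generated by the elements of degree \<open>j\<close> is
generated by the weighted covers of total weight \<open>j\<close>.  The theorem follows from three facts.

Graphs.  A vertex decomposable unicyclic graph whose cycle has length different from 3 and 5 has a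
vertex \<open>x\<close> on the cycle with a leaf attached to it (\<open>cycle_vertex_with_leaf\<close>).  Otherwise every
neighbour of the cycle off the cycle has a further neighbour; these further neighbours form an
independent set \<open>A\<close> that cuts off the cycle, in the sense that deleting \<open>A\<close> and its neighbours
leaves the cycle as a component.  This obstruction survives every step of a vertex decomposition,
because no vertex of such a cycle can be a shedding vertex: the two vertices at distance 2 from it
are then equal or not adjacent, and they block both of its neighbours.
Deleting \<open>x\<close> leaves a forest, as it destroys the only cycle.

Combinatorics.  If \<open>x\<close> has a leaf \<open>y\<close> and the graph is a forest away from \<open>x\<close>, then the weighted
covers of each total weight have linear quotients (\<open>whiskered_forest_linear_quotients\<close>).  They are
split repeatedly according to whether a lower bound \<open>l z \<le> a z\<close> is attained at a chosen vertex
\<open>z\<close>.  An edge is settled once the bounds at its ends add up to \<open>s\<close>.  If only one unsettled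
edge meets \<open>y\<close>, and \<open>z\<close> is its other end, then a cover that attains the bound at \<open>z\<close> is above its
bound at \<open>y\<close>, and one unit of weight can be moved from \<open>y\<close> to \<open>z\<close>.  This is the exchange
that linear quotients require, and the unsettled edges of a forest always leave such a choice.

Algebra.  An ideal generated in one degree with linear quotients has a linear resolution
(\<open>linear_quotients_linear_resolution\<close>).  The Koszul homology of a monomial ideal in a fixed
multidegree is the homology of a simplicial complex, and adding one generator with linear
quotients attaches a family of faces that a cone contracts (\<open>linear_quotients_acyclic\<close>).
Graded Betti numbers are defined by an arbitrary graded free resolution, so two more steps
are needed: Koszul homology controls the homology of every resolution tensored with the field, by
dimension shifting along the syzygy modules (\<open>tensor_cycle_is_boundary\<close>), and a
resolution exists because multigraded syzygies are generated in multidegrees that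
do not exceed a common multiple of the generators (\<open>monomial_ideal_resolution\<close>).
\<close>

section \<open>Koszul differentials and linear quotients\<close>

text \<open>An enumeration of the variables; its only purpose is to fix the signs of the Koszul complex.\<close>

definition vpos :: "'v::finite \<Rightarrow> nat" where
  "vpos = (SOME f. inj f)"

lemma vpos_eq_iff:
  fixes u v :: "'v::finite"
  shows "vpos u = vpos v \<longleftrightarrow> u = v"
proof -
  obtain f :: "'v \<Rightarrow> nat" where "bij_betw f UNIV {0..<card (UNIV :: 'v set)}"
    using ex_bij_betw_finite_nat[of "UNIV :: 'v set"] by (metis finite_class.finite_UNIV)
  then have "inj f" by (simp add: bij_betw_def)
  then have "inj (vpos :: 'v::finite \<Rightarrow> nat)"
    unfolding vpos_def by (rule someI[of inj])
  then show ?thesis by (simp add: inj_eq)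
qed

definition ksign :: "'v::finite \<Rightarrow> 'v set \<Rightarrow> 'a::comm_ring_1" where
  "ksign v A = (- 1) ^ card {u \<in> A. vpos u < vpos v}"

text \<open>A chain is stored as the function that maps a set \<open>A\<close> to the coefficient of the basis
  element \<open>e A\<close> of the exterior algebra; \<open>koszul X\<close> is the Koszul differential of the elements \<open>X v\<close>.
  Taking \<open>X v = 1\<close> gives the simplicial boundary, and the pointwise ring structure on vectors of
  polynomials makes the Koszul complex of a free module another instance.\<close>

definition koszul :: "('v::finite \<Rightarrow> 'a::comm_ring_1) \<Rightarrow> ('v set \<Rightarrow> 'a) \<Rightarrow> 'v set \<Rightarrow> 'a" where
  "koszul X g A = (\<Sum>v\<in>-A. ksign v A * X v * g (insert v A))"

lemma ksign_square: "ksign v A * ksign v A = 1"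
  by (simp add: ksign_def flip: power_add)

lemma ksign_insert:
  assumes "w \<notin> A"
  shows "ksign v (insert w A) = (if vpos w < vpos v then - ksign v A else ksign v A)"
proof -
  have "{u \<in> insert w A. vpos u < vpos v}
      = (if vpos w < vpos v then insert w {u \<in> A. vpos u < vpos v} else {u \<in> A. vpos u < vpos v})"
    by auto
  with assms show ?thesis by (simp add: ksign_def)
qed

lemma ksign_swap:
  assumes "v \<noteq> w" "v \<notin> A" "w \<notin> A"
  shows "ksign w A * ksign v (insert w A) = - (ksign v A * ksign w (insert v A))"
proof -
  have "vpos v \<noteq> vpos w" using assms by (simp add: vpos_eq_iff)
  then show ?thesis using assms by (auto simp: ksign_insert)
qed

text \<open>The terms are matched in pairs rather than by reindexing the whole sum, since \<open>2\<close> may be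
  zero in the ring.\<close>

lemma sum_antisymmetric_pairs:
  fixes f :: "'v::finite \<Rightarrow> 'v \<Rightarrow> 'a::comm_ring_1"
  assumes anti: "\<And>v w. v \<in> S \<Longrightarrow> w \<in> S \<Longrightarrow> v \<noteq> w \<Longrightarrow> f w v = - f v w"
  shows "(\<Sum>v\<in>S. \<Sum>w\<in>S - {v}. f v w) = 0"
proof -
  let ?L = "{(v, w). v \<in> S \<and> w \<in> S \<and> vpos v < vpos w}"
  have "(\<Sum>v\<in>S. \<Sum>w\<in>S - {v}. f v w) = (\<Sum>(v, w)\<in>Sigma S (\<lambda>v. S - {v}). f v w)"
    by (simp add: sum.Sigma)
  also have "Sigma S (\<lambda>v. S - {v}) = ?L \<union> prod.swap ` ?L"
  proof -
    have eq: "v = w \<longleftrightarrow> \<not> (vpos v < vpos w \<or> vpos w < vpos v)" for v w :: 'v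
      using vpos_eq_iff[of v w] by linarith
    have "prod.swap ` ?L = {(v, w). v \<in> S \<and> w \<in> S \<and> vpos w < vpos v}" by force
    then show ?thesis by (auto simp: eq)
  qed
  also have "(\<Sum>(v, w)\<in>?L \<union> prod.swap ` ?L. f v w)
      = (\<Sum>(v, w)\<in>?L. f v w) + (\<Sum>(v, w)\<in>prod.swap ` ?L. f v w)"
    by (rule sum.union_disjoint) auto
  also have "(\<Sum>(v, w)\<in>prod.swap ` ?L. f v w) = (\<Sum>(v, w)\<in>?L. f w v)"
    by (subst sum.reindex) (auto simp: case_prod_unfold)
  also have "\<dots> = (\<Sum>(v, w)\<in>?L. - f v w)"
    by (rule sum.cong) (auto intro!: anti)
  finally show ?thesis by (simp add: sum_negf case_prod_unfold)
qed

lemma koszul_koszul: "koszul X (koszul X g) A = 0"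
proof -
  let ?f = "\<lambda>v w. ksign v A * ksign w (insert v A) * X v * X w * g (insert v (insert w A))"
  have "koszul X (koszul X g) A = (\<Sum>v\<in>-A. \<Sum>w\<in>-A - {v}. ?f v w)"
    unfolding koszul_def sum_distrib_left
    by (intro sum.cong) (auto simp: insert_commute mult_ac)
  also have "\<dots> = 0"
  proof (rule sum_antisymmetric_pairs)
    fix v w assume "v \<in> - A" "w \<in> - A" "v \<noteq> w"
    then show "?f w v = - ?f v w"
      by (simp add: ksign_swap[of v w A] insert_commute mult_ac)
  qed
  finally show ?thesis .
qed

lemma koszul_diff: "koszul X (\<lambda>A. g A - h A) A = koszul X g A - koszul X h A"
  by (simp add: koszul_def algebra_simps sum_subtractf)

lemma koszul_add: "koszul X (\<lambda>A. g A + h A) A = koszul X g A + koszul X h A"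
  by (simp add: koszul_def algebra_simps sum.distrib)

abbreviation boundary :: "('v::finite set \<Rightarrow> 'a::comm_ring_1) \<Rightarrow> 'v set \<Rightarrow> 'a" where
  "boundary \<equiv> koszul (\<lambda>_. 1)"

text \<open>If the faces of \<open>\<Delta>\<close> outside \<open>\<Gamma>\<close> are closed under adding and removing the vertex \<open>x\<close>,
  then the quotient of the two chain complexes is contracted by the cone over \<open>x\<close>, so every cycle
  is homologous to one in \<open>\<Gamma>\<close>.\<close>

lemma cone_pushes_cycle:
  fixes z :: "'v::finite set \<Rightarrow> 'a::comm_ring_1"
  assumes cycle: "\<And>A. boundary z A = 0"
    and supp: "\<And>A. z A \<noteq> 0 \<Longrightarrow> A \<in> \<Delta> \<and> card A = p"
    and sub: "\<Gamma> \<subseteq> \<Delta>"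
    and down\<Delta>: "\<And>A B. A \<in> \<Delta> \<Longrightarrow> B \<subseteq> A \<Longrightarrow> B \<in> \<Delta>"
    and down: "\<And>A B. A \<in> \<Gamma> \<Longrightarrow> B \<subseteq> A \<Longrightarrow> B \<in> \<Gamma>"
    and apex: "\<And>A. A \<in> \<Delta> - \<Gamma> \<Longrightarrow> insert x A \<in> \<Delta> - \<Gamma> \<and> A - {x} \<in> \<Delta> - \<Gamma>"
  shows "\<exists>h. (\<forall>A. h A \<noteq> 0 \<longrightarrow> A \<in> \<Delta> \<and> card A = Suc p) \<and> (\<forall>A. z A \<noteq> boundary h A \<longrightarrow> A \<in> \<Gamma>)"
proof -
  \<comment> \<open>the cone over the new part of \<open>z\<close>\<close>
  define h where "h A = (if x \<in> A \<and> A - {x} \<in> \<Delta> - \<Gamma> then ksign x (A - {x}) * z (A - {x}) else 0)" for A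
  define y where "y A = z A - boundary h A" for A
  have hsupp: "A \<in> \<Delta> \<and> card A = Suc p" if "h A \<noteq> 0" for A
  proof -
    from that have x: "x \<in> A" "A - {x} \<in> \<Delta> - \<Gamma>" "z (A - {x}) \<noteq> 0" by (auto simp: h_def split: if_splits)
    then have "card (A - {x}) = p" using supp by blast
    with x have "card A = Suc p" by (metis card.remove finite_class.finite)
    moreover have "insert x (A - {x}) \<in> \<Delta>" using apex[OF x(2)] by blast
    ultimately show ?thesis using x(1) by (simp add: insert_absorb)
  qed
  have y0: "y A = 0" if A: "A \<in> \<Delta> - \<Gamma>" "x \<notin> A" for A
  proof -
    have "boundary h A = (\<Sum>v\<in>{x}. ksign v A * 1 * h (insert v A))"
      unfolding koszul_def
      by (rule sum.mono_neutral_right) (use A in \<open>auto simp: h_def\<close>)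
    also have "\<dots> = z A" using A by (simp add: h_def mult.assoc[symmetric] ksign_square)
    finally show ?thesis by (simp add: y_def)
  qed
  \<comment> \<open>the value at \<open>A\<close> is the only term left of the boundary of the cycle \<open>y\<close> at \<open>A - {x}\<close>\<close>
  have y1: "y A = 0" if A: "A \<in> \<Delta> - \<Gamma>" "x \<in> A" for A
  proof -
    let ?B = "A - {x}"
    have B: "?B \<in> \<Delta> - \<Gamma>" using apex A by blast
    have z0: "y C = 0" if C: "C \<notin> \<Gamma>" "x \<notin> C" for C
    proof (cases "C \<in> \<Delta>")
      case True
      with C show ?thesis using y0 by blast
    next
      case False
      have "boundary h C = 0" unfolding koszul_def
      proof (rule sum.neutral, rule ballI)
        fix v assume "v \<in> - C"
        have "h (insert v C) = 0"
          using C False unfolding h_def by (metis DiffD1 Diff_insert_absorb insertE)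
        then show "ksign v C * 1 * h (insert v C) = 0" by (simp add: h_def)
      qed
      moreover have "z C = 0" using supp False by blast
      ultimately show ?thesis by (simp add: y_def)
    qed
    have "0 = boundary y ?B"
      unfolding y_def using cycle by (simp add: koszul_diff koszul_koszul)
    also have "\<dots> = (\<Sum>v\<in>{x}. ksign v ?B * 1 * y (insert v ?B))"
      unfolding koszul_def
    proof (rule sum.mono_neutral_right)
      show "\<forall>v\<in>- ?B - {x}. ksign v ?B * 1 * y (insert v ?B) = 0"
      proof
        fix v assume v: "v \<in> - ?B - {x}"
        have "insert v ?B \<notin> \<Gamma>" using down[of "insert v ?B" ?B] B by blast
        then have "y (insert v ?B) = 0" using z0 v by blast
        then show "ksign v ?B * 1 * y (insert v ?B) = 0" by simp
      qed
    qed simp_all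
    also have "\<dots> = ksign x ?B * y A" using A by (simp add: insert_absorb)
    finally have "ksign x ?B * (ksign x ?B * y A) = 0" by simp
    then show ?thesis by (simp add: mult.assoc[symmetric] ksign_square)
  qed
  have "A \<in> \<Gamma>" if "z A \<noteq> boundary h A" for A
  proof (rule ccontr)
    assume nG: "A \<notin> \<Gamma>"
    have ny: "y A \<noteq> 0" using that by (simp add: y_def)
    show False
    proof (cases "A \<in> \<Delta>")
      case True
      then show False using nG ny y0 y1 by blast
    next
      case False
      have "z A = 0" using False supp by blast
      moreover have "boundary h A = 0" unfolding koszul_def
      proof (rule sum.neutral, rule ballI)
        fix v assume v: "v \<in> - A"
        have "h (insert v A) = 0"
        proof (rule ccontr)
          assume ne: "h (insert v A) \<noteq> 0"
          then have x: "x \<in> insert v A" "insert v A - {x} \<in> \<Delta> - \<Gamma>" by (auto simp: h_def split: if_splits)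
          show False
          proof (cases "x \<in> A")
            case True
            have "insert x (insert v A - {x}) \<in> \<Delta>" using apex[OF x(2)] by blast
            then have "A \<in> \<Delta>" by (rule down\<Delta>) blast
            with \<open>A \<notin> \<Delta>\<close> show False by simp
          next
            case False
            with x(1) have "insert v A - {x} = A" by auto
            with x(2) \<open>A \<notin> \<Delta>\<close> show False by simp
          qed
        qed
        then show "ksign v A * 1 * h (insert v A) = 0" by simp
      qed
      ultimately show False using ny by (simp add: y_def)
    qed
  qed
  then show ?thesis using hsupp by blast
qed


text \<open>For monomials of one degree, given by exponent vectors: the colon ideal of the earlier
  monomials by the next one, \<open>m\<close>, is generated by variables.  The variable \<open>i\<close> lies in the colon
  ideal because exchanging some \<open>j\<close> for \<open>i\<close> in \<open>m\<close> gives an earlier monomial, and every earlier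
  monomial has a larger exponent than \<open>m\<close> at one of these variables.\<close>

inductive linear_quotients :: "('v \<Rightarrow> nat) set \<Rightarrow> bool" where
  empty: "linear_quotients {}"
| insert: "linear_quotients (insert m D)"
    if "linear_quotients D"
      and "\<And>a. a \<in> D \<Longrightarrow> \<exists>i j. i \<noteq> j \<and> m i < a i \<and> 0 < m j \<and> m(i := Suc (m i), j := m j - 1) \<in> D"

text \<open>Listing the monomials of \<open>B\<close> after those of \<open>A\<close>, an earlier monomial from \<open>B\<close> is handled
  inside \<open>B\<close>, and the exchanged monomial may then lie in either part.\<close>

lemma linear_quotients_Un:
  assumes "linear_quotients B" and "linear_quotients A"
    and "\<And>a b. a \<in> A \<Longrightarrow> b \<in> B \<Longrightarrow>
           \<exists>i j. i \<noteq> j \<and> b i < a i \<and> 0 < b j \<and> b(i := Suc (b i), j := b j - 1) \<in> A"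
  shows "linear_quotients (A \<union> B)"
  using assms
proof (induction B)
  case empty
  then show ?case by simp
next
  case (insert D m)
  have "linear_quotients (A \<union> D)"
    by (rule insert.IH) (use insert.prems in auto)
  then have "linear_quotients (insert m (A \<union> D))"
  proof (rule linear_quotients.insert)
    fix a assume "a \<in> A \<union> D"
    then show "\<exists>i j. i \<noteq> j \<and> m i < a i \<and> 0 < m j \<and> m(i := Suc (m i), j := m j - 1) \<in> A \<union> D"
      using insert.hyps(2)[of a] insert.prems(2)[of a m] by blast
  qed
  then show ?case by simp
qed

text \<open>The upper Koszul simplicial complex, in multidegree \<open>b\<close>, of the ideal generated by \<open>D\<close>:
  the sets \<open>A\<close> for which the monomial with exponent \<open>b\<close> minus the indicator of \<open>A\<close> is in the ideal.\<close>

definition koszul_faces :: "('v \<Rightarrow> nat) set \<Rightarrow> ('v \<Rightarrow> nat) \<Rightarrow> 'v set set" where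
  "koszul_faces D b = {A. \<exists>m\<in>D. \<forall>v. m v + of_bool (v \<in> A) \<le> b v}"

lemma koszul_faces_down: "A \<in> koszul_faces D b \<Longrightarrow> B \<subseteq> A \<Longrightarrow> B \<in> koszul_faces D b"
proof -
  assume "A \<in> koszul_faces D b" "B \<subseteq> A"
  then obtain m where m: "m \<in> D" "\<And>v. m v + of_bool (v \<in> A) \<le> b v"
    by (auto simp: koszul_faces_def)
  have "m v + of_bool (v \<in> B) \<le> b v" for v
    using m(2)[of v] \<open>B \<subseteq> A\<close> by (auto simp: of_bool_def split: if_splits)
  with m(1) show ?thesis unfolding koszul_faces_def by blast
qed

lemma koszul_faces_insert:
  "koszul_faces (insert m D) b = {A. \<forall>v. m v + of_bool (v \<in> A) \<le> b v} \<union> koszul_faces D b"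
  unfolding koszul_faces_def by blast

lemma sum_of_bool_mem: "(\<Sum>v\<in>UNIV. of_bool (v \<in> A) :: nat) = card (A :: 'v::finite set)"
  by (simp add: of_bool_def sum.If_cases)

text \<open>By induction on the generators.  A face \<open>A\<close> that is new with the generator \<open>m\<close> satisfies
  \<open>m + A \<le> b\<close>, and the inequality is strict at some \<open>x\<close> because the degrees differ.  This
  \<open>x\<close> is not one of the variables that generate the colon ideal, and only those decide
  whether a set with \<open>m + A \<le> b\<close> is an old face.  So the new faces form a cone with apex \<open>x\<close>.\<close>

lemma linear_quotients_acyclic:
  fixes z :: "'v::finite set \<Rightarrow> 'a::comm_ring_1"
  assumes "linear_quotients D"
    and "\<And>m. m \<in> D \<Longrightarrow> sum m UNIV = d"
    and "sum b UNIV \<noteq> d + p"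
    and "\<And>A. boundary z A = 0"
    and "\<And>A. z A \<noteq> 0 \<Longrightarrow> A \<in> koszul_faces D b \<and> card A = p"
  shows "\<exists>h. (\<forall>A. h A \<noteq> 0 \<longrightarrow> A \<in> koszul_faces D b \<and> card A = Suc p) \<and> (\<forall>A. boundary h A = z A)"
  using assms
proof (induction D arbitrary: z)
  case empty
  then have "z = (\<lambda>A. 0)" by (auto simp: koszul_faces_def)
  then show ?case by (intro exI[of _ "\<lambda>A. 0"]) (simp add: koszul_def)
next
  case (insert D m)
  let ?\<Gamma> = "koszul_faces D b" and ?\<Delta> = "koszul_faces (insert m D) b"
  have sub: "?\<Gamma> \<subseteq> ?\<Delta>" by (auto simp: koszul_faces_def)
  have "\<exists>h. (\<forall>A. h A \<noteq> 0 \<longrightarrow> A \<in> ?\<Delta> \<and> card A = Suc p) \<and> (\<forall>A. z A \<noteq> boundary h A \<longrightarrow> A \<in> ?\<Gamma>)"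
  proof (cases "\<forall>A. z A \<noteq> 0 \<longrightarrow> A \<in> ?\<Gamma>")
    case True
    then show ?thesis by (intro exI[of _ "\<lambda>A. 0"]) (auto simp: koszul_def)
  next
    case False
    then obtain A where A: "z A \<noteq> 0" "A \<notin> ?\<Gamma>" by blast
    with insert.prems(4) have "A \<in> ?\<Delta>" and cA: "card A = p" by blast+
    with A(2) have mA: "m v + of_bool (v \<in> A) \<le> b v" for v
      unfolding koszul_faces_insert by blast
    have "(\<Sum>v\<in>UNIV. m v + of_bool (v \<in> A)) \<noteq> sum b UNIV"
      using insert.prems(1)[of m] insert.prems(2) by (simp add: sum.distrib sum_of_bool_mem cA)
    \<comment> \<open>the total degrees of \<open>m + A\<close> and \<open>b\<close> differ, hence so do their values somewhere\<close>
    then obtain x where "m x + of_bool (x \<in> A) \<noteq> b x" by (metis sum.cong)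
    with mA[of x] have x: "m x + of_bool (x \<in> A) < b x" by simp
    show ?thesis
    proof (rule cone_pushes_cycle[where x = x])
      show "boundary z A = 0" for A by (rule insert.prems(3))
      show "z A \<noteq> 0 \<Longrightarrow> A \<in> ?\<Delta> \<and> card A = p" for A by (rule insert.prems(4))
      show "?\<Gamma> \<subseteq> ?\<Delta>" by (rule sub)
      show "\<And>A B. A \<in> ?\<Delta> \<Longrightarrow> B \<subseteq> A \<Longrightarrow> B \<in> ?\<Delta>" "\<And>A B. A \<in> ?\<Gamma> \<Longrightarrow> B \<subseteq> A \<Longrightarrow> B \<in> ?\<Gamma>"
        by (blast intro: koszul_faces_down)+
      fix A' assume A': "A' \<in> ?\<Delta> - ?\<Gamma>"
      then have mA': "m v + of_bool (v \<in> A') \<le> b v" for v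
        unfolding koszul_faces_insert by blast
      have "m v + of_bool (v \<in> insert x A') \<le> b v" for v
        using mA'[of v] x by (auto simp: of_bool_def split: if_splits)
      then have "insert x A' \<in> ?\<Delta>" unfolding koszul_faces_insert by blast
      moreover have "insert x A' \<notin> ?\<Gamma>" using A' koszul_faces_down[of "insert x A'" D b A'] by blast
      moreover have "A' - {x} \<in> ?\<Delta>" using A' koszul_faces_down[of A' _ b "A' - {x}"] by blast
      moreover have "A' - {x} \<notin> ?\<Gamma>"
      proof
        assume "A' - {x} \<in> ?\<Gamma>"
        then obtain a where a: "a \<in> D" "\<And>v. a v + of_bool (v \<in> A' - {x}) \<le> b v"
          unfolding koszul_faces_def by blast
        obtain i j where ij: "i \<noteq> j" "m i < a i" "0 < m j" "m(i := Suc (m i), j := m j - 1) \<in> D" (is "?c \<in> D")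
          using insert.hyps(2)[OF a(1)] by metis
        \<comment> \<open>otherwise the exchanged monomial would make \<open>A\<close> an old face\<close>
        have "i \<noteq> x"
        proof
          assume "i = x"
          then have "?c v + of_bool (v \<in> A) \<le> b v" for v
            using x mA[of v] by auto
          then have "A \<in> ?\<Gamma>" using ij(4) unfolding koszul_faces_def by blast
          with A(2) show False by simp
        qed
        then have "?c v + of_bool (v \<in> A') \<le> b v" for v
          using ij(2) a(2)[of v] mA'[of v] by auto
        then have "A' \<in> ?\<Gamma>" using ij(4) unfolding koszul_faces_def by blast
        with A' show False by simp
      qed
      ultimately show "insert x A' \<in> ?\<Delta> - ?\<Gamma> \<and> A' - {x} \<in> ?\<Delta> - ?\<Gamma>" by blast
    qed
  qed
  then obtain h where h: "\<And>A. h A \<noteq> 0 \<Longrightarrow> A \<in> ?\<Delta> \<and> card A = Suc p"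
    and zh: "\<And>A. z A \<noteq> boundary h A \<Longrightarrow> A \<in> ?\<Gamma>" by blast
  have card_h: "boundary h A = 0" if "card A \<noteq> p" for A
    unfolding koszul_def
  proof (rule sum.neutral, rule ballI)
    fix v assume v: "v \<in> - A"
    have "h (insert v A) = 0"
    proof (rule ccontr)
      assume "h (insert v A) \<noteq> 0"
      with h[of "insert v A"] v that show False by simp
    qed
    then show "ksign v A * 1 * h (insert v A) = 0" by simp
  qed
  have "\<exists>h'. (\<forall>A. h' A \<noteq> 0 \<longrightarrow> A \<in> ?\<Gamma> \<and> card A = Suc p) \<and> (\<forall>A. boundary h' A = z A - boundary h A)"
  proof (rule insert.IH)
    show "boundary (\<lambda>A. z A - boundary h A) A = 0" for A
      by (simp add: koszul_diff koszul_koszul insert.prems(3))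
    show "A \<in> ?\<Gamma> \<and> card A = p" if "z A - boundary h A \<noteq> 0" for A
      using that zh[of A] card_h[of A] insert.prems(4)[of A] by fastforce
  qed (use insert.prems in auto)
  then obtain h' where h': "\<And>A. h' A \<noteq> 0 \<Longrightarrow> A \<in> ?\<Gamma> \<and> card A = Suc p"
    "\<And>A. boundary h' A = z A - boundary h A" by blast
  show ?case
  proof (intro exI[of _ "\<lambda>A. h A + h' A"] conjI allI impI)
    fix A
    show "boundary (\<lambda>A. h A + h' A) A = z A" by (simp add: koszul_add h'(2))
    assume "h A + h' A \<noteq> 0"
    then have "h A \<noteq> 0 \<or> h' A \<noteq> 0" by auto
    then show "A \<in> ?\<Delta>" "card A = Suc p" using h[of A] h'(1)[of A] sub by blast+
  qed
qed

section \<open>Koszul homology of monomial ideals\<close>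

lemma lookup_single_mult:
  fixes t m :: "'v \<Rightarrow>\<^sub>0 nat" and p :: "('v, 'k::field) mpoly"
  shows "Poly_Mapping.lookup (Poly_Mapping.single t c * p) m =
    (if Poly_Mapping.lookup t \<le> Poly_Mapping.lookup m then c * Poly_Mapping.lookup p (m - t) else 0)"
proof -
  have eq: "m = t + q \<longleftrightarrow> q = m - t \<and> Poly_Mapping.lookup t \<le> Poly_Mapping.lookup m" for q
  proof
    assume "q = m - t \<and> Poly_Mapping.lookup t \<le> Poly_Mapping.lookup m"
    then show "m = t + q"
      by (intro poly_mapping_eqI) (simp add: lookup_add lookup_minus le_fun_def)
  qed (simp add: le_fun_def lookup_add)
  have "Poly_Mapping.lookup (Poly_Mapping.single t c * p) m
      = (\<Sum>l. (c * (\<Sum>q. (Poly_Mapping.lookup p q when m = l + q)) when l = t))"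
    unfolding lookup_mult
    by (rule Sum_any.cong) (simp add: lookup_single when_def)
  also have "\<dots> = c * (\<Sum>q. (Poly_Mapping.lookup p q when m = t + q))"
    by simp
  also have "\<dots> = (if Poly_Mapping.lookup t \<le> Poly_Mapping.lookup m
                  then c * Poly_Mapping.lookup p (m - t) else 0)"
    by (simp add: eq when_when[symmetric] flip: when_when)
  finally show ?thesis .
qed

lemma lookup_mult_const:
  fixes p q :: "('v, 'k::field) mpoly"
  shows "Poly_Mapping.lookup (p * q) 0 = Poly_Mapping.lookup p 0 * Poly_Mapping.lookup q 0"
proof -
  have "Poly_Mapping.lookup (p * q) 0
      = (\<Sum>l. (Poly_Mapping.lookup p l * (\<Sum>r. (Poly_Mapping.lookup q r when r = 0)) when l = 0))"
    unfolding lookup_mult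
  proof (rule Sum_any.cong)
    fix l :: "'v \<Rightarrow>\<^sub>0 nat"
    have "0 = l + r \<longleftrightarrow> r = 0 \<and> l = 0" for r
      by (auto simp: poly_mapping_eq_iff fun_eq_iff lookup_add)
    then show "Poly_Mapping.lookup p l * (\<Sum>r. (Poly_Mapping.lookup q r when 0 = l + r))
      = (Poly_Mapping.lookup p l * (\<Sum>r. (Poly_Mapping.lookup q r when r = 0)) when l = 0)"
      by (simp add: when_def)
  qed
  also have "\<dots> = Poly_Mapping.lookup p 0 * Poly_Mapping.lookup q 0" by simp
  finally show ?thesis .
qed

abbreviation "monomial_of \<equiv> Poly_Mapping.Abs_poly_mapping"

lemma lookup_monomial_of [simp]: "Poly_Mapping.lookup (monomial_of (f :: 'v::finite \<Rightarrow> nat)) = f"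
  by simp

text \<open>The part of multidegree \<open>b\<close> of a chain of the Koszul complex over the polynomial ring, as a
  simplicial chain over the field; \<open>e A\<close> has the multidegree of the product of the variables in \<open>A\<close>.\<close>

definition koszul_strand :: "('v::finite \<Rightarrow> nat) \<Rightarrow> ('v set \<Rightarrow> ('v, 'k::field) mpoly) \<Rightarrow> 'v set \<Rightarrow> 'k" where
  "koszul_strand b g A =
     (if \<forall>v\<in>A. 0 < b v then Poly_Mapping.lookup (g A) (monomial_of (\<lambda>v. b v - of_bool (v \<in> A))) else 0)"

lemma lookup_ksign_mult: "Poly_Mapping.lookup (ksign v A * p) t = ksign v A * Poly_Mapping.lookup p t"
  by (cases "even (card {u \<in> A. vpos u < vpos v})") (simp_all add: ksign_def)

lemma koszul_strand_koszul: "koszul_strand b (koszul Var g) A = boundary (koszul_strand b g) A"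
proof (cases "\<forall>v\<in>A. 0 < b v")
  case False
  then have "koszul_strand b g (insert w A) = 0" "koszul_strand b (koszul Var g) A = 0" for w
    unfolding koszul_strand_def by (meson insertI2)+
  then show ?thesis by (simp add: koszul_def[of _ "koszul_strand b g"])
next
  case True
  have "Poly_Mapping.lookup (Var v * g (insert v A)) (monomial_of (\<lambda>u. b u - of_bool (u \<in> A)))
      = koszul_strand b g (insert v A)" if "v \<notin> A" for v
  proof -
    have le: "Poly_Mapping.lookup (Poly_Mapping.single v 1) \<le> (\<lambda>u. b u - of_bool (u \<in> A)) \<longleftrightarrow> 0 < b v"
      using that by (auto simp: le_fun_def lookup_single when_def)
    have eq: "monomial_of (\<lambda>u. b u - of_bool (u \<in> A)) - Poly_Mapping.single v 1
        = monomial_of (\<lambda>u. b u - of_bool (u \<in> insert v A))"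
      using that by (intro poly_mapping_eqI) (auto simp: lookup_minus lookup_single when_def)
    show ?thesis
      unfolding Var_def lookup_single_mult lookup_monomial_of le eq koszul_strand_def
      using True by (simp only: mult_1 ball_simps) simp
  qed
  with True show ?thesis
    by (simp add: koszul_strand_def[of b "koszul Var g"] koszul_def lookup_sum mult.assoc lookup_ksign_mult)
qed

lemma koszul_strand_zero: "g A = 0 \<Longrightarrow> koszul_strand b g A = 0"
  by (simp add: koszul_strand_def)

lemma lookup_eq_koszul_strand:
  "Poly_Mapping.lookup (g A) t = koszul_strand (\<lambda>v. Poly_Mapping.lookup t v + of_bool (v \<in> A)) g A"
  by (simp add: koszul_strand_def Poly_Mapping.lookup_inverse)

lemma koszul_strand_nonzeroE:
  assumes "koszul_strand b g A \<noteq> 0"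
  obtains t where "t \<in> Poly_Mapping.keys (g A)" "b = (\<lambda>v. Poly_Mapping.lookup t v + of_bool (v \<in> A))"
proof
  let ?t = "monomial_of (\<lambda>v. b v - of_bool (v \<in> A))"
  show "?t \<in> Poly_Mapping.keys (g A)"
    using assms by (auto simp: koszul_strand_def in_keys_iff split: if_splits)
  show "b = (\<lambda>v. Poly_Mapping.lookup ?t v + of_bool (v \<in> A))"
    using assms by (auto simp: koszul_strand_def fun_eq_iff split: if_splits)
qed

definition monomial_ideal :: "('v \<Rightarrow> nat) set \<Rightarrow> ('v, 'k::field) mpoly set" where
  "monomial_ideal D = {p. \<forall>t\<in>Poly_Mapping.keys p. \<exists>m\<in>D. m \<le> Poly_Mapping.lookup t}"

text \<open>A chain is determined by its multigraded parts, and only finitely many of them are nonzero.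
  Filling each of them within the upper Koszul complex therefore fills the chain in the ideal.\<close>

lemma koszul_fill:
  fixes g :: "'v::finite set \<Rightarrow> ('v, 'k::field) mpoly"
  assumes fill: "\<And>b. \<exists>A. koszul_strand b g A \<noteq> 0 \<Longrightarrow>
      \<exists>h. (\<forall>A. h A \<noteq> 0 \<longrightarrow> A \<in> koszul_faces D b \<and> card A = Suc p) \<and>
          (\<forall>A. boundary h A = koszul_strand b g A)"
    and homog: "\<And>A. homogeneous (j - int (card A)) (g A)"
  shows "\<exists>h. (\<forall>A. h A \<in> monomial_ideal D) \<and> (\<forall>A. card A \<noteq> Suc p \<longrightarrow> h A = 0) \<and>
      (\<forall>A. koszul Var h A = g A) \<and> (\<forall>A. homogeneous (j - int (card A)) (h A))"
proof -
  let ?B = "{b. \<exists>A. koszul_strand b g A \<noteq> 0}"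
  have "?B \<subseteq> (\<Union>A. (\<lambda>t v. Poly_Mapping.lookup t v + of_bool (v \<in> A)) ` Poly_Mapping.keys (g A))"
    by (auto elim!: koszul_strand_nonzeroE)
  then have finB: "finite ?B" by (rule finite_subset) simp
  have "\<exists>h. (\<forall>A. h A \<noteq> 0 \<longrightarrow> A \<in> koszul_faces D b \<and> card A = Suc p \<and> b \<in> ?B) \<and>
          (\<forall>A. boundary h A = koszul_strand b g A)" for b
  proof (cases "b \<in> ?B")
    case True
    then show ?thesis using fill[of b] by auto
  next
    case False
    then show ?thesis by (intro exI[of _ "\<lambda>A. 0"]) (simp add: koszul_def)
  qed
  from choice[OF allI, OF this] obtain H where HH:
    "\<forall>b. (\<forall>A. H b A \<noteq> 0 \<longrightarrow> A \<in> koszul_faces D b \<and> card A = Suc p \<and> b \<in> ?B) \<and>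
          (\<forall>A. boundary (H b) A = koszul_strand b g A)"
    by (rule exE)
  have H: "A \<in> koszul_faces D b \<and> card A = Suc p \<and> b \<in> ?B" if "H b A \<noteq> 0" for b A
    using HH[rule_format, THEN conjunct1] that by blast
  have bH: "boundary (H b) A = koszul_strand b g A" for b A
    using HH[rule_format, THEN conjunct2] by blast
  define \<tau> :: "'v set \<Rightarrow> ('v \<Rightarrow>\<^sub>0 nat) \<Rightarrow> 'v \<Rightarrow> nat"
    where "\<tau> A t v = Poly_Mapping.lookup t v + of_bool (v \<in> A)" for A t v
  have \<tau>_inj: "inj (\<tau> A)" for A
    by (rule injI) (auto simp: \<tau>_def fun_eq_iff intro!: poly_mapping_eqI)
  define h where "h A = Poly_Mapping.Abs_poly_mapping (\<lambda>t. H (\<tau> A t) A)" for A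
  have look: "Poly_Mapping.lookup (h A) t = H (\<tau> A t) A" for A t
  proof -
    have "{t. H (\<tau> A t) A \<noteq> 0} \<subseteq> \<tau> A -` ?B" using H by blast
    moreover have "finite (\<tau> A -` ?B)" by (rule finite_vimageI[OF finB \<tau>_inj])
    ultimately have "finite {t. H (\<tau> A t) A \<noteq> 0}" by (rule finite_subset)
    then show ?thesis unfolding h_def by simp
  qed
  have strand: "koszul_strand b h A = H b A" for b A
  proof (cases "\<forall>v\<in>A. 0 < b v")
    case True
    then have "\<tau> A (monomial_of (\<lambda>v. b v - of_bool (v \<in> A))) = b"
      by (auto simp: \<tau>_def fun_eq_iff)
    then show ?thesis using True by (simp add: koszul_strand_def look)
  next
    case False
    then obtain v where v: "v \<in> A" "b v = 0" by blast
    then have "\<not> m v + of_bool (v \<in> A) \<le> b v" for m :: "'v \<Rightarrow> nat" by simp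
    then have "A \<notin> koszul_faces D b" unfolding koszul_faces_def by blast
    then have "H b A = 0" using H by blast
    then show ?thesis using False by (auto simp: koszul_strand_def)
  qed
  show ?thesis
  proof (intro exI[of _ h] conjI allI impI)
    fix A
    show "h A \<in> monomial_ideal D"
      unfolding monomial_ideal_def
    proof (rule CollectI, rule ballI)
      fix t assume "t \<in> Poly_Mapping.keys (h A)"
      then have "A \<in> koszul_faces D (\<tau> A t)" using H by (simp add: in_keys_iff look)
      then obtain m where "m \<in> D" "\<And>v. m v + of_bool (v \<in> A) \<le> \<tau> A t v"
        unfolding koszul_faces_def by blast
      then show "\<exists>m\<in>D. m \<le> Poly_Mapping.lookup t" by (auto simp: \<tau>_def le_fun_def)
    qed
    show "h A = 0" if "card A \<noteq> Suc p"
      using that H by (intro poly_mapping_eqI) (auto simp: look)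
    show "koszul Var h A = g A"
    proof (rule poly_mapping_eqI)
      fix t
      have "koszul_strand b (koszul Var h) A = koszul_strand b g A" for b
        using bH[of b A] by (simp add: koszul_strand_koszul koszul_def[of _ "koszul_strand b h"] strand)
          (simp add: koszul_def)
      then show "Poly_Mapping.lookup (koszul Var h A) t = Poly_Mapping.lookup (g A) t"
        by (subst (1 2) lookup_eq_koszul_strand) blast
    qed
    show "homogeneous (j - int (card A)) (h A)"
      unfolding homogeneous_def
    proof
      fix t assume "t \<in> Poly_Mapping.keys (h A)"
      then have "\<tau> A t \<in> ?B" using H by (simp add: in_keys_iff look)
      then obtain A' where "koszul_strand (\<tau> A t) g A' \<noteq> 0" by blast
      then obtain t' where t': "t' \<in> Poly_Mapping.keys (g A')" "\<tau> A t = \<tau> A' t'"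
        unfolding \<tau>_def by (rule koszul_strand_nonzeroE) auto
      have "sum (\<tau> C s) UNIV = mon_degree s + card C" for C s
        by (simp add: \<tau>_def sum.distrib mon_degree_def sum_of_bool_mem)
      with t' have "mon_degree t + card A = mon_degree t' + card A'" by metis
      then show "int (mon_degree t) = j - int (card A)"
        using homog[of A'] t'(1) unfolding homogeneous_def by fastforce
    qed
  qed
qed

lemma monomial_ideal_koszul_exact:
  fixes g :: "'v::finite set \<Rightarrow> ('v, 'k::field) mpoly"
  assumes "linear_quotients D" "\<And>m. m \<in> D \<Longrightarrow> sum m UNIV = d" "j \<noteq> int d + int p"
    and "\<And>A. g A \<in> monomial_ideal D" "\<And>A. card A \<noteq> p \<Longrightarrow> g A = 0"
    and homog: "\<And>A. homogeneous (j - int (card A)) (g A)"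
    and cycle: "\<And>A. koszul Var g A = 0"
  shows "\<exists>h. (\<forall>A. h A \<in> monomial_ideal D) \<and> (\<forall>A. card A \<noteq> Suc p \<longrightarrow> h A = 0) \<and>
      (\<forall>A. koszul Var h A = g A) \<and> (\<forall>A. homogeneous (j - int (card A)) (h A))"
proof (rule koszul_fill[OF _ homog])
  fix b assume "\<exists>A. koszul_strand b g A \<noteq> 0"
  then obtain A t where t: "t \<in> Poly_Mapping.keys (g A)" "b = (\<lambda>v. Poly_Mapping.lookup t v + of_bool (v \<in> A))"
    by (auto elim!: koszul_strand_nonzeroE)
  have "sum b UNIV = mon_degree t + card A"
    by (simp add: t(2) sum.distrib mon_degree_def sum_of_bool_mem)
  moreover have "int (mon_degree t) = j - int (card A)"
    using homog t(1) unfolding homogeneous_def by blast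
  ultimately have b: "sum b UNIV \<noteq> d + p" using assms(3) by linarith
  show "\<exists>h. (\<forall>A. h A \<noteq> 0 \<longrightarrow> A \<in> koszul_faces D b \<and> card A = Suc p) \<and>
          (\<forall>A. boundary h A = koszul_strand b g A)"
  proof (rule linear_quotients_acyclic[OF assms(1,2) b])
    show "boundary (koszul_strand b g) A = 0" for A
      using koszul_strand_zero[of "koszul Var g" A b, OF cycle] unfolding koszul_strand_koszul .
    show "A \<in> koszul_faces D b \<and> card A = p" if "koszul_strand b g A \<noteq> 0" for A
    proof
      obtain t where t: "t \<in> Poly_Mapping.keys (g A)" "b = (\<lambda>v. Poly_Mapping.lookup t v + of_bool (v \<in> A))"
        using \<open>koszul_strand b g A \<noteq> 0\<close> by (rule koszul_strand_nonzeroE)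
      obtain m where "m \<in> D" "m \<le> Poly_Mapping.lookup t"
        using assms(4)[of A] t(1) unfolding monomial_ideal_def by blast
      then show "A \<in> koszul_faces D b" unfolding koszul_faces_def by (auto simp: t(2) le_fun_def)
      show "card A = p" using assms(5)[of A] t(1) by (cases "card A = p") auto
    qed
  qed
qed

text \<open>The ring is the ideal generated by \<open>1\<close>, and its upper Koszul complex in a multidegree
  \<open>b \<noteq> 0\<close> is a full simplex, hence a cone.  The multidegree \<open>0\<close> contributes only the constants
  in homological degree \<open>0\<close>.\<close>

lemma polynomial_ring_koszul_exact:
  fixes g :: "'v::finite set \<Rightarrow> ('v, 'k::field) mpoly"
  assumes supp: "\<And>A. card A \<noteq> p \<Longrightarrow> g A = 0"
    and const: "p = 0 \<Longrightarrow> Poly_Mapping.lookup (g {}) 0 = 0"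
    and homog: "\<And>A. homogeneous (j - int (card A)) (g A)"
    and cycle: "\<And>A. koszul Var g A = 0"
  shows "\<exists>h. (\<forall>A. card A \<noteq> Suc p \<longrightarrow> h A = 0) \<and>
      (\<forall>A. koszul Var h A = g A) \<and> (\<forall>A. homogeneous (j - int (card A)) (h A))"
proof -
  let ?D = "{\<lambda>v::'v. 0 :: nat}"
  have faces: "A \<in> koszul_faces ?D b \<longleftrightarrow> (\<forall>v\<in>A. 0 < b v)" for A b
    by (force simp: koszul_faces_def of_bool_def)
  have "\<exists>h. (\<forall>A. h A \<in> monomial_ideal ?D) \<and> (\<forall>A. card A \<noteq> Suc p \<longrightarrow> h A = 0) \<and>
      (\<forall>A. koszul Var h A = g A) \<and> (\<forall>A. homogeneous (j - int (card A)) (h A))"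
  proof (rule koszul_fill[OF _ homog])
    fix b assume "\<exists>A. koszul_strand b g A \<noteq> 0"
    then obtain A t where t: "t \<in> Poly_Mapping.keys (g A)" "b = (\<lambda>v. Poly_Mapping.lookup t v + of_bool (v \<in> A))"
      by (auto elim!: koszul_strand_nonzeroE)
    have "\<exists>x. 0 < b x"
    proof (rule ccontr)
      assume "\<nexists>x. 0 < b x"
      then have "A = {}" "t = 0"
        by (auto simp: t(2) of_bool_def split: if_splits intro!: poly_mapping_eqI)
      then show False using t(1) const supp[of A] by (cases "p = 0") (auto simp: in_keys_iff)
    qed
    then obtain x where x: "0 < b x" ..
    have "\<exists>h. (\<forall>A. h A \<noteq> 0 \<longrightarrow> A \<in> koszul_faces ?D b \<and> card A = Suc p) \<and>
          (\<forall>A. koszul_strand b g A \<noteq> boundary h A \<longrightarrow> A \<in> {})"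
    proof (rule cone_pushes_cycle[where x = x])
      show "boundary (koszul_strand b g) A = 0" for A
        using koszul_strand_zero[of "koszul Var g" A b, OF cycle] unfolding koszul_strand_koszul .
      show "A \<in> koszul_faces ?D b \<and> card A = p" if "koszul_strand b g A \<noteq> 0" for A
        using that supp[of A] koszul_strand_zero[of g A b]
        by (auto simp: koszul_strand_def faces split: if_splits)
    qed (use x in \<open>auto simp: faces\<close>)
    then show "\<exists>h. (\<forall>A. h A \<noteq> 0 \<longrightarrow> A \<in> koszul_faces ?D b \<and> card A = Suc p) \<and>
          (\<forall>A. boundary h A = koszul_strand b g A)" by (metis emptyE)
  qed
  then show ?thesis by blast
qed

section \<open>Koszul homology computes Tor from any resolution\<close>

lemma mon_degree_add: "mon_degree (s + t) = mon_degree s + mon_degree t"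
  by (simp add: mon_degree_def lookup_add sum.distrib)

lemma homogeneous_0: "homogeneous j 0"
  by (simp add: homogeneous_def)

lemma homogeneous_add: "homogeneous j p \<Longrightarrow> homogeneous j q \<Longrightarrow> homogeneous j (p + q)"
  unfolding homogeneous_def using keys_add[of p q] by blast

lemma homogeneous_sum: "(\<And>x. x \<in> A \<Longrightarrow> homogeneous j (f x)) \<Longrightarrow> homogeneous j (\<Sum>x\<in>A. f x)"
  by (induction A rule: infinite_finite_induct) (auto intro: homogeneous_0 homogeneous_add)

lemma homogeneous_mult:
  assumes "homogeneous i p" "homogeneous j q"
  shows "homogeneous (i + j) (p * q)"
  unfolding homogeneous_def
proof
  fix t assume "t \<in> Poly_Mapping.keys (p * q)"
  then obtain a b where "t = a + b" "a \<in> Poly_Mapping.keys p" "b \<in> Poly_Mapping.keys q"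
    using keys_mult[of p q] by blast
  with assms show "int (mon_degree t) = i + j"
    by (auto simp: homogeneous_def mon_degree_add)
qed

lemma homogeneous_const_coeff: "homogeneous j p \<Longrightarrow> j \<noteq> 0 \<Longrightarrow> Poly_Mapping.lookup p 0 = 0"
  unfolding homogeneous_def by (force simp: mon_degree_def in_keys_iff)

lemma lookup_Var_0: "Poly_Mapping.lookup (Var v) 0 = 0"
proof -
  have "Poly_Mapping.single v (1 :: nat) \<noteq> 0" by (metis lookup_single_eq lookup_zero one_neq_zero)
  then show ?thesis by (simp add: Var_def lookup_single)
qed

lemma sum_fun_apply: "(\<Sum>x\<in>A. f x) k = (\<Sum>x\<in>A. f x k)"
  by (induction A rule: infinite_finite_induct) auto

lemma ksign_apply: "ksign v A (k :: nat) = ksign v A"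
  by (cases "even (card {u \<in> A. vpos u < vpos v})") (simp_all add: ksign_def)

abbreviation koszul_vec ::
  "('v::finite set \<Rightarrow> nat \<Rightarrow> ('v, 'k::field) mpoly) \<Rightarrow> 'v set \<Rightarrow> nat \<Rightarrow> ('v, 'k) mpoly" where
  "koszul_vec \<equiv> koszul (\<lambda>v _. Var v)"

lemma koszul_vec_apply: "koszul_vec g A k = koszul Var (\<lambda>B. g B k) A"
  by (simp add: koszul_def sum_fun_apply ksign_apply)

lemma koszul_vec_sum: "koszul_vec g A k = (\<Sum>v\<in>-A. ksign v A * Var v * g (insert v A) k)"
  unfolding koszul_vec_apply by (simp add: koszul_def)

lemma mat_apply_diff: "mat_apply r M (a - b) = mat_apply r M a - mat_apply r M b"
  by (simp add: mat_apply_def fun_eq_iff algebra_simps sum_subtractf)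

lemma mat_apply_0: "mat_apply r M 0 = 0"
  by (simp add: mat_apply_def fun_eq_iff)

lemma mat_apply_koszul: "mat_apply r M (koszul_vec g A) = koszul_vec (\<lambda>B. mat_apply r M (g B)) A"
proof
  fix l
  have "mat_apply r M (koszul_vec g A) l
      = (\<Sum>k<r. \<Sum>v\<in>-A. ksign v A * Var v * (g (insert v A) k * M k l))"
    by (simp add: mat_apply_def koszul_vec_sum sum_distrib_right mult.assoc)
  also have "\<dots> = koszul_vec (\<lambda>B. mat_apply r M (g B)) A l"
    by (subst sum.swap) (simp add: mat_apply_def koszul_vec_sum sum_distrib_left)
  finally show "mat_apply r M (koszul_vec g A) l = koszul_vec (\<lambda>B. mat_apply r M (g B)) A l" .
qed

lemma koszul_vec_free: "(\<And>A. g A \<in> free_vectors r) \<Longrightarrow> koszul_vec g A \<in> free_vectors r"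
  by (simp add: free_vectors_def koszul_vec_sum)

lemma koszul_vec_card:
  assumes "\<And>A. card A \<noteq> Suc p \<Longrightarrow> g A = 0" "card A \<noteq> p"
  shows "koszul_vec g A = 0"
proof -
  have "g (insert v A) = 0" if "v \<in> - A" for v
    using that assms(1)[of "insert v A"] assms(2) by simp
  then show ?thesis by (simp add: koszul_def)
qed

lemma free_module_koszul_exact:
  fixes g :: "'v::finite set \<Rightarrow> nat \<Rightarrow> ('v, 'k::field) mpoly"
  assumes free: "\<And>A. g A \<in> free_vectors r"
    and supp: "\<And>A. card A \<noteq> p \<Longrightarrow> g A = 0"
    and const: "\<And>k. p = 0 \<Longrightarrow> Poly_Mapping.lookup (g {} k) 0 = 0"
    and homog: "\<And>A k. homogeneous (j - int (card A) - s k) (g A k)"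
    and cycle: "\<And>A. koszul_vec g A = 0"
  shows "\<exists>y. (\<forall>A. y A \<in> free_vectors r) \<and> (\<forall>A. card A \<noteq> Suc p \<longrightarrow> y A = 0) \<and>
      (\<forall>A. koszul_vec y A = g A) \<and> (\<forall>A k. homogeneous (j - int (card A) - s k) (y A k))"
proof -
  have "\<exists>h. (r \<le> k \<longrightarrow> h = (\<lambda>A. 0)) \<and> (\<forall>A. card A \<noteq> Suc p \<longrightarrow> h A = 0) \<and>
      (\<forall>A. koszul Var h A = g A k) \<and> (\<forall>A. homogeneous (j - int (card A) - s k) (h A))" for k
  proof (cases "r \<le> k")
    case True
    then show ?thesis
      using free by (intro exI[of _ "\<lambda>A. 0"]) (auto simp: koszul_def homogeneous_0 free_vectors_def)
  next
    case False
    have "\<exists>h. (\<forall>A. card A \<noteq> Suc p \<longrightarrow> h A = 0) \<and>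
      (\<forall>A. koszul Var h A = g A k) \<and> (\<forall>A. homogeneous (j - s k - int (card A)) (h A))"
    proof (rule polynomial_ring_koszul_exact)
      show "koszul Var (\<lambda>A. g A k) A = 0" for A
        using cycle[of A] koszul_vec_apply[of g A k] by simp
      show "homogeneous (j - s k - int (card A)) (g A k)" for A
        using homog[of A k] by (simp add: algebra_simps)
    qed (use supp const in auto)
    then show ?thesis using False by (auto simp: algebra_simps)
  qed
  from choice[OF allI, OF this] obtain h where
    h: "\<forall>k. (r \<le> k \<longrightarrow> h k = (\<lambda>A. 0)) \<and> (\<forall>A. card A \<noteq> Suc p \<longrightarrow> h k A = 0) \<and>
      (\<forall>A. koszul Var (h k) A = g A k) \<and> (\<forall>A. homogeneous (j - int (card A) - s k) (h k A))"
    by (rule exE)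
  show ?thesis
    by (rule exI[of _ "\<lambda>A k. h k A"]) (use h in \<open>auto simp: free_vectors_def fun_eq_iff koszul_vec_apply\<close>)
qed

text \<open>A graded complex of free modules that is exact except at its last term, the one with index
  \<open>0\<close>.  For a resolution of an ideal that term is the polynomial ring.\<close>

locale exact_graded_complex =
  fixes R :: "nat \<Rightarrow> nat" and S :: "nat \<Rightarrow> nat \<Rightarrow> int"
    and M :: "nat \<Rightarrow> nat \<Rightarrow> nat \<Rightarrow> ('v::finite, 'k::field) mpoly"
  assumes homog: "k < R (Suc n) \<Longrightarrow> homogeneous (S (Suc n) k - S n l) (M n k l)"
    and supp: "k < R (Suc n) \<Longrightarrow> R n \<le> l \<Longrightarrow> M n k l = 0"
    and exact: "{c \<in> free_vectors (R (Suc n)). mat_apply (R (Suc n)) (M n) c = 0}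
        = mat_apply (R (Suc (Suc n))) (M (Suc n)) ` free_vectors (R (Suc (Suc n)))"
begin

abbreviation D :: "nat \<Rightarrow> (nat \<Rightarrow> ('v, 'k) mpoly) \<Rightarrow> nat \<Rightarrow> ('v, 'k) mpoly" where
  "D n \<equiv> mat_apply (R (Suc n)) (M n)"

text \<open>For a resolution of an ideal, \<open>syz 0\<close> is the ideal and \<open>syz (Suc n)\<close> is its syzygy module of order \<open>n + 1\<close>.\<close>

definition syz :: "nat \<Rightarrow> (nat \<Rightarrow> ('v, 'k) mpoly) set" where
  "syz n = D n ` free_vectors (R (Suc n))"

lemma syz_Suc: "syz (Suc n) = {c \<in> free_vectors (R (Suc n)). D n c = 0}"
  by (simp add: syz_def exact)

lemma D_homogeneous:
  assumes "\<And>k. homogeneous (i - S (Suc n) k) (c k)"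
  shows "homogeneous (i - S n l) (D n c l)"
  unfolding mat_apply_def
proof (rule homogeneous_sum)
  fix k assume "k \<in> {..<R (Suc n)}"
  then have "homogeneous (S (Suc n) k - S n l) (M n k l)" using homog by simp
  from homogeneous_mult[OF assms[of k] this]
  show "homogeneous (i - S n l) (c k * M n k l)" by simp
qed

text \<open>The Koszul homology of \<open>syz n\<close> vanishes in homological degree \<open>p\<close> and total degree \<open>j\<close>,
  where the basis element \<open>e A\<close> has degree \<open>card A\<close>.\<close>

definition koszul_exact_at :: "nat \<Rightarrow> nat \<Rightarrow> int \<Rightarrow> bool" where
  "koszul_exact_at p n j \<longleftrightarrow> (\<forall>g. (\<forall>A. g A \<in> syz n) \<and> (\<forall>A. card A \<noteq> p \<longrightarrow> g A = 0) \<and>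
     (\<forall>A k. homogeneous (j - int (card A) - S n k) (g A k)) \<and> (\<forall>A. koszul_vec g A = 0) \<longrightarrow>
     (\<exists>h. (\<forall>A. h A \<in> syz n) \<and> (\<forall>A. card A \<noteq> Suc p \<longrightarrow> h A = 0) \<and> (\<forall>A. koszul_vec h A = g A)))"

text \<open>This is the connecting map of the long exact Koszul homology sequence of
  \<open>0 \<rightarrow> syz (Suc n) \<rightarrow> F \<rightarrow> syz n \<rightarrow> 0\<close>, as a diagram chase.  The cycle bounds a chain \<open>y\<close> in
  the free module \<open>F\<close>; the image of \<open>y\<close> in \<open>syz n\<close> is a cycle, which bounds by hypothesis; and
  correcting \<open>y\<close> by a lift of that bounding chain moves it into \<open>syz (Suc n)\<close>.  In homological degree
  \<open>0\<close> the Koszul homology of \<open>F\<close> consists of its constants, whence the condition on constant terms.\<close>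

lemma koszul_fill_syzygy:
  assumes van: "koszul_exact_at (Suc p) n j"
    and syz: "\<And>A. g A \<in> syz (Suc n)"
    and supp: "\<And>A. card A \<noteq> p \<Longrightarrow> g A = 0"
    and const: "\<And>k. p = 0 \<Longrightarrow> Poly_Mapping.lookup (g {} k) 0 = 0"
    and homog: "\<And>A k. homogeneous (j - int (card A) - S (Suc n) k) (g A k)"
    and cycle: "\<And>A. koszul_vec g A = 0"
  shows "\<exists>h. (\<forall>A. h A \<in> syz (Suc n)) \<and> (\<forall>A. card A \<noteq> Suc p \<longrightarrow> h A = 0) \<and> (\<forall>A. koszul_vec h A = g A)"
proof -
  have free: "g A \<in> free_vectors (R (Suc n))" and Dg: "D n (g A) = 0" for A
    using syz[of A] by (auto simp: syz_Suc)
  obtain y where y: "\<And>A. y A \<in> free_vectors (R (Suc n))" "\<And>A. card A \<noteq> Suc p \<Longrightarrow> y A = 0"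
    and yg: "\<And>A. koszul_vec y A = g A"
    and yh: "\<And>A k. homogeneous (j - int (card A) - S (Suc n) k) (y A k)"
    using free_module_koszul_exact[OF free supp const homog cycle] by blast
  have "\<exists>h. (\<forall>A. h A \<in> syz n) \<and> (\<forall>A. card A \<noteq> Suc (Suc p) \<longrightarrow> h A = 0) \<and>
      (\<forall>A. koszul_vec h A = D n (y A))"
  proof (rule van[unfolded koszul_exact_at_def, rule_format], intro conjI allI impI)
    fix A
    show "D n (y A) \<in> syz n" using y(1) by (simp add: syz_def)
    show "D n (y A) = 0" if "card A \<noteq> Suc p" using y(2)[OF that] by (simp add: mat_apply_0)
    show "homogeneous (j - int (card A) - S n k) (D n (y A) k)" for k
      by (rule D_homogeneous) (rule yh)
    show "koszul_vec (\<lambda>A. D n (y A)) A = 0"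
      by (simp add: mat_apply_koszul[symmetric] yg Dg)
  qed
  then obtain w where w: "\<And>A. w A \<in> syz n" "\<And>A. card A \<noteq> Suc (Suc p) \<Longrightarrow> w A = 0"
    and wy: "\<And>A. koszul_vec w A = D n (y A)" by blast
  have "\<exists>c. c \<in> free_vectors (R (Suc n)) \<and> D n c = w A \<and> (card A \<noteq> Suc (Suc p) \<longrightarrow> c = 0)" for A
  proof (cases "card A = Suc (Suc p)")
    case True
    then show ?thesis using w(1)[of A] by (auto simp: syz_def)
  next
    case False
    then show ?thesis by (intro exI[of _ 0]) (simp add: w(2) mat_apply_0 free_vectors_def)
  qed
  from choice[OF allI, OF this] obtain u where "\<forall>A. u A \<in> free_vectors (R (Suc n)) \<and>
      D n (u A) = w A \<and> (card A \<noteq> Suc (Suc p) \<longrightarrow> u A = 0)" by (rule exE)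
  then have u: "u A \<in> free_vectors (R (Suc n))" "D n (u A) = w A"
      "card A \<noteq> Suc (Suc p) \<Longrightarrow> u A = 0" for A by auto
  show ?thesis
  proof (intro exI[of _ "\<lambda>A. y A - koszul_vec u A"] conjI allI impI)
    fix A
    have "koszul_vec u A \<in> free_vectors (R (Suc n))" using u(1) by (rule koszul_vec_free)
    then have "y A - koszul_vec u A \<in> free_vectors (R (Suc n))"
      using y(1)[of A] by (simp add: free_vectors_def)
    moreover have "D n (y A - koszul_vec u A) = 0"
      by (simp add: mat_apply_diff mat_apply_koszul u(2) wy)
    ultimately show "y A - koszul_vec u A \<in> syz (Suc n)" by (simp add: syz_Suc)
    show "y A - koszul_vec u A = 0" if "card A \<noteq> Suc p"
      using y(2)[OF that] koszul_vec_card[OF u(3) that] by simp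
    show "koszul_vec (\<lambda>A. y A - koszul_vec u A) A = g A"
      by (simp add: koszul_diff koszul_koszul yg)
  qed
qed

lemma koszul_exact_at_shift:
  assumes "koszul_exact_at (Suc p + i) n j"
  shows "koszul_exact_at (Suc p) (n + i) j"
  using assms
proof (induction i arbitrary: p)
  case (Suc i)
  have "koszul_exact_at (Suc (Suc p)) (n + i) j" using Suc by simp
  then have "koszul_exact_at (Suc p) (Suc (n + i)) j"
    unfolding koszul_exact_at_def[of "Suc p" "Suc (n + i)"]
  proof (intro allI impI, elim conjE)
    fix g
    assume "\<forall>A. g A \<in> syz (Suc (n + i))" "\<forall>A. card A \<noteq> Suc p \<longrightarrow> g A = 0"
      "\<forall>A k. homogeneous (j - int (card A) - S (Suc (n + i)) k) (g A k)" "\<forall>A. koszul_vec g A = 0"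
    with \<open>koszul_exact_at (Suc (Suc p)) (n + i) j\<close>
    show "\<exists>h. (\<forall>A. h A \<in> syz (Suc (n + i))) \<and> (\<forall>A. card A \<noteq> Suc (Suc p) \<longrightarrow> h A = 0) \<and>
        (\<forall>A. koszul_vec h A = g A)"
      by (intro koszul_fill_syzygy; (blast | simp))
  qed
  then show ?case by simp
qed simp

text \<open>A cycle \<open>c\<close> of the complex tensored with the field is lifted to the vector \<open>C\<close> of constants.
  Its image is a syzygy with entries in the maximal ideal, or an element of the ideal itself if
  \<open>n = 0\<close>.  Vanishing of Koszul homology makes it a combination of syzygies with
  coefficients in the maximal ideal.  Subtracting a lift of this combination changes
  \<open>C\<close> into an element of the next syzygy module without changing its constant terms.\<close>

lemma tensor_cycle_is_boundary:
  fixes c :: "nat \<Rightarrow> 'k"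
  assumes van: "koszul_exact_at n 0 j"
    and c: "c \<in> free_vectors (R (Suc n))" "\<And>k. S (Suc n) k \<noteq> j \<Longrightarrow> c k = 0"
    and cycle: "0 < n \<Longrightarrow> mat_apply (R (Suc n)) (\<lambda>k l. Poly_Mapping.lookup (M n k l) 0) c = 0"
  shows "\<exists>e. e \<in> free_vectors (R (Suc (Suc n))) \<and> (\<forall>k. S (Suc (Suc n)) k \<noteq> j \<longrightarrow> e k = 0) \<and>
     mat_apply (R (Suc (Suc n))) (\<lambda>k l. Poly_Mapping.lookup (M (Suc n) k l) 0) e = c"
proof -
  define C :: "nat \<Rightarrow> ('v, 'k) mpoly" where "C k = Poly_Mapping.single 0 (c k)" for k
  have C: "C \<in> free_vectors (R (Suc n))" using c(1) by (simp add: C_def free_vectors_def)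
  have Ch: "homogeneous (j - S (Suc n) k) (C k)" for k
    using c(2)[of k] by (auto simp: C_def homogeneous_def mon_degree_def)
  define g where "g A = (if A = {} then D n C else 0)" for A :: "'v set"
  have g: "g A \<in> syz n" for A
  proof -
    have "0 = D n 0" by (simp add: mat_apply_0)
    then have "0 \<in> syz n" unfolding syz_def by (auto simp: free_vectors_def)
    then show ?thesis using C by (simp add: g_def syz_def)
  qed
  have gsupp: "g A = 0" if "card A \<noteq> 0" for A using that by (auto simp: g_def)
  have gh: "homogeneous (j - int (card A) - S n k) (g A k)" for A k
    using D_homogeneous[of j n C, OF Ch] by (simp add: g_def homogeneous_0)
  have gc: "koszul_vec g A = 0" for A by (simp add: koszul_def g_def)
  have "\<exists>h. (\<forall>A. h A \<in> syz n) \<and> (\<forall>A. card A \<noteq> Suc 0 \<longrightarrow> h A = 0) \<and> (\<forall>A. koszul_vec h A = g A)"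
  proof (cases n)
    case 0
    then show ?thesis
      using van g gsupp gh gc unfolding koszul_exact_at_def by blast
  next
    case (Suc m)
    then have "koszul_exact_at (Suc 0) (0 + m) j"
      using van by (intro koszul_exact_at_shift) simp
    then have exact1: "koszul_exact_at (Suc 0) m j" by simp
    have const: "Poly_Mapping.lookup (g {} l) 0 = 0" for l
    proof -
      have "Poly_Mapping.lookup (g {} l) 0
          = mat_apply (R (Suc n)) (\<lambda>k l. Poly_Mapping.lookup (M n k l) 0) c l"
        by (simp add: g_def mat_apply_def lookup_sum lookup_mult_const C_def)
      then show ?thesis using cycle Suc by simp
    qed
    show ?thesis
      using g gsupp const gh gc unfolding Suc by (intro koszul_fill_syzygy[OF exact1]; blast)
  qed
  then obtain h where h: "\<And>A. h A \<in> syz n" "\<And>A. koszul_vec h A = g A" by blast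
  have "\<exists>w. w \<in> free_vectors (R (Suc n)) \<and> D n w = h A" for A using h(1)[of A] by (auto simp: syz_def)
  from choice[OF allI, OF this] obtain W
    where "\<forall>A. W A \<in> free_vectors (R (Suc n)) \<and> D n (W A) = h A" by (rule exE)
  then have W: "W A \<in> free_vectors (R (Suc n))" "D n (W A) = h A" for A by auto
  define C' where "C' = C - koszul_vec W {}"
  have "C' \<in> free_vectors (R (Suc n))"
    using C koszul_vec_free[of W, OF W(1)] by (simp add: C'_def free_vectors_def)
  moreover have "D n C' = 0"
    using h(2)[of "{}"] by (simp add: C'_def mat_apply_diff mat_apply_koszul W(2) g_def)
  ultimately have "C' \<in> syz (Suc n)" by (simp add: syz_Suc)
  then obtain e where e: "e \<in> free_vectors (R (Suc (Suc n)))" "D (Suc n) e = C'"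
    by (auto simp: syz_def)
  have C'0: "Poly_Mapping.lookup (C' l) 0 = c l" for l
  proof -
    have "Poly_Mapping.lookup (koszul_vec W {} l) 0 = 0"
      unfolding koszul_vec_sum
      by (simp add: lookup_sum mult.assoc lookup_mult_const lookup_Var_0)
    then show ?thesis by (simp add: C'_def C_def lookup_minus)
  qed
  \<comment> \<open>only the generators of degree \<open>j\<close> belong to the strand; homogeneity makes the others invisible there\<close>
  define e0 where "e0 k = (if S (Suc (Suc n)) k = j then Poly_Mapping.lookup (e k) 0 else 0)" for k
  have "mat_apply (R (Suc (Suc n))) (\<lambda>k l. Poly_Mapping.lookup (M (Suc n) k l) 0) e0 l = c l" for l
  proof (cases "S (Suc n) l = j")
    case True
    have "e0 k * Poly_Mapping.lookup (M (Suc n) k l) 0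
        = Poly_Mapping.lookup (e k) 0 * Poly_Mapping.lookup (M (Suc n) k l) 0"
      if "k < R (Suc (Suc n))" for k
      using homogeneous_const_coeff[OF homog[OF that, of l]] True by (auto simp: e0_def)
    then have "mat_apply (R (Suc (Suc n))) (\<lambda>k l. Poly_Mapping.lookup (M (Suc n) k l) 0) e0 l
        = Poly_Mapping.lookup (D (Suc n) e l) 0"
      unfolding mat_apply_def lookup_sum lookup_mult_const by (intro sum.cong) auto
    then show ?thesis by (simp add: e(2) C'0)
  next
    case False
    have "e0 k * Poly_Mapping.lookup (M (Suc n) k l) 0 = 0" if "k < R (Suc (Suc n))" for k
      using homogeneous_const_coeff[OF homog[OF that, of l]] False by (auto simp: e0_def)
    then show ?thesis unfolding mat_apply_def c(2)[OF False] by (intro sum.neutral) blast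
  qed
  then show ?thesis
    by (intro exI[of _ e0]) (use e(1) in \<open>auto simp: e0_def free_vectors_def fun_eq_iff\<close>)
qed

lemma constant_complex:
  fixes e :: "nat \<Rightarrow> 'k"
  assumes "e \<in> free_vectors (R (Suc (Suc n)))"
  shows "mat_apply (R (Suc n)) (\<lambda>k l. Poly_Mapping.lookup (M n k l) 0)
      (mat_apply (R (Suc (Suc n))) (\<lambda>k l. Poly_Mapping.lookup (M (Suc n) k l) 0) e) = 0"
proof
  fix l
  have "(\<lambda>k. Poly_Mapping.single 0 (e k)) \<in> free_vectors (R (Suc (Suc n)))"
    using assms by (simp add: free_vectors_def)
  then have "D n (D (Suc n) (\<lambda>k. Poly_Mapping.single 0 (e k))) = 0" using exact[of n] by blast
  then have "Poly_Mapping.lookup (D n (D (Suc n) (\<lambda>k. Poly_Mapping.single 0 (e k))) l) 0 = 0" by simp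
  then show "mat_apply (R (Suc n)) (\<lambda>k l. Poly_Mapping.lookup (M n k l) 0)
      (mat_apply (R (Suc (Suc n))) (\<lambda>k l. Poly_Mapping.lookup (M (Suc n) k l) 0) e) l = 0 l"
    by (simp add: mat_apply_def lookup_sum lookup_mult_const)
qed

end


text \<open>The augmentation is absorbed as the last differential, so that the polynomial ring becomes
  the term of index \<open>0\<close> and the free modules of the resolution are shifted by one.\<close>

definition res_rank :: "('v, 'k) free_complex \<Rightarrow> nat \<Rightarrow> nat" where
  "res_rank F n = (case n of 0 \<Rightarrow> 1 | Suc i \<Rightarrow> rnk F i)"

definition res_shift :: "('v, 'k) free_complex \<Rightarrow> nat \<Rightarrow> nat \<Rightarrow> int" where
  "res_shift F n k = (case n of 0 \<Rightarrow> 0 | Suc i \<Rightarrow> shft F i k)"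

definition res_map :: "('v, 'k::zero) free_complex \<Rightarrow> nat \<Rightarrow> nat \<Rightarrow> nat \<Rightarrow> ('v, 'k) mpoly" where
  "res_map F n k l = (case n of 0 \<Rightarrow> if l = 0 then aug F k else 0 | Suc i \<Rightarrow> diff F i k l)"

lemmas res_defs = res_rank_def res_shift_def res_map_def

lemma mat_apply_augmentation:
  "mat_apply (res_rank F (Suc 0)) (res_map F 0) c = (\<lambda>l. if l = 0 then augmentation F c else 0)"
  by (auto simp: mat_apply_def augmentation_def res_defs fun_eq_iff)

lemma mat_apply_differential:
  "mat_apply (res_rank F (Suc (Suc i))) (res_map F (Suc i)) c = differential F i c"
  by (auto simp: mat_apply_def differential_def res_defs fun_eq_iff)

lemma graded_free_resolution_complex:
  assumes "graded_free_resolution I F"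
  shows "exact_graded_complex (res_rank F) (res_shift F) (res_map F)"
proof
  fix k n l assume k: "k < res_rank F (Suc n)"
  show "homogeneous (res_shift F (Suc n) k - res_shift F n l) (res_map F n k l)"
  proof (cases n)
    case 0
    then show ?thesis
      using assms k unfolding graded_free_resolution_def by (auto simp: res_defs homogeneous_0)
  next
    case (Suc i)
    show ?thesis
    proof (cases "l < rnk F i")
      case True
      then show ?thesis
        using assms k Suc unfolding graded_free_resolution_def by (auto simp: res_defs)
    next
      case False
      then have "diff F i k l = 0"
        using assms k Suc unfolding graded_free_resolution_def by (auto simp: res_defs)
      then show ?thesis by (simp add: res_defs Suc homogeneous_0)
    qed
  qed
  show "res_map F n k l = 0" if "res_rank F n \<le> l"
    using assms k that unfolding graded_free_resolution_def by (auto simp: res_defs split: nat.splits)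
next
  fix n
  show "{c \<in> free_vectors (res_rank F (Suc n)). mat_apply (res_rank F (Suc n)) (res_map F n) c = 0} =
      mat_apply (res_rank F (Suc (Suc n))) (res_map F (Suc n)) ` free_vectors (res_rank F (Suc (Suc n)))"
  proof (cases n)
    case 0
    have "mat_apply (res_rank F (Suc 0)) (res_map F 0) c = 0 \<longleftrightarrow> augmentation F c = 0" for c
      unfolding mat_apply_augmentation by (auto simp: fun_eq_iff)
    moreover have "{c \<in> free_vectors (rnk F 0). augmentation F c = 0}
        = differential F 0 ` free_vectors (rnk F 1)"
      using assms unfolding graded_free_resolution_def by blast
    ultimately show ?thesis
      unfolding 0 mat_apply_differential by (simp add: res_rank_def)
  next
    case (Suc i)
    have "{c \<in> free_vectors (rnk F (Suc i)). differential F i c = 0}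
       = differential F (Suc i) ` free_vectors (rnk F (Suc (Suc i)))"
      using assms unfolding graded_free_resolution_def by blast
    then show ?thesis
      unfolding Suc mat_apply_differential by (simp add: res_rank_def)
  qed
qed

text \<open>The augmented resolution is exact, and its \<open>syz 0\<close> is the ideal, whose Koszul homology is known.\<close>

lemma linear_quotients_tensor_homology:
  fixes F :: "('v::finite, 'k::field) free_complex"
  assumes res: "graded_free_resolution (monomial_ideal D) F"
    and lq: "linear_quotients D" "\<And>m. m \<in> D \<Longrightarrow> sum m UNIV = d"
    and j: "j \<noteq> int d + int i"
  shows "tensor_homology_dim F i j = 0"
proof -
  interpret exact_graded_complex "res_rank F" "res_shift F" "res_map F"
    by (rule graded_free_resolution_complex[OF res])
  have syz0: "syz 0 = (\<lambda>f l. if l = 0 then f else 0) ` monomial_ideal D"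
  proof -
    have "augmentation F ` free_vectors (rnk F 0) = monomial_ideal D"
      using res unfolding graded_free_resolution_def by blast
    then show ?thesis
      unfolding syz_def mat_apply_augmentation by (simp add: res_rank_def image_image flip: \<open>_ = monomial_ideal D\<close>)
  qed
  have exact_i: "koszul_exact_at i 0 j"
    unfolding koszul_exact_at_def
  proof (intro allI impI, elim conjE)
    fix g
    assume g: "\<forall>A. g A \<in> syz 0" "\<forall>A. card A \<noteq> i \<longrightarrow> g A = 0"
      "\<forall>A k. homogeneous (j - int (card A) - res_shift F 0 k) (g A k)" "\<forall>A. koszul_vec g A = 0"
    have g0: "g A 0 \<in> monomial_ideal D" "l \<noteq> 0 \<Longrightarrow> g A l = 0" for A l
      using g(1)[rule_format, of A] by (auto simp: syz0)
    have "\<exists>h. (\<forall>A. h A \<in> monomial_ideal D) \<and> (\<forall>A. card A \<noteq> Suc i \<longrightarrow> h A = 0) \<and>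
        (\<forall>A. koszul Var h A = g A 0) \<and> (\<forall>A. homogeneous (j - int (card A)) (h A))"
    proof (rule monomial_ideal_koszul_exact[OF lq j])
      show "homogeneous (j - int (card A)) (g A 0)" for A
        using g(3)[rule_format, of A 0] by (simp add: res_shift_def)
      show "koszul Var (\<lambda>A. g A 0) A = 0" for A
        using g(4)[rule_format, of A] koszul_vec_apply[of g A 0] by simp
    qed (use g(2) g0(1) in auto)
    then obtain h where h: "\<And>A. h A \<in> monomial_ideal D" "\<And>A. card A \<noteq> Suc i \<Longrightarrow> h A = 0"
      "\<And>A. koszul Var h A = g A 0" by blast
    show "\<exists>h. (\<forall>A. h A \<in> syz 0) \<and> (\<forall>A. card A \<noteq> Suc i \<longrightarrow> h A = 0) \<and> (\<forall>A. koszul_vec h A = g A)"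
    proof (intro exI[of _ "\<lambda>A l. if l = 0 then h A else 0"] conjI allI impI)
      fix A
      show "(\<lambda>l. if l = 0 then h A else 0) \<in> syz 0" using h(1) by (auto simp: syz0)
      show "(\<lambda>l. if l = 0 then h A else 0) = 0" if "card A \<noteq> Suc i" using h(2)[OF that] by auto
      show "koszul_vec (\<lambda>A l. if l = 0 then h A else 0) A = g A"
      proof
        fix l
        show "koszul_vec (\<lambda>A l. if l = 0 then h A else 0) A l = g A l"
        proof (cases "l = 0")
          case True
          then show ?thesis using h(3)[of A] by (simp add: koszul_vec_apply)
        next
          case False
          then show ?thesis using g0(2)[of l A] by (simp add: koszul_vec_sum)
        qed
      qed
    qed
  qed
  have tensor_diff: "tensor_differential F k
      = mat_apply (res_rank F (Suc (Suc k))) (\<lambda>a l. Poly_Mapping.lookup (res_map F (Suc k) a l) 0)" for k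
    by (simp add: tensor_differential_def res_defs)
  have "tensor_cycles F i j = tensor_boundaries F i j"
  proof (intro equalityI subsetI)
    fix c assume c: "c \<in> tensor_cycles F i j"
    have "\<exists>e. e \<in> free_vectors (res_rank F (Suc (Suc i))) \<and>
      (\<forall>k. res_shift F (Suc (Suc i)) k \<noteq> j \<longrightarrow> e k = 0) \<and>
      mat_apply (res_rank F (Suc (Suc i))) (\<lambda>k l. Poly_Mapping.lookup (res_map F (Suc i) k l) 0) e = c"
    proof (rule tensor_cycle_is_boundary[OF exact_i])
      show "mat_apply (res_rank F (Suc i)) (\<lambda>k l. Poly_Mapping.lookup (res_map F i k l) 0) c = 0" if pos: "0 < i"
      proof -
        obtain i' where i': "i = Suc i'" using gr0_implies_Suc[OF pos] by blast
        show ?thesis using c unfolding tensor_cycles_def i' tensor_diff by simp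
      qed
    qed (use c in \<open>auto simp: tensor_cycles_def tensor_strand_def res_defs\<close>)
    then show "c \<in> tensor_boundaries F i j"
      unfolding tensor_boundaries_def tensor_diff tensor_strand_def
      by (auto simp: res_rank_def res_shift_def)
  next
    fix c assume "c \<in> tensor_boundaries F i j"
    then obtain e where e: "e \<in> tensor_strand F (Suc i) j" "c = tensor_differential F i e"
      by (auto simp: tensor_boundaries_def)
    have e': "e \<in> free_vectors (res_rank F (Suc (Suc i)))" "\<And>k. res_shift F (Suc (Suc i)) k \<noteq> j \<Longrightarrow> e k = 0"
      using e(1) by (auto simp: tensor_strand_def res_defs)
    have "c l = 0" if "res_rank F (Suc i) \<le> l \<or> res_shift F (Suc i) l \<noteq> j" for l
    proof -
      have "e k * Poly_Mapping.lookup (res_map F (Suc i) k l) 0 = 0" if "k < res_rank F (Suc (Suc i))" for k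
        using \<open>res_rank F (Suc i) \<le> l \<or> res_shift F (Suc i) l \<noteq> j\<close> supp[OF that, of l] e'(2)[of k]
          homogeneous_const_coeff[OF homog[OF that, of l]]
        by (cases "res_shift F (Suc (Suc i)) k = j"; cases "res_shift F (Suc (Suc i)) k = res_shift F (Suc i) l") auto
      then show ?thesis unfolding e(2) tensor_diff mat_apply_def by (intro sum.neutral) blast
    qed
    then have "c \<in> tensor_strand F i j"
      by (auto simp: tensor_strand_def free_vectors_def res_defs)
    moreover have "tensor_differential F i' c = 0" if "i = Suc i'" for i'
      using constant_complex[OF e'(1)] unfolding e(2) tensor_diff that .
    ultimately show "c \<in> tensor_cycles F i j" by (simp add: tensor_cycles_def)
  qed
  then show ?thesis by (simp add: tensor_homology_dim_def)
qed

section \<open>Existence of multigraded resolutions\<close>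

text \<open>The matrix of a multigraded map between free modules is determined by scalars \<open>C k l\<close>: the
  generator of multidegree \<open>a' k\<close> is sent to the generators of multidegree \<open>a l\<close> with
  monomial coefficients of the missing multidegree.\<close>

definition multigraded_matrix ::
  "(nat \<Rightarrow> 'v::finite \<Rightarrow> nat) \<Rightarrow> (nat \<Rightarrow> 'v \<Rightarrow> nat) \<Rightarrow> (nat \<Rightarrow> nat \<Rightarrow> 'k) \<Rightarrow> nat \<Rightarrow> nat \<Rightarrow> ('v, 'k::field) mpoly" where
  "multigraded_matrix a' a C k l = Poly_Mapping.single (monomial_of (\<lambda>v. a' k v - a l v)) (C k l)"

text \<open>The part of multidegree \<open>b\<close> of a vector \<open>f\<close> of a free module whose generators have multidegrees \<open>a k\<close>.\<close>

definition strand :: "(nat \<Rightarrow> 'v::finite \<Rightarrow> nat) \<Rightarrow> ('v \<Rightarrow> nat) \<Rightarrow> (nat \<Rightarrow> ('v, 'k::field) mpoly) \<Rightarrow> nat \<Rightarrow> 'k" where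
  "strand a b f k = (if a k \<le> b then Poly_Mapping.lookup (f k) (monomial_of (\<lambda>v. b v - a k v)) else 0)"

lemma lookup_eq_strand:
  "Poly_Mapping.lookup (f k) t = strand a (\<lambda>v. a k v + Poly_Mapping.lookup t v) f k"
  by (simp add: strand_def le_fun_def Poly_Mapping.lookup_inverse)

lemma strand_mat_apply:
  assumes C: "\<And>k. k < r' \<Longrightarrow> C k l \<noteq> 0 \<Longrightarrow> a l \<le> a' k"
  shows "strand a b (mat_apply r' (multigraded_matrix a' a C) f) l = (\<Sum>k<r'. strand a' b f k * C k l)"
proof (cases "a l \<le> b")
  case True
  have "Poly_Mapping.lookup (f k * multigraded_matrix a' a C k l) (monomial_of (\<lambda>v. b v - a l v))
      = strand a' b f k * C k l" if "k < r'" for k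
  proof (cases "C k l = 0")
    case False
    with C that have le: "a l \<le> a' k" by blast
    have iff: "(\<lambda>v. a' k v - a l v) \<le> (\<lambda>v. b v - a l v) \<longleftrightarrow> a' k \<le> b"
    proof -
      have "a' k v - a l v \<le> b v - a l v \<longleftrightarrow> a' k v \<le> b v" for v
        using le True unfolding le_fun_def by (meson diff_le_mono le_diff_iff)
      then show ?thesis by (simp add: le_fun_def)
    qed
    have eq: "monomial_of (\<lambda>v. b v - a l v) - monomial_of (\<lambda>v. a' k v - a l v) = monomial_of (\<lambda>v. b v - a' k v)"
      if "a' k \<le> b"
    proof (rule poly_mapping_eqI)
      fix v
      show "Poly_Mapping.lookup (monomial_of (\<lambda>v. b v - a l v) - monomial_of (\<lambda>v. a' k v - a l v)) v
          = Poly_Mapping.lookup (monomial_of (\<lambda>v. b v - a' k v)) v"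
        using le_funD[OF le, of v] le_funD[OF that, of v] by (simp add: lookup_minus)
    qed
    show ?thesis
      unfolding multigraded_matrix_def mult.commute[of "f k"] lookup_single_mult lookup_monomial_of iff
      by (simp add: strand_def eq)
  qed (simp add: multigraded_matrix_def)
  then show ?thesis using True by (simp add: strand_def[of a] mat_apply_def lookup_sum)
next
  case False
  have "strand a' b f k * C k l = 0" if "k < r'" for k
    using C[OF that] False order_trans[of "a l" "a' k" b] by (auto simp: strand_def)
  then show ?thesis using False unfolding strand_def[of a] by (simp del: mult_eq_0_iff)
qed

lemma strand_zero: "f k = 0 \<Longrightarrow> strand a b f k = 0"
  by (simp add: strand_def)

lemma strand_ext:
  assumes "\<And>b. strand a b f k = 0" shows "f k = 0"
  by (rule poly_mapping_eqI) (simp add: lookup_eq_strand[of f k _ a] assms)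

text \<open>The part of multidegree \<open>b\<close> of the kernel of a multigraded map, as a space of scalar vectors.\<close>

definition strand_kernel :: "nat \<Rightarrow> (nat \<Rightarrow> 'v \<Rightarrow> nat) \<Rightarrow> (nat \<Rightarrow> nat \<Rightarrow> 'k::field) \<Rightarrow> ('v \<Rightarrow> nat) \<Rightarrow> (nat \<Rightarrow> 'k) set" where
  "strand_kernel r a C b = {c. (\<forall>k. c k \<noteq> 0 \<longrightarrow> k < r \<and> a k \<le> b) \<and> (\<forall>l. (\<Sum>k<r. c k * C k l) = 0)}"

interpretation vec: vector_space "\<lambda>(a::'k::field) (c::nat \<Rightarrow> 'k) k. a * c k"
  by (rule vector_space_vectors)

lemma strand_kernel_finite_span:
  fixes C :: "nat \<Rightarrow> nat \<Rightarrow> 'k::field"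
  shows "\<exists>B. finite B \<and> B \<subseteq> strand_kernel r a C b \<and> strand_kernel r a C b \<subseteq> vec.span B"
proof -
  let ?K = "strand_kernel r a C b"
  define e where "e i k = (if k = i then 1 else 0 :: 'k)" for i k :: nat
  have K: "?K \<subseteq> vec.span (e ` {..<r})"
  proof
    fix c assume "c \<in> ?K"
    then have "c k = 0" if "r \<le> k" for k
      using that unfolding strand_kernel_def by (metis (mono_tags, lifting) mem_Collect_eq not_le)
    then have "c = (\<Sum>i<r. (\<lambda>k. c i * e i k))"
      by (auto simp: fun_eq_iff sum_fun_apply e_def if_distrib[of "\<lambda>x. _ * x"] not_less cong: if_cong)
    moreover have "(\<Sum>i<r. (\<lambda>k. c i * e i k)) \<in> vec.span (e ` {..<r})"
      by (intro vec.span_sum vec.span_scale vec.span_base) auto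
    ultimately show "c \<in> vec.span (e ` {..<r})" by simp
  qed
  obtain B where B: "B \<subseteq> ?K" "\<not> vec.dependent B" "?K \<subseteq> vec.span B"
    using vec.maximal_independent_subset by blast
  have "finite B"
    using vec.independent_span_bound[of "e ` {..<r}" B] B K by blast
  with B show ?thesis by blast
qed

lemma finite_bounded_functions: "finite {b :: 'v::finite \<Rightarrow> nat. b \<le> L}"
proof -
  have "b v \<le> sum L UNIV" if "b \<le> L" for b v
    using le_funD[OF that, of v] member_le_sum[of v UNIV L] by simp
  then have "{b. b \<le> L} \<subseteq> {f. \<forall>x. (x \<in> UNIV \<longrightarrow> f x \<in> {..sum L UNIV}) \<and> (x \<notin> UNIV \<longrightarrow> f x = 0)}"
    by auto
  then show ?thesis by (rule finite_subset) (rule finite_set_of_finite_funs; simp)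
qed

lemma mat_apply_add: "mat_apply r M (c + c') = mat_apply r M c + mat_apply r M c'"
  by (simp add: mat_apply_def fun_eq_iff algebra_simps sum.distrib)

lemma mat_apply_scale: "mat_apply r M (\<lambda>k. p * c k) = (\<lambda>l. p * mat_apply r M c l)"
  by (simp add: mat_apply_def fun_eq_iff sum_distrib_left mult.assoc)

lemma mat_apply_unit:
  "i < r \<Longrightarrow> mat_apply r M (\<lambda>k. if k = i then 1 else 0) = M i"
  by (simp add: mat_apply_def if_distrib[of "\<lambda>x. x * _"] cong: if_cong)

lemma strand_sum:
  fixes f :: "nat \<Rightarrow> ('v::finite, 'k::field) mpoly"
  assumes "f \<in> free_vectors r"
  shows "f = (\<Sum>b\<in>(\<Union>k<r. (\<lambda>t v. a k v + Poly_Mapping.lookup t v) ` Poly_Mapping.keys (f k)).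
               (\<lambda>k. Poly_Mapping.single (monomial_of (\<lambda>v. b v - a k v)) (strand a b f k)))"
    (is "f = (\<Sum>b\<in>?B. ?g b)")
proof
  fix k
  show "f k = (\<Sum>b\<in>?B. ?g b) k"
  proof (rule poly_mapping_eqI)
    fix t
    let ?b = "\<lambda>v. a k v + Poly_Mapping.lookup t v"
    have zero: "Poly_Mapping.lookup (?g b k) t = 0" if "b \<noteq> ?b" for b
    proof (cases "a k \<le> b")
      case True
      have "monomial_of (\<lambda>v. b v - a k v) \<noteq> t"
      proof
        assume "monomial_of (\<lambda>v. b v - a k v) = t"
        then have "Poly_Mapping.lookup t v = b v - a k v" for v by auto
        then have "b = ?b" using True by (auto simp: fun_eq_iff le_fun_def)
        with that show False by simp
      qed
      then show ?thesis by (simp add: lookup_single)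
    qed (simp add: strand_def)
    have eq: "Poly_Mapping.lookup (?g ?b k) t = Poly_Mapping.lookup (f k) t"
      by (simp add: lookup_eq_strand[of f k t a] Poly_Mapping.lookup_inverse)
    show "Poly_Mapping.lookup (f k) t = Poly_Mapping.lookup ((\<Sum>b\<in>?B. ?g b) k) t"
    proof (cases "?b \<in> ?B")
      case True
      have "(\<Sum>b\<in>?B. Poly_Mapping.lookup (?g b k) t) = (\<Sum>b\<in>{?b}. Poly_Mapping.lookup (?g b k) t)"
        by (rule sum.mono_neutral_right) (use True zero in auto)
      then show ?thesis using eq by (simp add: sum_fun_apply lookup_sum)
    next
      case False
      have "Poly_Mapping.lookup (f k) t = 0"
      proof (cases "k < r")
        case True
        with False have "t \<notin> Poly_Mapping.keys (f k)" by blast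
        then show ?thesis by (simp add: in_keys_iff)
      next
        case False
        with assms show ?thesis by (simp add: free_vectors_def)
      qed
      moreover have "(\<Sum>b\<in>?B. Poly_Mapping.lookup (?g b k) t) = 0"
      proof (rule sum.neutral, rule ballI)
        fix b assume "b \<in> ?B"
        with False have "b \<noteq> ?b" by blast
        then show "Poly_Mapping.lookup (?g b k) t = 0" by (rule zero)
      qed
      ultimately show ?thesis by (simp add: sum_fun_apply lookup_sum)
    qed
  qed
qed

text \<open>The part of multidegree \<open>b\<close> of the kernel only depends on which generators have multidegree
  at most \<open>b\<close>.  Since all of these are at most \<open>L\<close>, it is the part of multidegree
  \<open>min b L\<close>, multiplied by a monomial.  Hence spanning sets of the finitely many parts
  with \<open>b \<le> L\<close> generate the kernel, and the bound \<open>L\<close> is inherited by the next step.\<close>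

lemma multigraded_syzygies:
  fixes C :: "nat \<Rightarrow> nat \<Rightarrow> 'k::field" and a a' :: "nat \<Rightarrow> 'v::finite \<Rightarrow> nat"
  assumes C: "\<And>k l. k < r' \<Longrightarrow> C k l \<noteq> 0 \<Longrightarrow> a l \<le> a' k"
    and L: "\<And>k. k < r' \<Longrightarrow> a' k \<le> L"
  shows "\<exists>r'' a'' C'. (\<forall>k<r''. a'' k \<le> L) \<and> (\<forall>k<r''. \<forall>l. C' k l \<noteq> 0 \<longrightarrow> l < r' \<and> a' l \<le> a'' k) \<and>
    {c \<in> free_vectors r'. mat_apply r' (multigraded_matrix a' a C) c = 0}
      = mat_apply r'' (multigraded_matrix a'' a' C') ` free_vectors r''"
proof -
  let ?K = "strand_kernel r' a' C"
  define B where "B b = (SOME B. finite B \<and> B \<subseteq> ?K b \<and> ?K b \<subseteq> vec.span B)" for b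
  have B: "finite (B b)" "B b \<subseteq> ?K b" "?K b \<subseteq> vec.span (B b)" for b
    using someI_ex[OF strand_kernel_finite_span[of r' a' C b]] by (simp_all add: B_def)
  have "finite (SIGMA b:{b. b \<le> L}. B b)" using finite_bounded_functions B(1) by auto
  then obtain xs where xs: "set xs = (SIGMA b:{b. b \<le> L}. B b)" using finite_list by blast
  define r'' where "r'' = length xs"
  define a'' where "a'' k = fst (xs ! k)" for k
  define C' where "C' k = snd (xs ! k)" for k
  let ?D = "mat_apply r' (multigraded_matrix a' a C)"
  let ?D' = "mat_apply r'' (multigraded_matrix a'' a' C')"
  have nth: "a'' k \<le> L" "C' k \<in> ?K (a'' k)" if "k < r''" for k
  proof -
    have "xs ! k \<in> set xs" using that by (simp add: r''_def)
    then obtain b e where "xs ! k = (b, e)" "b \<le> L" "e \<in> B b" unfolding xs by blast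
    then show "a'' k \<le> L" "C' k \<in> ?K (a'' k)"
      using B(2)[of b] by (auto simp: a''_def C'_def)
  qed
  have C': "l < r' \<and> a' l \<le> a'' k" if "k < r''" "C' k l \<noteq> 0" for k l
    using nth(2)[OF that(1)] that(2) by (auto simp: strand_kernel_def)
  have C'C: "(\<Sum>k<r'. C' m k * C k l) = 0" if "m < r''" for m l
    using nth(2)[OF that] by (auto simp: strand_kernel_def)
  define Im where "Im = ?D' ` free_vectors r''"
  have Im_add: "x + y \<in> Im" if "x \<in> Im" "y \<in> Im" for x y
  proof -
    from that obtain c d where "c \<in> free_vectors r''" "d \<in> free_vectors r''" "x = ?D' c" "y = ?D' d"
      by (auto simp: Im_def)
    then have "c + d \<in> free_vectors r''" "x + y = ?D' (c + d)"
      by (simp_all add: free_vectors_def mat_apply_add)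
    then show ?thesis by (auto simp: Im_def)
  qed
  have Im_scale: "(\<lambda>k. p * x k) \<in> Im" if "x \<in> Im" for x p
  proof -
    from that obtain c where "c \<in> free_vectors r''" "x = ?D' c" by (auto simp: Im_def)
    then have "(\<lambda>k. p * c k) \<in> free_vectors r''" "(\<lambda>k. p * x k) = ?D' (\<lambda>k. p * c k)"
      by (simp_all add: free_vectors_def mat_apply_scale)
    then show ?thesis by (auto simp: Im_def)
  qed
  have Im_0: "0 \<in> Im"
  proof -
    have "?D' 0 \<in> Im" unfolding Im_def by (rule imageI) (simp add: free_vectors_def)
    then show ?thesis by (simp add: mat_apply_0)
  qed
  have Im_sum: "(\<Sum>x\<in>X. f x) \<in> Im" if "\<And>x. x \<in> X \<Longrightarrow> f x \<in> Im" for X and f :: "('v \<Rightarrow> nat) \<Rightarrow> _"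
    using that by (induction X rule: infinite_finite_induct) (auto intro: Im_0 Im_add)
  define lift where "lift b c l = Poly_Mapping.single (monomial_of (\<lambda>v. b v - a' l v)) (c l)" for b and c :: "nat \<Rightarrow> 'k" and l
  have lift_Im: "lift b c \<in> Im" if "b \<le> L" "c \<in> ?K b" for b c
  proof -
    have "vec.span (B b) \<subseteq> {c. lift b c \<in> Im}"
    proof (rule vec.span_minimal)
      show "B b \<subseteq> {c. lift b c \<in> Im}"
      proof
        fix e assume "e \<in> B b"
        then have "(b, e) \<in> set xs" using that(1) by (simp add: xs)
        then obtain k where k: "k < r''" "xs ! k = (b, e)" by (auto simp: in_set_conv_nth r''_def)
        have "?D' (\<lambda>i. if i = k then 1 else 0) \<in> Im"
          unfolding Im_def by (rule imageI) (use k(1) in \<open>auto simp: free_vectors_def\<close>)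
        moreover have "?D' (\<lambda>i. if i = k then 1 else 0) = lift b e"
          unfolding mat_apply_unit[OF k(1)]
          by (simp add: fun_eq_iff multigraded_matrix_def lift_def a''_def C'_def k(2))
        ultimately show "e \<in> {c. lift b c \<in> Im}" by simp
      qed
      show "vec.subspace {c. lift b c \<in> Im}"
        unfolding vec.subspace_def
      proof (intro conjI ballI allI)
        have "lift b 0 = 0" by (simp add: fun_eq_iff lift_def)
        then show "0 \<in> {c. lift b c \<in> Im}" using Im_0 by simp
        fix c assume c: "c \<in> {c. lift b c \<in> Im}"
        show "c + d \<in> {c. lift b c \<in> Im}" if "d \<in> {c. lift b c \<in> Im}" for d
        proof -
          have "lift b (c + d) = lift b c + lift b d" by (simp add: fun_eq_iff lift_def single_add)
          then show ?thesis using c that Im_add by simp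
        qed
        show "(\<lambda>k. z * c k) \<in> {c. lift b c \<in> Im}" for z
        proof -
          have "lift b (\<lambda>k. z * c k) = (\<lambda>k. Poly_Mapping.single 0 z * lift b c k)"
            by (simp add: fun_eq_iff lift_def mult_single)
          then show ?thesis using c Im_scale by simp
        qed
      qed
    qed
    then show ?thesis using B(3) that(2) by blast
  qed
  have "{c \<in> free_vectors r'. ?D c = 0} = Im"
  proof (intro equalityI subsetI)
    fix f assume "f \<in> {c \<in> free_vectors r'. ?D c = 0}"
    then have f: "f \<in> free_vectors r'" "?D f = 0" by auto
    have "lift b (strand a' b f) \<in> Im" for b
    proof -
      \<comment> \<open>dividing by a monomial moves the part of multidegree \<open>b\<close> below the bound \<open>L\<close>\<close>
      let ?b = "\<lambda>v. min (b v) (L v)"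
      have "strand a' b f \<in> ?K ?b"
        unfolding strand_kernel_def
      proof (rule CollectI, intro conjI allI impI)
        fix k assume nz: "strand a' b f k \<noteq> 0"
        show "k < r'"
        proof (rule ccontr)
          assume "\<not> k < r'"
          then have "f k = 0" using f(1) by (simp add: free_vectors_def)
          with nz show False by (simp add: strand_zero)
        qed
        then show "a' k \<le> ?b" using nz L[of k] by (auto simp: strand_def le_fun_def split: if_splits)
      next
        fix l
        have "strand a b (?D f) l = 0" by (simp add: f(2) strand_def)
        then show "(\<Sum>k<r'. strand a' b f k * C k l) = 0"
          by (subst (asm) strand_mat_apply) (use C in auto)
      qed
      then have K: "strand a' b f \<in> ?K ?b" .
      then have "lift ?b (strand a' b f) \<in> Im" by (intro lift_Im) (auto simp: le_fun_def)
      then have "(\<lambda>k. Poly_Mapping.single (monomial_of (\<lambda>v. b v - ?b v)) 1 * lift ?b (strand a' b f) k) \<in> Im"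
        by (rule Im_scale)
      also have "(\<lambda>k. Poly_Mapping.single (monomial_of (\<lambda>v. b v - ?b v)) 1 * lift ?b (strand a' b f) k)
          = lift b (strand a' b f)"
      proof
        fix k
        show "Poly_Mapping.single (monomial_of (\<lambda>v. b v - ?b v)) 1 * lift ?b (strand a' b f) k
            = lift b (strand a' b f) k"
        proof (cases "strand a' b f k = 0")
          case False
          then have "a' k \<le> ?b" using K unfolding strand_kernel_def by blast
          then have le: "a' k v \<le> min (b v) (L v)" for v by (simp add: le_fun_def)
          have "monomial_of (\<lambda>v. b v - ?b v) + monomial_of (\<lambda>v. ?b v - a' k v) = monomial_of (\<lambda>v. b v - a' k v)"
          proof (rule poly_mapping_eqI)
            fix v
            show "Poly_Mapping.lookup (monomial_of (\<lambda>v. b v - ?b v) + monomial_of (\<lambda>v. ?b v - a' k v)) v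
              = Poly_Mapping.lookup (monomial_of (\<lambda>v. b v - a' k v)) v"
              using le[of v] by (simp add: lookup_add)
          qed
          then show ?thesis by (simp add: lift_def mult_single)
        qed (simp add: lift_def)
      qed
      finally show ?thesis .
    qed
    then have "(\<Sum>b\<in>(\<Union>k<r'. (\<lambda>t v. a' k v + Poly_Mapping.lookup t v) ` Poly_Mapping.keys (f k)).
        lift b (strand a' b f)) \<in> Im"
      by (rule Im_sum)
    then show "f \<in> Im" unfolding lift_def by (subst strand_sum[OF f(1), of a'])
  next
    fix x assume "x \<in> Im"
    then obtain f where f: "f \<in> free_vectors r''" "x = ?D' f" by (auto simp: Im_def)
    have "x l = 0" if "r' \<le> l" for l
    proof -
      have "C' k l = 0" if "k < r''" for k using C'[OF that, of l] \<open>r' \<le> l\<close> by (cases "C' k l = 0") auto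
      then show ?thesis by (simp add: f(2) mat_apply_def multigraded_matrix_def)
    qed
    then have "x \<in> free_vectors r'" by (simp add: free_vectors_def)
    moreover have "?D x l = 0" for l
    proof (rule strand_ext[of a])
      fix b
      have "strand a b (?D x) l = (\<Sum>k<r'. strand a' b x k * C k l)"
        by (rule strand_mat_apply) (use C in auto)
      also have "\<dots> = (\<Sum>k<r'. \<Sum>m<r''. strand a'' b f m * (C' m k * C k l))"
        unfolding f(2) by (subst strand_mat_apply) (use C' in \<open>auto simp: sum_distrib_right mult.assoc\<close>)
      also have "\<dots> = (\<Sum>m<r''. strand a'' b f m * (\<Sum>k<r'. C' m k * C k l))"
        by (subst sum.swap) (simp add: sum_distrib_left)
      also have "\<dots> = 0" using C'C by simp
      finally show "strand a b (?D x) l = 0" .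
    qed
    ultimately show "x \<in> {c \<in> free_vectors r'. ?D c = 0}" by (simp add: fun_eq_iff)
  qed
  then have "(\<forall>k<r''. a'' k \<le> L) \<and> (\<forall>k<r''. \<forall>l. C' k l \<noteq> 0 \<longrightarrow> l < r' \<and> a' l \<le> a'' k) \<and>
    {c \<in> free_vectors r'. ?D c = 0} = ?D' ` free_vectors r''"
    unfolding Im_def using nth(1) C' by simp
  then show ?thesis by (intro exI)
qed

lemma monomial_ideal_add: "p \<in> monomial_ideal D \<Longrightarrow> q \<in> monomial_ideal D \<Longrightarrow> p + q \<in> monomial_ideal D"
proof -
  assume pq: "p \<in> monomial_ideal D" "q \<in> monomial_ideal D"
  have "\<exists>m\<in>D. m \<le> Poly_Mapping.lookup t" if "t \<in> Poly_Mapping.keys (p + q)" for t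
  proof -
    have "t \<in> Poly_Mapping.keys p \<or> t \<in> Poly_Mapping.keys q" using subsetD[OF keys_add that] by (rule UnE) simp_all
    with pq show ?thesis unfolding monomial_ideal_def by (elim disjE) simp_all
  qed
  then show ?thesis by (simp add: monomial_ideal_def)
qed

lemma monomial_ideal_0: "0 \<in> monomial_ideal D"
  by (simp add: monomial_ideal_def)

lemma monomial_ideal_mult:
  assumes "q \<in> monomial_ideal D" shows "p * q \<in> monomial_ideal D"
  unfolding monomial_ideal_def
proof (rule CollectI, rule ballI)
  fix t assume "t \<in> Poly_Mapping.keys (p * q)"
  then obtain a b where t: "t = a + b" "b \<in> Poly_Mapping.keys q" using keys_mult[of p q] by auto
  from assms t(2) have "\<exists>m\<in>D. m \<le> Poly_Mapping.lookup b" unfolding monomial_ideal_def by simp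
  then obtain m where m: "m \<in> D" "m \<le> Poly_Mapping.lookup b" ..
  have "m v \<le> Poly_Mapping.lookup t v" for v
    using le_funD[OF m(2), of v] by (simp add: t(1) lookup_add)
  with m(1) show "\<exists>m\<in>D. m \<le> Poly_Mapping.lookup t" by (auto simp: le_fun_def)
qed

lemma monomial_ideal_sum: "(\<And>x. x \<in> A \<Longrightarrow> f x \<in> monomial_ideal D) \<Longrightarrow> (\<Sum>x\<in>A. f x) \<in> monomial_ideal D"
  by (induction A rule: infinite_finite_induct) (auto intro: monomial_ideal_0 monomial_ideal_add)

lemma poly_eq_sum_monomials:
  "p = (\<Sum>t\<in>Poly_Mapping.keys p. Poly_Mapping.single t (Poly_Mapping.lookup p t))"
proof (rule poly_mapping_eqI)
  fix s
  have "(\<Sum>t\<in>Poly_Mapping.keys p. Poly_Mapping.lookup (Poly_Mapping.single t (Poly_Mapping.lookup p t)) s)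
      = (\<Sum>t\<in>Poly_Mapping.keys p. if t = s then Poly_Mapping.lookup p s else 0)"
    by (rule sum.cong) (auto simp: lookup_single when_def)
  also have "\<dots> = Poly_Mapping.lookup p s" by (simp add: in_keys_iff)
  finally show "Poly_Mapping.lookup p s
      = Poly_Mapping.lookup (\<Sum>t\<in>Poly_Mapping.keys p. Poly_Mapping.single t (Poly_Mapping.lookup p t)) s"
    by (simp add: lookup_sum)
qed

lemma monomial_ideal_generators:
  fixes ms :: "('v::finite \<Rightarrow> nat) list"
  shows "(\<lambda>c. \<Sum>k<length ms. c k * Poly_Mapping.single (monomial_of (ms ! k)) 1) ` free_vectors (length ms)
    = (monomial_ideal (set ms) :: ('v, 'k::field) mpoly set)" (is "?A ` ?V = ?I")
proof (intro equalityI subsetI)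
  fix p assume "p \<in> ?A ` ?V"
  then obtain c where p: "p = ?A c" by blast
  show "p \<in> ?I" unfolding p
  proof (intro monomial_ideal_sum monomial_ideal_mult)
    fix k assume "k \<in> {..<length ms}"
    then show "Poly_Mapping.single (monomial_of (ms ! k)) 1 \<in> ?I"
      by (auto simp: monomial_ideal_def)
  qed
next
  fix p assume p: "p \<in> ?I"
  have "\<exists>k. k < length ms \<and> ms ! k \<le> Poly_Mapping.lookup t" if "t \<in> Poly_Mapping.keys p" for t
  proof -
    from that p obtain m where "m \<in> set ms" "m \<le> Poly_Mapping.lookup t"
      unfolding monomial_ideal_def by blast
    then show ?thesis unfolding in_set_conv_nth by blast
  qed
  then obtain \<kappa> where \<kappa>: "\<And>t. t \<in> Poly_Mapping.keys p \<Longrightarrow> \<kappa> t < length ms \<and> ms ! \<kappa> t \<le> Poly_Mapping.lookup t"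
    by metis
  \<comment> \<open>\<open>\<kappa> t\<close> selects a generator dividing the monomial \<open>t\<close>, and \<open>c k\<close> collects the cofactors of the \<open>k\<close>-th generator\<close>
  define c where "c k = (\<Sum>t\<in>{t \<in> Poly_Mapping.keys p. \<kappa> t = k}.
      Poly_Mapping.single (t - monomial_of (ms ! k)) (Poly_Mapping.lookup p t))" for k
  have "c k = 0" if "length ms \<le> k" for k
  proof -
    have empty: "{t \<in> Poly_Mapping.keys p. \<kappa> t = k} = {}"
    proof (intro equals0I, elim CollectE conjE)
      fix t assume "t \<in> Poly_Mapping.keys p" "\<kappa> t = k"
      with \<kappa>[of t] that show False by simp
    qed
    show ?thesis unfolding c_def empty by simp
  qed
  then have "c \<in> ?V" by (simp add: free_vectors_def)
  moreover have "?A c = p"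
  proof -
    have "?A c = (\<Sum>k<length ms. \<Sum>t\<in>{t \<in> Poly_Mapping.keys p. \<kappa> t = k}.
        Poly_Mapping.single t (Poly_Mapping.lookup p t))"
      unfolding c_def sum_distrib_right
    proof (intro sum.cong refl)
      fix k t assume "t \<in> {t \<in> Poly_Mapping.keys p. \<kappa> t = k}"
      then have "ms ! k \<le> Poly_Mapping.lookup t" using \<kappa> by auto
      then have "t - monomial_of (ms ! k) + monomial_of (ms ! k) = t"
        by (intro poly_mapping_eqI) (simp add: lookup_add lookup_minus le_fun_def)
      then show "Poly_Mapping.single (t - monomial_of (ms ! k)) (Poly_Mapping.lookup p t) *
          Poly_Mapping.single (monomial_of (ms ! k)) 1 = Poly_Mapping.single t (Poly_Mapping.lookup p t)"
        by (simp add: mult_single)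
    qed
    also have "\<dots> = (\<Sum>t\<in>Poly_Mapping.keys p. Poly_Mapping.single t (Poly_Mapping.lookup p t))"
      by (rule sum.group) (use \<kappa> in auto)
    also have "\<dots> = p" by (rule poly_eq_sum_monomials[symmetric])
    finally show ?thesis .
  qed
  ultimately show "p \<in> ?A ` ?V" by (intro image_eqI[where x = c]) simp_all
qed

lemma homogeneous_multigraded_matrix:
  assumes "C k l \<noteq> 0 \<Longrightarrow> a l \<le> a' k"
  shows "homogeneous (int (sum (a' k) UNIV) - int (sum (a l) UNIV)) (multigraded_matrix a' a C k l)"
proof (cases "C k l = 0")
  case False
  with assms have le: "a l v \<le> a' k v" for v by (simp add: le_fun_def)
  have "sum (a' k) UNIV = (\<Sum>v\<in>UNIV. (a' k v - a l v) + a l v)" using le by simp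
  then show ?thesis using False by (simp add: homogeneous_def multigraded_matrix_def mon_degree_def sum.distrib)
qed (simp add: multigraded_matrix_def homogeneous_0)

text \<open>The state of the iteration consists of the multidegrees of the target, the rank and the
  multidegrees of the source, and the scalars of the map.  The first state maps the generators of the
  ideal to the polynomial ring, seen as a free module with one generator of multidegree \<open>0\<close>.\<close>

lemma monomial_ideal_resolution:
  fixes D :: "('v::finite \<Rightarrow> nat) set"
  assumes "finite D"
  shows "\<exists>F. graded_free_resolution (monomial_ideal D :: ('v, 'k::field) mpoly set) F"
proof -
  obtain ms where ms: "set ms = D" using finite_list[OF assms] by blast
  \<comment> \<open>any common multiple of the generators serves as the bound\<close>
  define L where "L v = (\<Sum>m\<in>D. m v)" for v
  have L: "m \<le> L" if "m \<in> D" for m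
    using member_le_sum[OF that, of "\<lambda>m. m _"] assms by (simp add: le_fun_def L_def)
  define P :: "(nat \<Rightarrow> 'v \<Rightarrow> nat) \<times> nat \<times> (nat \<Rightarrow> 'v \<Rightarrow> nat) \<times> (nat \<Rightarrow> nat \<Rightarrow> 'k) \<Rightarrow> bool" where
    "P = (\<lambda>(a, r', a', C). (\<forall>k<r'. a' k \<le> L) \<and> (\<forall>k<r'. \<forall>l. C k l \<noteq> 0 \<longrightarrow> a l \<le> a' k))"
  define Q :: "(nat \<Rightarrow> 'v \<Rightarrow> nat) \<times> nat \<times> (nat \<Rightarrow> 'v \<Rightarrow> nat) \<times> (nat \<Rightarrow> nat \<Rightarrow> 'k) \<Rightarrow>
      (nat \<Rightarrow> 'v \<Rightarrow> nat) \<times> nat \<times> (nat \<Rightarrow> 'v \<Rightarrow> nat) \<times> (nat \<Rightarrow> nat \<Rightarrow> 'k) \<Rightarrow> bool" where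
    "Q = (\<lambda>(a, r', a', C) (b, r'', a'', C'). b = a' \<and>
      (\<forall>k<r''. \<forall>l. C' k l \<noteq> 0 \<longrightarrow> l < r') \<and>
      {c \<in> free_vectors r'. mat_apply r' (multigraded_matrix a' a C) c = 0}
      = mat_apply r'' (multigraded_matrix a'' a' C') ` free_vectors r'')"
  define s0 :: "(nat \<Rightarrow> 'v \<Rightarrow> nat) \<times> nat \<times> (nat \<Rightarrow> 'v \<Rightarrow> nat) \<times> (nat \<Rightarrow> nat \<Rightarrow> 'k)" where
    "s0 = (\<lambda>_ _. 0, length ms, \<lambda>k. ms ! k, \<lambda>k l. if l = 0 then 1 else 0)"
  have P0: "P s0" using L ms by (auto simp: P_def s0_def le_fun_def)
  have step: "\<exists>y. P y \<and> Q x y" if "P x" for x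
  proof -
    obtain a r' a' C where x: "x = (a, r', a', C)" using prod_cases4 by blast
    have "\<exists>r'' a'' C'. (\<forall>k<r''. a'' k \<le> L) \<and> (\<forall>k<r''. \<forall>l. C' k l \<noteq> 0 \<longrightarrow> l < r' \<and> a' l \<le> a'' k) \<and>
      {c \<in> free_vectors r'. mat_apply r' (multigraded_matrix a' a C) c = 0}
      = mat_apply r'' (multigraded_matrix a'' a' C') ` free_vectors r''"
      by (rule multigraded_syzygies) (use that in \<open>auto simp: P_def x\<close>)
    then obtain r'' a'' C' where new: "(\<forall>k<r''. a'' k \<le> L) \<and>
      (\<forall>k<r''. \<forall>l. C' k l \<noteq> 0 \<longrightarrow> l < r' \<and> a' l \<le> a'' k) \<and>
      {c \<in> free_vectors r'. mat_apply r' (multigraded_matrix a' a C) c = 0}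
      = mat_apply r'' (multigraded_matrix a'' a' C') ` free_vectors r''"
      by (elim exE) (rule that)
    then have "P (a', r'', a'', C') \<and> Q x (a', r'', a'', C')"
      unfolding P_def Q_def x by simp
    then show ?thesis ..
  qed
  have "\<exists>f. \<forall>n. (P (f n) \<and> (n = 0 \<longrightarrow> f n = s0)) \<and> Q (f n) (f (Suc n))"
  proof (rule dependent_nat_choice)
    show "\<exists>x. P x \<and> (0 = (0::nat) \<longrightarrow> x = s0)" using P0 by blast
    show "\<exists>y. (P y \<and> (Suc n = 0 \<longrightarrow> y = s0)) \<and> Q x y" if "P x \<and> (n = 0 \<longrightarrow> x = s0)" for x n
      using step[of x] that by blast
  qed
  then obtain f where "\<forall>n. (P (f n) \<and> (n = 0 \<longrightarrow> f n = s0)) \<and> Q (f n) (f (Suc n))" ..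
  then have f: "P (f n)" "f 0 = s0" "Q (f n) (f (Suc n))" for n by blast+
  define a where "a n = fst (f n)" for n
  define r where "r n = fst (snd (f n))" for n
  define C where "C n = snd (snd (snd (f n)))" for n
  have fn: "f n = (a n, r n, a (Suc n), C n)" for n
    using f(3)[of n] by (auto simp: a_def r_def C_def Q_def split: prod.splits)
  have le: "a n l \<le> a (Suc n) k" if "k < r n" "C n k l \<noteq> 0" for n k l
    using f(1)[of n] that unfolding fn P_def by auto
  have bound: "l < r n" if "k < r (Suc n)" "C (Suc n) k l \<noteq> 0" for n k l
    using f(3)[of n] that unfolding fn Q_def by auto
  have exact: "{c \<in> free_vectors (r n). mat_apply (r n) (multigraded_matrix (a (Suc n)) (a n) (C n)) c = 0}
      = mat_apply (r (Suc n)) (multigraded_matrix (a (Suc (Suc n))) (a (Suc n)) (C (Suc n))) ` free_vectors (r (Suc n))" for n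
    using f(3)[of n] unfolding fn Q_def by auto
  have zero: "a 0 = (\<lambda>_ _. 0)" "r 0 = length ms" "a (Suc 0) = (\<lambda>k. ms ! k)" "C 0 = (\<lambda>k l. if l = 0 then 1 else 0)"
    using f(2) fn[of 0] by (auto simp: s0_def)
  define F :: "('v, 'k) free_complex" where
    "F = \<lparr>rnk = r, shft = (\<lambda>i k. int (sum (a (Suc i) k) UNIV)),
          diff = (\<lambda>i. multigraded_matrix (a (Suc (Suc i))) (a (Suc i)) (C (Suc i))),
          aug = (\<lambda>k. multigraded_matrix (a (Suc 0)) (a 0) (C 0) k 0)\<rparr>"
  have F: "rnk F = r" "shft F i k = int (sum (a (Suc i) k) UNIV)"
    "diff F i = multigraded_matrix (a (Suc (Suc i))) (a (Suc i)) (C (Suc i))"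
    "aug F k = multigraded_matrix (a (Suc 0)) (a 0) (C 0) k 0" for i k
    by (simp_all add: F_def)
  have aug_eq: "augmentation F c = (\<Sum>k<length ms. c k * Poly_Mapping.single (monomial_of (ms ! k)) 1)" for c
    by (simp add: augmentation_def F zero multigraded_matrix_def)
  have aug_mat: "mat_apply (r 0) (multigraded_matrix (a (Suc 0)) (a 0) (C 0)) c
      = (\<lambda>l. if l = 0 then augmentation F c else 0)" for c
    by (auto simp: fun_eq_iff mat_apply_def augmentation_def F zero multigraded_matrix_def)
  have "graded_free_resolution (monomial_ideal D) F"
    unfolding graded_free_resolution_def
  proof (intro conjI allI impI)
    fix k assume "k < rnk F 0"
    then show "homogeneous (shft F 0 k) (aug F k)"
      using homogeneous_multigraded_matrix[of "C 0" k 0 "a 0" "a (Suc 0)"] le[of k 0 0] by (simp add: F zero)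
  next
    fix i k l assume "k < rnk F (Suc i)" "l < rnk F i"
    then show "homogeneous (shft F (Suc i) k - shft F i l) (diff F i k l)"
      unfolding F by (intro homogeneous_multigraded_matrix le) auto
  next
    fix i k l assume "k < rnk F (Suc i)" "rnk F i \<le> l"
    then have "C (Suc i) k l = 0" using bound[of k i l] unfolding F by fastforce
    then show "diff F i k l = 0" by (simp add: F multigraded_matrix_def)
  next
    show "augmentation F ` free_vectors (rnk F 0) = monomial_ideal D"
      unfolding aug_eq F zero monomial_ideal_generators ms ..
  next
    have "augmentation F c = 0 \<longleftrightarrow> mat_apply (r 0) (multigraded_matrix (a (Suc 0)) (a 0) (C 0)) c = 0" for c
      unfolding aug_mat by (auto simp: fun_eq_iff)
    then show "{c \<in> free_vectors (rnk F 0). augmentation F c = 0} = differential F 0 ` free_vectors (rnk F 1)"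
      using exact[of 0] by (simp add: differential_def F)
  next
    fix i
    show "{c \<in> free_vectors (rnk F (Suc i)). differential F i c = 0}
       = differential F (Suc i) ` free_vectors (rnk F (Suc (Suc i)))"
      using exact[of "Suc i"] by (simp add: differential_def F)
  qed
  then show ?thesis by blast
qed

lemma linear_quotients_linear_resolution:
  fixes D :: "('v::finite \<Rightarrow> nat) set"
  assumes "finite D" "linear_quotients D" "\<And>m. m \<in> D \<Longrightarrow> sum m UNIV = d"
  shows "has_linear_resolution (monomial_ideal D :: ('v, 'k::field) mpoly set)"
  unfolding has_linear_resolution_def
proof (intro exI[of _ "int d"] allI impI)
  fix i and b :: int assume "b \<noteq> int d"
  then have j: "int i + b \<noteq> int d + int i" by linarith
  have "tensor_homology_dim F i (int i + b) = 0"
    if "graded_free_resolution (monomial_ideal D :: ('v, 'k) mpoly set) F" for F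
    by (rule linear_quotients_tensor_homology[OF that assms(2) _ j]) (rule assms(3))
  moreover have "graded_free_resolution (monomial_ideal D :: ('v, 'k) mpoly set)
      (SOME F. graded_free_resolution (monomial_ideal D) F)"
    by (rule someI_ex) (rule monomial_ideal_resolution[OF assms(1)])
  ultimately show "graded_betti (monomial_ideal D :: ('v, 'k) mpoly set) i (int i + b) = 0"
    unfolding graded_betti_def by blast
qed

section \<open>Weighted covers of a forest with a whisker\<close>

lemma ideal_gen_sum: "(\<And>x. x \<in> A \<Longrightarrow> f x \<in> ideal_gen B) \<Longrightarrow> sum f A \<in> ideal_gen B"
  unfolding ideal_gen_def by (rule module.span_sum[OF module_times])

lemma monomial_factor:
  fixes s t :: "'v \<Rightarrow>\<^sub>0 nat"
  assumes "Poly_Mapping.lookup s \<le> Poly_Mapping.lookup t"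
  shows "Poly_Mapping.single t (c::'k::field) = Poly_Mapping.single (t - s) c * Poly_Mapping.single s 1"
proof -
  have "t - s + s = t"
  proof (rule poly_mapping_eqI)
    fix v show "Poly_Mapping.lookup (t - s + s) v = Poly_Mapping.lookup t v"
      using le_funD[OF assms, of v] by (simp add: lookup_add lookup_minus)
  qed
  then show ?thesis by (simp add: mult_single)
qed

lemma keys_ideal_power_ge:
  fixes p :: "('v::finite, 'k::field) mpoly"
  assumes "p \<in> ideal_power (var_ideal A) s" "t \<in> Poly_Mapping.keys p"
  shows "s \<le> sum (Poly_Mapping.lookup t) A"
  using assms
proof (induction s arbitrary: p t)
  case (Suc s)
  have var: "1 \<le> sum (Poly_Mapping.lookup t) A"
    if "a \<in> (var_ideal A :: ('v, 'k) mpoly set)" "t \<in> Poly_Mapping.keys a" for a t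
    using that unfolding var_ideal_def
  proof (induction a arbitrary: t rule: ideal_gen_induct)
    case base
    then show ?case by simp
  next
    case (step c x y)
    from subsetD[OF keys_add step.prems] consider "t \<in> Poly_Mapping.keys (c * x)" | "t \<in> Poly_Mapping.keys y" by blast
    then show ?case
    proof cases
      case 1
      obtain v where v: "v \<in> A" "x = Var v" using step.hyps by blast
      obtain b where "t = b + Poly_Mapping.single v 1"
        using subsetD[OF keys_mult 1] v by (auto simp: Var_def split: if_splits)
      then have "1 \<le> Poly_Mapping.lookup t v" by (simp add: lookup_add)
      also have "\<dots> \<le> sum (Poly_Mapping.lookup t) A" by (rule member_le_sum) (use v in auto)
      finally show ?thesis .
    next
      case 2
      then show ?thesis by (rule step.IH)
    qed
  qed
  have mult: "Suc s \<le> sum (Poly_Mapping.lookup t) A"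
    if ab: "a \<in> (var_ideal A :: ('v, 'k) mpoly set)" "b \<in> ideal_power (var_ideal A) s"
      "t \<in> Poly_Mapping.keys (c * (a * b))" for a b c t
  proof -
    obtain t1 t2 where t: "t = t1 + t2" "t2 \<in> Poly_Mapping.keys (a * b)" using subsetD[OF keys_mult ab(3)] by auto
    obtain t3 t4 where t': "t2 = t3 + t4" "t3 \<in> Poly_Mapping.keys a" "t4 \<in> Poly_Mapping.keys b"
      using subsetD[OF keys_mult t(2)] by auto
    show ?thesis using var[OF ab(1) t'(2)] Suc.IH[OF ab(2) t'(3)]
      by (simp add: t(1) t'(1) lookup_add sum.distrib)
  qed
  have "p \<in> ideal_gen {a * b | a b. a \<in> var_ideal A \<and> b \<in> ideal_power (var_ideal A) s}"
    using Suc.prems(1) by (simp add: ideal_mult_def)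
  then show ?case using Suc.prems(2)
  proof (induction p arbitrary: t rule: ideal_gen_induct)
    case base
    then show ?case by simp
  next
    case (step c x y)
    from subsetD[OF keys_add step.prems] consider "t \<in> Poly_Mapping.keys (c * x)" | "t \<in> Poly_Mapping.keys y" by blast
    then show ?case
    proof cases
      case 1
      then show ?thesis using step.hyps mult by auto
    next
      case 2
      then show ?thesis by (rule step.IH)
    qed
  qed
qed simp

lemma monomial_in_ideal_power:
  fixes t :: "'v::finite \<Rightarrow>\<^sub>0 nat"
  assumes "s \<le> sum (Poly_Mapping.lookup t) A"
  shows "Poly_Mapping.single t (c::'k::field) \<in> ideal_power (var_ideal A) s"
  using assms
proof (induction s arbitrary: t c)
  case (Suc s)
  have "\<exists>v\<in>A. 0 < Poly_Mapping.lookup t v"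
  proof (rule ccontr)
    assume "\<not> ?thesis"
    then have "sum (Poly_Mapping.lookup t) A = 0" by simp
    with Suc.prems show False by simp
  qed
  then obtain v where v: "v \<in> A" "0 < Poly_Mapping.lookup t v" ..
  let ?t = "t - Poly_Mapping.single v 1"
  have le: "Poly_Mapping.lookup (Poly_Mapping.single v 1) \<le> Poly_Mapping.lookup t"
    using v(2) by (auto simp: le_fun_def lookup_single when_def)
  have "sum (Poly_Mapping.lookup t) A = sum (Poly_Mapping.lookup ?t) A + (\<Sum>u\<in>A. if v = u then 1 else 0)"
    unfolding sum.distrib[symmetric]
    by (rule sum.cong) (use v(2) in \<open>auto simp: lookup_minus lookup_single when_def\<close>)
  then have "s \<le> sum (Poly_Mapping.lookup ?t) A" using Suc.prems v(1) by simp
  then have "Poly_Mapping.single ?t c \<in> ideal_power (var_ideal A) s" by (rule Suc.IH)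
  moreover have "Var v \<in> (var_ideal A :: ('v, 'k) mpoly set)"
    unfolding var_ideal_def using v(1) by (intro ideal_gen_base) simp
  ultimately have "Var v * Poly_Mapping.single ?t c \<in> ideal_power (var_ideal A) (Suc s)"
    unfolding ideal_power.simps ideal_mult_def by (intro ideal_gen_base) blast
  also have "Var v * Poly_Mapping.single ?t c = Poly_Mapping.single t c"
    using monomial_factor[OF le, of c] by (simp add: Var_def mult.commute)
  finally show ?case .
qed simp

text \<open>Both sides are spanned by monomials, so it suffices to compare the monomials they contain.\<close>

lemma ideal_power_var_ideal:
  fixes A :: "'v::finite set"
  shows "ideal_power (var_ideal A) s
    = {p :: ('v, 'k::field) mpoly. \<forall>t\<in>Poly_Mapping.keys p. s \<le> sum (Poly_Mapping.lookup t) A}"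
proof (intro equalityI subsetI)
  fix p :: "('v, 'k) mpoly"
  assume "p \<in> {p. \<forall>t\<in>Poly_Mapping.keys p. s \<le> sum (Poly_Mapping.lookup t) A}"
  then have mono: "Poly_Mapping.single t (Poly_Mapping.lookup p t) \<in> ideal_power (var_ideal A) s"
    if "t \<in> Poly_Mapping.keys p" for t
    using that by (intro monomial_in_ideal_power) simp
  show "p \<in> ideal_power (var_ideal A) s"
  proof (cases s)
    case (Suc s')
    have "(\<Sum>t\<in>Poly_Mapping.keys p. Poly_Mapping.single t (Poly_Mapping.lookup p t)) \<in> ideal_power (var_ideal A) s"
      using mono unfolding Suc ideal_power.simps ideal_mult_def by (rule ideal_gen_sum)
    then show ?thesis using poly_eq_sum_monomials[of p] by simp
  qed simp
qed (simp add: keys_ideal_power_ge)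

lemma monomial_ideal_eq_ideal_gen:
  fixes D :: "('v::finite \<Rightarrow> nat) set"
  assumes B: "B \<subseteq> monomial_ideal D"
    and D: "\<And>m. m \<in> D \<Longrightarrow> Poly_Mapping.single (monomial_of m) 1 \<in> B"
  shows "ideal_gen B = (monomial_ideal D :: ('v, 'k::field) mpoly set)"
proof (intro equalityI subsetI)
  fix p assume "p \<in> ideal_gen B"
  then show "p \<in> monomial_ideal D"
  proof (induction p rule: ideal_gen_induct)
    case base
    then show ?case by (rule monomial_ideal_0)
  next
    case (step c x y)
    then show ?case using B by (intro monomial_ideal_add monomial_ideal_mult) auto
  qed
next
  fix p :: "('v, 'k) mpoly" assume p: "p \<in> monomial_ideal D"
  have "(\<Sum>t\<in>Poly_Mapping.keys p. Poly_Mapping.single t (Poly_Mapping.lookup p t)) \<in> ideal_gen B"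
  proof (rule ideal_gen_sum)
    fix t assume "t \<in> Poly_Mapping.keys p"
    with p have "\<exists>m\<in>D. m \<le> Poly_Mapping.lookup t" by (simp add: monomial_ideal_def)
    then obtain m where m: "m \<in> D" "m \<le> Poly_Mapping.lookup t" ..
    then have le: "Poly_Mapping.lookup (monomial_of m) \<le> Poly_Mapping.lookup t" by simp
    show "Poly_Mapping.single t (Poly_Mapping.lookup p t) \<in> ideal_gen B"
      by (subst monomial_factor[OF le, of "Poly_Mapping.lookup p t"]) (rule ideal_gen_scale, rule ideal_gen_base, rule D, rule m(1))
  qed
  then show "p \<in> ideal_gen B" using poly_eq_sum_monomials[of p] by simp
qed

definition weighted_covers :: "'v set set \<Rightarrow> nat \<Rightarrow> ('v \<Rightarrow> nat) set" where
  "weighted_covers E s = {a. \<forall>u v. {u, v} \<in> E \<longrightarrow> s \<le> a u + a v}"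

text \<open>All ideals involved are spanned by monomials, and a monomial lies in the \<open>s\<close>-th power of the
  ideal of an edge when its exponents at the two ends add up to at least \<open>s\<close>.\<close>

lemma degree_component_symbolic_power:
  fixes E :: "'v::finite set set"
  assumes "simple_graph UNIV E"
  shows "degree_component_ideal (symbolic_power (vertex_cover_ideal E :: ('v, 'k::field) mpoly set) s) j
    = monomial_ideal {a \<in> weighted_covers E s. int (sum a UNIV) = j}"
proof -
  have edge: "\<exists>u v. u \<noteq> v \<and> e = {u, v}" if "e \<in> E" for e
    using assms that unfolding simple_graph_def by blast
  have noloop: "u \<noteq> v" if "{u, v} \<in> E" for u v
    using edge[OF that] by (auto simp: doubleton_eq_iff)
  have covers: "(\<forall>e\<in>E. s \<le> sum a e) \<longleftrightarrow> a \<in> weighted_covers E s" for a :: "'v \<Rightarrow> nat"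
  proof
    assume *: "\<forall>e\<in>E. s \<le> sum a e"
    show "a \<in> weighted_covers E s"
      unfolding weighted_covers_def
    proof (intro CollectI allI impI)
      fix u v assume uv: "{u, v} \<in> E"
      then show "s \<le> a u + a v" using * noloop[OF uv] by fastforce
    qed
  next
    assume *: "a \<in> weighted_covers E s"
    show "\<forall>e\<in>E. s \<le> sum a e"
    proof
      fix e assume "e \<in> E"
      with edge obtain u v where "u \<noteq> v" "e = {u, v}" by blast
      with * \<open>e \<in> E\<close> show "s \<le> sum a e" by (simp add: weighted_covers_def)
    qed
  qed
  have symb: "symbolic_power (vertex_cover_ideal E :: ('v, 'k) mpoly set) s
      = {p. \<forall>t\<in>Poly_Mapping.keys p. Poly_Mapping.lookup t \<in> weighted_covers E s}"
    unfolding symbolic_power_vertex_cover_ideal[OF assms] ideal_power_var_ideal covers[symmetric] by auto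
  show ?thesis
    unfolding degree_component_ideal_def symb
  proof (rule monomial_ideal_eq_ideal_gen)
    show "{f \<in> {p. \<forall>t\<in>Poly_Mapping.keys p. Poly_Mapping.lookup t \<in> weighted_covers E s}. homogeneous j f}
        \<subseteq> monomial_ideal {a \<in> weighted_covers E s. int (sum a UNIV) = j}"
      by (auto simp: monomial_ideal_def homogeneous_def mon_degree_def)
  qed (auto simp: homogeneous_def mon_degree_def)
qed

text \<open>The covers of total weight \<open>d\<close> with lower bounds \<open>l\<close>, where the bound is attained at all
  vertices outside \<open>W\<close>: these vertices have been decided.\<close>

definition cover_slice :: "'v set set \<Rightarrow> nat \<Rightarrow> nat \<Rightarrow> 'v set \<Rightarrow> ('v \<Rightarrow> nat) \<Rightarrow> ('v::finite \<Rightarrow> nat) set" where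
  "cover_slice E s d W l =
     {a \<in> weighted_covers E s. sum a UNIV = d \<and> (\<forall>v. l v \<le> a v) \<and> (\<forall>v. v \<notin> W \<longrightarrow> a v = l v)}"

text \<open>The bounds that the edges at \<open>x\<close> impose on the neighbours of \<open>x\<close> once the weight of \<open>x\<close> is \<open>l x\<close>.\<close>

definition push_bounds :: "'v set set \<Rightarrow> nat \<Rightarrow> 'v \<Rightarrow> ('v \<Rightarrow> nat) \<Rightarrow> 'v \<Rightarrow> nat" where
  "push_bounds E s x l u = (if {u, x} \<in> E then max (l u) (s - l x) else l u)"

text \<open>Covers above the bound at \<open>x\<close> are listed before those that attain it.  Passing from the
  second kind to the first raises the exponent of \<open>x\<close>, so a single exchange that raises \<open>x\<close> serves
  for all pairs.  The weight is taken from a vertex \<open>y\<close> above its bound all of whose edges,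
  except possibly the one to \<open>x\<close>, are satisfied by the bounds alone.\<close>

lemma cover_slice_branch:
  fixes E :: "'v::finite set set"
  assumes x: "x \<in> W" and noloop: "{x, x} \<notin> E"
    and active: "\<And>u v. {u, v} \<in> E \<Longrightarrow> l u + l v < s \<Longrightarrow> u \<in> W"
    and raised: "linear_quotients (cover_slice E s d W (l(x := Suc (l x))))"
    and fixed: "linear_quotients (cover_slice E s d (W - {x}) (push_bounds E s x l))"
    and exch: "\<And>a b. a \<in> cover_slice E s d W (l(x := Suc (l x))) \<Longrightarrow> b \<in> cover_slice E s d W l \<Longrightarrow> b x = l x \<Longrightarrow>
      \<exists>y\<in>W. y \<noteq> x \<and> l y < b y \<and> (\<forall>u. {u, y} \<in> E \<longrightarrow> u \<noteq> x \<longrightarrow> s \<le> l u + l y)"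
  shows "linear_quotients (cover_slice E s d W l)"
proof -
  let ?A = "cover_slice E s d W (l(x := Suc (l x)))"
  let ?l = "push_bounds E s x l"
  let ?B = "cover_slice E s d (W - {x}) ?l"
  have lx: "?l x = l x" using noloop by (simp add: push_bounds_def)
  have lW: "?l v = l v" if "v \<notin> W" for v
    using active[of v x] that by (cases "l v + l x < s") (auto simp: push_bounds_def max_def)
  have le: "l v \<le> ?l v" for v by (simp add: push_bounds_def)
  have B: "?B = {a \<in> cover_slice E s d W l. a x = l x}"
  proof (intro equalityI subsetI)
    fix a assume "a \<in> ?B"
    then have a: "a \<in> weighted_covers E s" "sum a UNIV = d" "\<And>v. ?l v \<le> a v" "\<And>v. v \<notin> W - {x} \<Longrightarrow> a v = ?l v"
      by (auto simp: cover_slice_def)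
    have "l v \<le> a v" for v using le[of v] a(3)[of v] by simp
    moreover have "a v = l v" if "v \<notin> W" for v using a(4)[of v] lW[OF that] that by simp
    moreover have "a x = l x" using a(4)[of x] lx by simp
    ultimately show "a \<in> {a \<in> cover_slice E s d W l. a x = l x}" using a(1,2) by (simp add: cover_slice_def)
  next
    fix a assume "a \<in> {a \<in> cover_slice E s d W l. a x = l x}"
    then have a: "a \<in> weighted_covers E s" "sum a UNIV = d" "\<And>v. l v \<le> a v" "\<And>v. v \<notin> W \<Longrightarrow> a v = l v" "a x = l x"
      by (auto simp: cover_slice_def)
    have "?l v \<le> a v" for v
    proof -
      have "{v, x} \<in> E \<Longrightarrow> s \<le> a v + a x" using a(1) by (auto simp: weighted_covers_def)
      then show ?thesis using a(3)[of v] a(5) by (auto simp: push_bounds_def)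
    qed
    moreover have "a v = ?l v" if "v \<notin> W - {x}" for v
      using that a(4)[of v] a(5) lx lW[of v] by (cases "v = x") auto
    ultimately show "a \<in> ?B" using a(1,2) by (simp add: cover_slice_def)
  qed
  have A: "?A = {a \<in> cover_slice E s d W l. a x \<noteq> l x}"
  proof (intro equalityI subsetI)
    fix a assume "a \<in> ?A"
    then have a: "a \<in> weighted_covers E s" "sum a UNIV = d" "\<And>v. (l(x := Suc (l x))) v \<le> a v"
       "\<And>v. v \<notin> W \<Longrightarrow> a v = (l(x := Suc (l x))) v"
      by (auto simp: cover_slice_def simp del: fun_upd_apply)
    have "l v \<le> a v" for v using a(3)[of v] by (cases "v = x") auto
    moreover have "a v = l v" if "v \<notin> W" for v using a(4)[OF that] x that by auto
    moreover have "a x \<noteq> l x" using a(3)[of x] by simp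
    ultimately show "a \<in> {a \<in> cover_slice E s d W l. a x \<noteq> l x}" using a(1,2) by (simp add: cover_slice_def)
  next
    fix a assume "a \<in> {a \<in> cover_slice E s d W l. a x \<noteq> l x}"
    then have a: "a \<in> weighted_covers E s" "sum a UNIV = d" "\<And>v. l v \<le> a v" "\<And>v. v \<notin> W \<Longrightarrow> a v = l v" "a x \<noteq> l x"
      by (auto simp: cover_slice_def)
    have "(l(x := Suc (l x))) v \<le> a v" for v
      using a(3)[of v] a(5) by auto
    moreover have "a v = (l(x := Suc (l x))) v" if "v \<notin> W" for v
      using a(4)[OF that] that x by auto
    ultimately show "a \<in> ?A" using a(1,2) by (simp add: cover_slice_def)
  qed
  have "linear_quotients (?A \<union> ?B)"
  proof (rule linear_quotients_Un[OF fixed raised])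
    fix a b assume ab: "a \<in> ?A" "b \<in> ?B"
    then have b: "b \<in> cover_slice E s d W l" "b x = l x" using B by auto
    obtain y where y: "y \<in> W" "y \<noteq> x" "l y < b y"
      and loose: "\<And>u. {u, y} \<in> E \<Longrightarrow> u \<noteq> x \<Longrightarrow> s \<le> l u + l y"
      using exch[OF ab(1) b] by blast
    have bs: "sum b UNIV = d" "\<And>v. l v \<le> b v" "\<And>v. v \<notin> W \<Longrightarrow> b v = l v" "\<And>u v. {u, v} \<in> E \<Longrightarrow> s \<le> b u + b v"
      using b(1) by (auto simp: cover_slice_def weighted_covers_def)
    let ?c = "b(x := Suc (b x), y := b y - 1)"
    have cl: "l v \<le> ?c v" for v using y bs(2)[of v] by (auto simp: le_Suc_eq)
    have "s \<le> ?c u + ?c v" if e: "{u, v} \<in> E" for u v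
    proof -
      have e': "{v, u} \<in> E" using e by (simp add: insert_commute)
      consider "u = y" "v = x" | "u = x" "v = y" | "u = y" "v \<noteq> x" | "v = y" "u \<noteq> x" | "u \<noteq> y" "v \<noteq> y" by blast
      then show ?thesis
      proof cases
        case 3
        then show ?thesis using loose[of v] e' cl[of u] cl[of v] by force
      next
        case 4
        then show ?thesis using loose[of u] e cl[of u] cl[of v] by force
      qed (use bs(4)[OF e] y in auto)
    qed
    moreover have "sum ?c UNIV = d"
    proof -
      have "sum ?c UNIV = ?c x + (?c y + sum ?c (UNIV - {x} - {y}))"
        using y(2) by (simp add: sum.remove[of _ x] sum.remove[of _ y] del: fun_upd_apply)
      also have "sum ?c (UNIV - {x} - {y}) = sum b (UNIV - {x} - {y})"
        by (rule sum.cong) auto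
      also have "?c x + (?c y + sum b (UNIV - {x} - {y})) = b x + (b y + sum b (UNIV - {x} - {y}))"
        using y by auto
      also have "\<dots> = sum b UNIV"
        using y(2) by (simp add: sum.remove[of _ x] sum.remove[of _ y])
      finally show ?thesis unfolding bs(1) .
    qed
    moreover have "?c v = l v" if "v \<notin> W" for v using that bs(3)[OF that] x y(1) by auto
    moreover have "?c x \<noteq> l x" using y(2) b(2) by simp
    ultimately have "?c \<in> ?A" using cl unfolding A by (simp add: cover_slice_def weighted_covers_def del: fun_upd_apply)
    moreover have "b x < a x"
      using ab(1) b(2) by (auto simp: cover_slice_def dest!: spec[of _ x])
    ultimately show "\<exists>i j. i \<noteq> j \<and> b i < a i \<and> 0 < b j \<and> b(i := Suc (b i), j := b j - 1) \<in> ?A"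
      using y by (intro exI[of _ x] exI[of _ y]) auto
  qed
  moreover have "?A \<union> ?B = cover_slice E s d W l" unfolding A B by auto
  ultimately show ?thesis by simp
qed

lemma push_bounds_active:
  assumes "{u, v} \<in> E" "push_bounds E s x l u + push_bounds E s x l v < s"
  shows "l u + l v < s" "u \<noteq> x"
proof -
  have le: "l w \<le> push_bounds E s x l w" for w by (simp add: push_bounds_def)
  show "l u + l v < s" using le[of u] le[of v] assms(2) by simp
  show "u \<noteq> x"
  proof
    assume u: "u = x"
    then have "{v, x} \<in> E" using assms(1) by (simp add: insert_commute)
    then have "s - l x \<le> push_bounds E s x l v" by (simp add: push_bounds_def)
    then show False using le[of x] assms(2) by (simp add: u)
  qed
qed

text \<open>The unsettled edges form a forest.  If one is left, there is a vertex \<open>y\<close> on exactly one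
  unsettled edge \<open>{x, y}\<close>; a cover with \<open>b x = l x\<close> has \<open>b y \<ge> s - l x > l y\<close>, so \<open>y\<close> can give weight to \<open>x\<close>.
  If none is left, any vertex above its bound can give weight, and comparing total weights shows
  that there is one.  Raising a bound or deciding a vertex decreases the measure, because no cover exists when
  the bounds exceed the total weight.\<close>

lemma cover_slice_forest:
  fixes E :: "'v::finite set set"
  assumes noloop: "\<And>x. {x, x} \<notin> E"
    and forest: "\<And>U. U \<noteq> {} \<Longrightarrow> U \<subseteq> V0 \<Longrightarrow> \<exists>u\<in>U. card {v \<in> U. {u, v} \<in> E} \<le> 1"
    and active: "\<And>u v. {u, v} \<in> E \<Longrightarrow> l u + l v < s \<Longrightarrow> u \<in> W \<and> u \<in> V0"
  shows "linear_quotients (cover_slice E s d W l)"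
  using active
proof (induction "card W + (Suc d - sum l UNIV)" arbitrary: W l rule: less_induct)
  case less
  show ?case
  proof (cases "sum l UNIV \<le> d \<and> W \<noteq> {}")
    case False
    note outside = this
    show ?thesis
    proof (cases "W = {}")
      case True
      then have "cover_slice E s d W l \<subseteq> {l}" by (auto simp: cover_slice_def)
      then consider "cover_slice E s d W l = {}" | "cover_slice E s d W l = {l}" by blast
      then show ?thesis
        using linear_quotients.empty linear_quotients.insert[OF linear_quotients.empty, of l] by cases simp_all
    next
      case False
      with outside have "d < sum l UNIV" by simp
      then have "cover_slice E s d W l = {}"
        unfolding cover_slice_def by (auto simp: not_le[symmetric] intro: sum_mono)
      then show ?thesis by (simp add: linear_quotients.empty)
    qed
  next
    case True
    have branch: ?thesis
      if x: "x \<in> W" and exch: "\<And>a b. a \<in> cover_slice E s d W (l(x := Suc (l x))) \<Longrightarrow> b \<in> cover_slice E s d W l \<Longrightarrow> b x = l x \<Longrightarrow>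
      \<exists>y\<in>W. y \<noteq> x \<and> l y < b y \<and> (\<forall>u. {u, y} \<in> E \<longrightarrow> u \<noteq> x \<longrightarrow> s \<le> l u + l y)" for x
    proof (rule cover_slice_branch[OF x noloop _ _ _ exch])
      show "u \<in> W" if "{u, v} \<in> E" "l u + l v < s" for u v using less.prems[OF that] ..
      have "sum (l(x := Suc (l x))) UNIV = Suc (l x) + sum (l(x := Suc (l x))) (UNIV - {x})"
        by (simp add: sum.remove[of _ x])
      also have "sum (l(x := Suc (l x))) (UNIV - {x}) = sum l (UNIV - {x})" by (rule sum.cong) auto
      also have "Suc (l x) + sum l (UNIV - {x}) = Suc (sum l UNIV)" by (simp add: sum.remove[of _ x])
      finally have sum_up: "sum (l(x := Suc (l x))) UNIV = Suc (sum l UNIV)" .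
      show "linear_quotients (cover_slice E s d W (l(x := Suc (l x))))"
      proof (rule less.hyps)
        show "card W + (Suc d - sum (l(x := Suc (l x))) UNIV) < card W + (Suc d - sum l UNIV)"
          using True unfolding sum_up by linarith
        fix u v assume "{u, v} \<in> E" "(l(x := Suc (l x))) u + (l(x := Suc (l x))) v < s"
        then show "u \<in> W \<and> u \<in> V0" using less.prems[of u v] by (auto split: if_splits)
      qed
      show "linear_quotients (cover_slice E s d (W - {x}) (push_bounds E s x l))"
      proof (rule less.hyps)
        have "sum l UNIV \<le> sum (push_bounds E s x l) UNIV"
          by (rule sum_mono) (simp add: push_bounds_def)
        moreover have "card (W - {x}) < card W" using x by (intro psubset_card_mono) auto
        ultimately show "card (W - {x}) + (Suc d - sum (push_bounds E s x l) UNIV) < card W + (Suc d - sum l UNIV)"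
          by simp
        fix u v assume "{u, v} \<in> E" "push_bounds E s x l u + push_bounds E s x l v < s"
        then show "u \<in> W - {x} \<and> u \<in> V0"
          using push_bounds_active[of u v E s x l] less.prems[of u v] by auto
      qed
    qed
    let ?U = "{u. \<exists>v. {u, v} \<in> E \<and> l u + l v < s}"
    show ?thesis
    proof (cases "?U = {}")
      case True
      obtain x where x: "x \<in> W" using \<open>_ \<and> W \<noteq> {}\<close> by blast
      show ?thesis
      proof (rule branch[OF x])
        fix a b assume a: "a \<in> cover_slice E s d W (l(x := Suc (l x)))" and b: "b \<in> cover_slice E s d W l" "b x = l x"
        have ax: "b x < a x" using a b(2) by (auto simp: cover_slice_def dest!: spec[of _ x])
        have al: "l v \<le> a v" for v using a by (auto simp: cover_slice_def dest!: spec[of _ v] split: if_splits)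
        have "\<exists>y. a y < b y"
        proof (rule ccontr)
          assume "\<nexists>y. a y < b y"
          then have "sum b UNIV < sum a UNIV" using ax
            by (intro sum_strict_mono_ex1) (auto simp: not_less)
          then show False using a b by (simp add: cover_slice_def)
        qed
        then obtain y where y: "a y < b y" ..
        have "l y < b y" using y al[of y] by simp
        moreover have "y \<in> W" using b(1) calculation by (auto simp: cover_slice_def)
        moreover have "y \<noteq> x" using y ax by auto
        ultimately show "\<exists>y\<in>W. y \<noteq> x \<and> l y < b y \<and> (\<forall>u. {u, y} \<in> E \<longrightarrow> u \<noteq> x \<longrightarrow> s \<le> l u + l y)"
          using True by (intro bexI[of _ y]) (auto simp: not_less[symmetric])
      qed
    next
      case False
      moreover have "?U \<subseteq> V0" using less.prems by auto
      ultimately have "\<exists>y\<in>?U. card {v \<in> ?U. {y, v} \<in> E} \<le> 1" by (rule forest)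
      then obtain y where y: "y \<in> ?U" "card {v \<in> ?U. {y, v} \<in> E} \<le> 1" ..
      then obtain x where x: "{y, x} \<in> E" "l y + l x < s" by blast
      have xy: "{x, y} \<in> E" "l x + l y < s" using x by (simp_all add: insert_commute)
      have only: "u = x" if "{u, y} \<in> E" "l u + l y < s" for u
      proof -
        have "{y, u} \<in> E" using that(1) by (simp add: insert_commute)
        then have "u \<in> {v \<in> ?U. {y, v} \<in> E}" "x \<in> {v \<in> ?U. {y, v} \<in> E}" using that xy x by auto
        moreover have "\<forall>a\<in>{v \<in> ?U. {y, v} \<in> E}. \<forall>b\<in>{v \<in> ?U. {y, v} \<in> E}. a = b"
          using y(2) by (subst card_le_Suc0_iff_eq[symmetric]) simp_all
        ultimately show ?thesis by simp
      qed
      show ?thesis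
      proof (rule branch)
        show "x \<in> W" using less.prems[OF xy] ..
        fix a b assume b: "b \<in> cover_slice E s d W l" "b x = l x"
        have "s \<le> b x + b y" using b(1) xy(1) by (auto simp: cover_slice_def weighted_covers_def)
        then have "l y < b y" using b(2) xy(2) by simp
        moreover have "y \<in> W" using less.prems[OF x] ..
        moreover have "y \<noteq> x" using noloop x(1) by auto
        ultimately show "\<exists>y\<in>W. y \<noteq> x \<and> l y < b y \<and> (\<forall>u. {u, y} \<in> E \<longrightarrow> u \<noteq> x \<longrightarrow> s \<le> l u + l y)"
          using only by (intro bexI[of _ y]) (auto simp: not_less[symmetric])
      qed
    qed
  qed
qed

text \<open>The leaf \<open>y\<close> keeps the bound \<open>0\<close>, so it can give weight to \<open>x\<close> until the bound at \<open>x\<close> reaches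
  \<open>s\<close>.  From then on, or as soon as the weight of \<open>x\<close> is decided, no unsettled edge
  meets \<open>x\<close>, and the forest case applies.\<close>

lemma whiskered_forest_linear_quotients:
  fixes E :: "'v::finite set set"
  assumes noloop: "\<And>x. {x, x} \<notin> E"
    and whisker: "{x, y} \<in> E" "\<And>u. {u, y} \<in> E \<Longrightarrow> u = x"
    and forest: "\<And>U. U \<noteq> {} \<Longrightarrow> x \<notin> U \<Longrightarrow> \<exists>u\<in>U. card {v \<in> U. {u, v} \<in> E} \<le> 1"
  shows "linear_quotients {a \<in> weighted_covers E s. sum a UNIV = d}"
proof -
  have forest': "\<exists>u\<in>U. card {v \<in> U. {u, v} \<in> E} \<le> 1" if "U \<noteq> {}" "U \<subseteq> - {x}" for U
    using forest[OF that(1)] that(2) by blast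
  have "linear_quotients (cover_slice E s d UNIV ((\<lambda>_. 0)(x := t)))" if "t \<le> s" for t
    using that
  proof (induction t rule: inc_induct)
    case base
    show ?case
    proof (rule cover_slice_forest[OF noloop forest'])
      fix u v assume "((\<lambda>_. 0)(x := s)) u + ((\<lambda>_. 0)(x := s)) v < s"
      then show "u \<in> UNIV \<and> u \<in> - {x}" by auto
    qed
  next
    case (step t)
    let ?l = "(\<lambda>_. 0)(x := t)"
    show ?case
    proof (rule cover_slice_branch)
      show "linear_quotients (cover_slice E s d UNIV (?l(x := Suc (?l x))))"
        using step.IH by (simp only: fun_upd_upd fun_upd_same)
      show "linear_quotients (cover_slice E s d (UNIV - {x}) (push_bounds E s x ?l))"
      proof (rule cover_slice_forest[OF noloop forest'])
        fix u v assume "{u, v} \<in> E" "push_bounds E s x ?l u + push_bounds E s x ?l v < s"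
        then show "u \<in> UNIV - {x} \<and> u \<in> - {x}" using push_bounds_active[of u v E s x ?l] by simp
      qed
      fix b assume b: "b \<in> cover_slice E s d UNIV ?l" "b x = ?l x"
      have yx: "y \<noteq> x" using noloop whisker(1) by auto
      \<comment> \<open>\<open>b x = t < s\<close> forces a positive weight at the leaf\<close>
      have "s \<le> b x + b y" using b(1) whisker(1) by (auto simp: cover_slice_def weighted_covers_def)
      then have "?l y < b y" using b(2) step.hyps yx by simp
      then show "\<exists>y\<in>UNIV. y \<noteq> x \<and> ?l y < b y \<and> (\<forall>u. {u, y} \<in> E \<longrightarrow> u \<noteq> x \<longrightarrow> s \<le> ?l u + ?l y)"
        using yx whisker(2) by (intro bexI[of _ y]) auto
    qed (use noloop in auto)
  qed
  from this[of 0] have "linear_quotients (cover_slice E s d UNIV (\<lambda>_. 0))" by (simp add: fun_upd_idem)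
  then show ?thesis by (simp add: cover_slice_def)
qed

lemma whiskered_forest_componentwise_linear:
  fixes E :: "'v::finite set set"
  assumes G: "simple_graph UNIV E"
    and whisker: "{x, y} \<in> E" "\<And>u. {u, y} \<in> E \<Longrightarrow> u = x"
    and forest: "\<And>U. U \<noteq> {} \<Longrightarrow> x \<notin> U \<Longrightarrow> \<exists>u\<in>U. card {v \<in> U. {u, v} \<in> E} \<le> 1"
  shows "componentwise_linear (symbolic_power (vertex_cover_ideal E :: ('v, 'k::field) mpoly set) s)"
  unfolding componentwise_linear_def degree_component_symbolic_power[OF G]
proof
  fix j :: int
  let ?D = "{a \<in> weighted_covers E s. int (sum a UNIV) = j}"
  have noloop: "{x, x} \<notin> E" for x
  proof
    assume "{x, x} \<in> E"
    with G obtain u v where "u \<noteq> v" "{x, x} = {u, v}" unfolding simple_graph_def by blast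
    then show False by (auto simp: doubleton_eq_iff)
  qed
  have deg: "?D \<subseteq> {a. a \<le> (\<lambda>_. nat j)}"
  proof
    fix a assume "a \<in> ?D"
    then have "int (sum a UNIV) = j" by blast
    then have "sum a UNIV = nat j" by (metis nat_int)
    then have "a v \<le> nat j" for v using member_le_sum[of v UNIV a] by simp
    then show "a \<in> {a. a \<le> (\<lambda>_. nat j)}" by (simp add: le_fun_def)
  qed
  have D: "?D = (if j < 0 then {} else {a \<in> weighted_covers E s. sum a UNIV = nat j})" by (auto simp del: of_nat_sum)
  show "has_linear_resolution (monomial_ideal ?D :: ('v, 'k) mpoly set)"
  proof (rule linear_quotients_linear_resolution)
    show "finite ?D" using deg finite_bounded_functions by (rule finite_subset)
    show "linear_quotients ?D"
      unfolding D using whiskered_forest_linear_quotients[OF noloop whisker forest] by (simp add: linear_quotients.empty)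
    show "sum m UNIV = nat j" if "m \<in> ?D" for m
      using that by (auto simp del: of_nat_sum)
  qed
qed

section \<open>Unicyclic vertex decomposable graphs\<close>

lemma long_path_exists:
  assumes W: "finite W" "W \<noteq> {}"
  shows "\<exists>vs. vs \<noteq> [] \<and> distinct vs \<and> set vs \<subseteq> W \<and>
      (\<forall>i. Suc i < length vs \<longrightarrow> {vs ! i, vs ! Suc i} \<in> F) \<and>
      (\<forall>v\<in>W. {v, hd vs} \<in> F \<longrightarrow> v \<in> set vs)"
proof -
  define P where "P vs \<longleftrightarrow> vs \<noteq> [] \<and> distinct vs \<and> set vs \<subseteq> W \<and>
      (\<forall>i. Suc i < length vs \<longrightarrow> {vs ! i, vs ! Suc i} \<in> F)" for vs
  obtain w where "w \<in> W" using W(2) by blast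
  then have "P [w]" by (simp add: P_def)
  moreover have "length vs \<le> card W" if "P vs" for vs
    using that W(1) card_mono[of W "set vs"] distinct_card[of vs] by (simp add: P_def)
  ultimately have "\<exists>vs. P vs \<and> (\<forall>ws. P ws \<longrightarrow> length ws \<le> length vs)"
    by (intro ex_has_greatest_nat[of P "[w]" length "Suc (card W)"]) (auto simp: less_Suc_eq_le)
  then obtain vs where vs: "P vs" and longest: "\<And>ws. P ws \<Longrightarrow> length ws \<le> length vs" by blast
  have "v \<in> set vs" if "v \<in> W" "{v, hd vs} \<in> F" for v
  proof (rule ccontr)
    assume "v \<notin> set vs"
    have "P (v # vs)"
      unfolding P_def
    proof (intro conjI allI impI)
      fix i assume i: "Suc i < length (v # vs)"
      show "{(v # vs) ! i, (v # vs) ! Suc i} \<in> F"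
      proof (cases i)
        case 0
        then show ?thesis using that vs by (simp add: P_def hd_conv_nth)
      next
        case (Suc j)
        then show ?thesis using i vs by (simp add: P_def)
      qed
    qed (use that vs \<open>v \<notin> set vs\<close> in \<open>auto simp: P_def\<close>)
    from longest[OF this] show False by simp
  qed
  with vs show ?thesis unfolding P_def by blast
qed

text \<open>The first vertex \<open>u\<close> of a path that cannot be extended at this end has its neighbours on the path;
  a neighbour other than the second vertex closes a cycle.\<close>

lemma min_degree_two_has_cycle:
  assumes W: "finite W" "W \<noteq> {}" and noloop: "\<And>u. {u} \<notin> F"
    and deg: "\<And>u. u \<in> W \<Longrightarrow> 2 \<le> card {v \<in> W. {u, v} \<in> F}"
  shows "\<exists>C n. is_cycle F n C"
proof -
  obtain vs where vs: "vs \<noteq> []" "distinct vs" "set vs \<subseteq> W"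
    and path: "\<And>i. Suc i < length vs \<Longrightarrow> {vs ! i, vs ! Suc i} \<in> F"
    and maximal: "\<And>v. v \<in> W \<Longrightarrow> {v, hd vs} \<in> F \<Longrightarrow> v \<in> set vs"
    using long_path_exists[OF W, of F] by blast
  let ?u = "hd vs"
  have u: "?u = vs ! 0" "?u \<in> W" using vs by (auto simp: hd_conv_nth)
  let ?N = "{v \<in> W. {?u, v} \<in> F}"
  have "\<not> ?N \<subseteq> {vs ! 1}"
  proof
    assume "?N \<subseteq> {vs ! 1}"
    then have "card ?N \<le> card {vs ! 1}" by (intro card_mono) auto
    then show False using deg[OF u(2)] by simp
  qed
  then obtain v where v: "v \<in> W" "{?u, v} \<in> F" "v \<noteq> vs ! 1" by blast
  then have "v \<in> set vs" using maximal[of v] by (simp add: insert_commute)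
  then obtain k where k: "k < length vs" "v = vs ! k" by (auto simp: in_set_conv_nth)
  have "k \<noteq> 0" using v(2) k(2) u(1) noloop[of v] by (cases k) auto
  moreover have "k \<noteq> 1" using v(3) k(2) by auto
  ultimately have k2: "2 \<le> k" by simp
  let ?ws = "take (Suc k) vs"
  have len: "length ?ws = Suc k" using k(1) by simp
  have "cycle_edges ?ws \<subseteq> F"
  proof
    fix e assume "e \<in> cycle_edges ?ws"
    then obtain i where i: "i < Suc k" "e = {?ws ! i, ?ws ! (Suc i mod Suc k)}"
      unfolding cycle_edges_def len by blast
    show "e \<in> F"
    proof (cases "i = k")
      case True
      then have "e = {vs ! k, vs ! 0}" using i by simp
      then show ?thesis using v(2) u(1) k(2) by (simp add: insert_commute)
    next
      case False
      then have "e = {vs ! i, vs ! Suc i}" using i by simp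
      then show ?thesis using path[of i] False i(1) k(1) by simp
    qed
  qed
  then have "is_cycle F (Suc k) (cycle_edges ?ws)"
    unfolding is_cycle_def using vs(2) len k2 by (intro conjI exI[of _ ?ws]) auto
  then show ?thesis by blast
qed

text \<open>Remove a vertex of degree at most one, which exists because there is no cycle.\<close>

lemma forest_edge_count:
  assumes "finite W" "W \<noteq> {}"
    and F: "\<And>e. e \<in> F \<Longrightarrow> \<exists>u v. u \<noteq> v \<and> e = {u, v}"
    and acyclic: "\<nexists>C n. is_cycle F n C"
  shows "finite {e \<in> F. e \<subseteq> W} \<and> card {e \<in> F. e \<subseteq> W} < card W"
  using assms(1,2)
proof (induction "card W" arbitrary: W)
  case 0
  then show ?case by simp
next
  case (Suc k)
  have noloop: "{u} \<notin> F" for u using F[of "{u}"] by auto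
  have "\<exists>u\<in>W. card {v \<in> W. {u, v} \<in> F} \<le> 1"
  proof (rule ccontr)
    assume "\<not> ?thesis"
    then have "\<forall>u\<in>W. 2 \<le> card {v \<in> W. {u, v} \<in> F}" by (auto simp: not_le Suc_le_eq numeral_2_eq_2)
    then have "\<exists>C n. is_cycle F n C"
      by (intro min_degree_two_has_cycle[OF Suc.prems noloop]) blast
    with acyclic show False by blast
  qed
  then obtain u where u: "u \<in> W" "card {v \<in> W. {u, v} \<in> F} \<le> 1" ..
  let ?W = "W - {u}"
  let ?S = "(\<lambda>v. {u, v}) ` {v \<in> W. {u, v} \<in> F}"
  have sub: "{e \<in> F. e \<subseteq> W} \<subseteq> {e \<in> F. e \<subseteq> ?W} \<union> ?S"
  proof
    fix e assume e: "e \<in> {e \<in> F. e \<subseteq> W}"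
    show "e \<in> {e \<in> F. e \<subseteq> ?W} \<union> ?S"
    proof (cases "u \<in> e")
      case True
      obtain a b where ab: "a \<noteq> b" "e = {a, b}" using F e by blast
      have "e = {u, if u = a then b else a}" using True ab by auto
      then show ?thesis using e by auto
    next
      case False
      then show ?thesis using e by auto
    qed
  qed
  have cS: "card ?S \<le> 1"
    using card_image_le[of "{v \<in> W. {u, v} \<in> F}" "\<lambda>v. {u, v}"] Suc.prems(1) u(2) by simp
  have fS: "finite ?S" using Suc.prems(1) by simp
  show ?case
  proof (cases "?W = {}")
    case True
    have empty: "{e \<in> F. e \<subseteq> W} = {}"
    proof (rule equals0I)
      fix e assume e: "e \<in> {e \<in> F. e \<subseteq> W}"
      then have "e \<subseteq> {u}" using True by auto
      moreover obtain a b where "a \<noteq> b" "e = {a, b}" using F e by blast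
      ultimately show False by simp
    qed
    show ?thesis unfolding empty using Suc.hyps(2) by simp
  next
    case False
    have "k = card ?W" using Suc.hyps(2) u(1) Suc.prems(1) by simp
    then have IH: "finite {e \<in> F. e \<subseteq> ?W}" "card {e \<in> F. e \<subseteq> ?W} < card ?W"
      using Suc.hyps(1)[of ?W] Suc.prems(1) False by auto
    have fin: "finite {e \<in> F. e \<subseteq> W}" by (rule finite_subset[OF sub]) (simp add: IH(1) fS)
    have "card {e \<in> F. e \<subseteq> W} \<le> card ({e \<in> F. e \<subseteq> ?W} \<union> ?S)"
      using sub IH(1) fS by (intro card_mono) auto
    also have "\<dots> \<le> card {e \<in> F. e \<subseteq> ?W} + card ?S" by (rule card_Un_le)
    also have "\<dots> < card W" using IH(2) cS \<open>k = card ?W\<close> Suc.hyps(2) by linarith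
    finally show ?thesis using fin by blast
  qed
qed

text \<open>The set \<open>A\<close> is independent, and deleting it with its neighbours cuts \<open>Q\<close> off from the rest of
  the graph.  For \<open>x\<close> in \<open>Q\<close>, the independent set \<open>B\<close> avoids \<open>x\<close> and its neighbours and is adjacent to every neighbour of
  \<open>x\<close> in \<open>Q\<close>, so \<open>A \<union> B\<close> shows that \<open>x\<close> is not a shedding vertex.\<close>

definition shedding_obstruction :: "'v set \<Rightarrow> 'v set set \<Rightarrow> 'v set \<Rightarrow> 'v set \<Rightarrow> bool" where
  "shedding_obstruction V E A Q \<longleftrightarrow>
     A \<subseteq> V \<and> Q \<subseteq> V \<and> Q \<noteq> {} \<and> A \<inter> Q = {} \<and>
     (\<forall>u\<in>A. \<forall>v\<in>A. {u, v} \<notin> E) \<and> (\<forall>q\<in>Q. \<forall>a\<in>A. {q, a} \<notin> E) \<and>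
     (\<forall>q\<in>Q. \<forall>r. {q, r} \<in> E \<longrightarrow> r \<notin> Q \<longrightarrow> (\<exists>a\<in>A. {r, a} \<in> E)) \<and>
     (\<forall>x\<in>Q. (\<exists>y\<in>Q. {x, y} \<in> E) \<and>
        (\<exists>B\<subseteq>Q. (\<forall>b\<in>B. b \<noteq> x \<and> {x, b} \<notin> E) \<and> (\<forall>b\<in>B. \<forall>c\<in>B. {b, c} \<notin> E) \<and>
               (\<forall>y\<in>Q. {x, y} \<in> E \<longrightarrow> (\<exists>b\<in>B. {y, b} \<in> E))))"

lemma shedding_obstructionD:
  assumes "shedding_obstruction V E A Q"
  shows "A \<subseteq> V" "Q \<subseteq> V" "Q \<noteq> {}" "A \<inter> Q = {}"
    and "u \<in> A \<Longrightarrow> v \<in> A \<Longrightarrow> {u, v} \<notin> E" "q \<in> Q \<Longrightarrow> a \<in> A \<Longrightarrow> {q, a} \<notin> E"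
    and "q \<in> Q \<Longrightarrow> {q, r} \<in> E \<Longrightarrow> r \<notin> Q \<Longrightarrow> \<exists>a\<in>A. {r, a} \<in> E"
    and "x \<in> Q \<Longrightarrow> \<exists>y\<in>Q. {x, y} \<in> E"
    and "x \<in> Q \<Longrightarrow> \<exists>B\<subseteq>Q. (\<forall>b\<in>B. b \<noteq> x \<and> {x, b} \<notin> E) \<and> (\<forall>b\<in>B. \<forall>c\<in>B. {b, c} \<notin> E) \<and>
               (\<forall>y\<in>Q. {x, y} \<in> E \<longrightarrow> (\<exists>b\<in>B. {y, b} \<in> E))"
  using assms unfolding shedding_obstruction_def by simp_all

lemma induced_edge_iff: "{u, v} \<in> induced_edges E W \<longleftrightarrow> {u, v} \<in> E \<and> u \<in> W \<and> v \<in> W"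
  by (auto simp: induced_edges_def)

text \<open>This covers both reductions of a vertex decomposition at a vertex outside \<open>Q\<close>.  If a
  member of \<open>A\<close> is removed along with its neighbours, it has no vertex left to dominate.\<close>

lemma shedding_obstruction_induced:
  assumes ob: "shedding_obstruction V E A Q"
    and A': "A' \<subseteq> A" "A' \<subseteq> W" and Q: "Q \<subseteq> W"
    and dom: "\<And>r a. r \<in> W \<Longrightarrow> a \<in> A \<Longrightarrow> {r, a} \<in> E \<Longrightarrow> \<exists>a\<in>A'. {r, a} \<in> E"
  shows "shedding_obstruction W (induced_edges E W) A' Q"
proof -
  have 1: "Q \<noteq> {}" "A' \<inter> Q = {}" "\<forall>u\<in>A'. \<forall>v\<in>A'. {u, v} \<notin> induced_edges E W"
    "\<forall>q\<in>Q. \<forall>a\<in>A'. {q, a} \<notin> induced_edges E W"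
    using shedding_obstructionD(3-6)[OF ob] A'(1) unfolding induced_edge_iff by blast+
  have 2: "\<exists>a\<in>A'. {r, a} \<in> induced_edges E W" if q: "q \<in> Q" "{q, r} \<in> induced_edges E W" "r \<notin> Q" for q r
  proof -
    from q(2) have r: "{q, r} \<in> E" "r \<in> W" by (simp_all add: induced_edge_iff)
    then obtain a where "a \<in> A" "{r, a} \<in> E"
      using shedding_obstructionD(7)[OF ob q(1) _ q(3)] by blast
    with dom[OF r(2)] obtain a' where "a' \<in> A'" "{r, a'} \<in> E" by blast
    then show ?thesis using r(2) A'(2) by (auto simp: induced_edge_iff)
  qed
  have 3: "(\<exists>y\<in>Q. {x, y} \<in> induced_edges E W) \<and>
        (\<exists>B\<subseteq>Q. (\<forall>b\<in>B. b \<noteq> x \<and> {x, b} \<notin> induced_edges E W) \<and> (\<forall>b\<in>B. \<forall>c\<in>B. {b, c} \<notin> induced_edges E W) \<and>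
               (\<forall>y\<in>Q. {x, y} \<in> induced_edges E W \<longrightarrow> (\<exists>b\<in>B. {y, b} \<in> induced_edges E W)))"
    if x: "x \<in> Q" for x
  proof -
    obtain y where y: "y \<in> Q" "{x, y} \<in> E" using shedding_obstructionD(8)[OF ob x] by blast
    obtain B where B: "B \<subseteq> Q" "\<forall>b\<in>B. b \<noteq> x \<and> {x, b} \<notin> E" "\<forall>b\<in>B. \<forall>c\<in>B. {b, c} \<notin> E"
      "\<forall>y\<in>Q. {x, y} \<in> E \<longrightarrow> (\<exists>b\<in>B. {y, b} \<in> E)"
      using shedding_obstructionD(9)[OF ob x] by blast
    have QW: "z \<in> W" if "z \<in> Q" for z using that Q by blast
    have BW: "b \<in> W" if "b \<in> B" for b using that B(1) Q by blast
    show ?thesis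
      unfolding induced_edge_iff
    proof (intro conjI exI[of _ B])
      show "\<exists>y\<in>Q. {x, y} \<in> E \<and> x \<in> W \<and> y \<in> W" using y x QW by blast
      show "\<forall>y\<in>Q. {x, y} \<in> E \<and> x \<in> W \<and> y \<in> W \<longrightarrow> (\<exists>b\<in>B. {y, b} \<in> E \<and> y \<in> W \<and> b \<in> W)"
        using B(4) BW by blast
    qed (use B in auto)
  qed
  show ?thesis
    unfolding shedding_obstruction_def
  proof (intro conjI ballI allI impI)
    show "\<exists>a\<in>A'. {r, a} \<in> induced_edges E W" if "q \<in> Q" "{q, r} \<in> induced_edges E W" "r \<notin> Q" for q r
      using 2 that .
    fix x assume x: "x \<in> Q"
    show "\<exists>y\<in>Q. {x, y} \<in> induced_edges E W" by (rule 3[OF x, THEN conjunct1])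
    show "\<exists>B\<subseteq>Q. (\<forall>b\<in>B. b \<noteq> x \<and> {x, b} \<notin> induced_edges E W) \<and> (\<forall>b\<in>B. \<forall>c\<in>B. {b, c} \<notin> induced_edges E W) \<and>
         (\<forall>y\<in>Q. {x, y} \<in> induced_edges E W \<longrightarrow> (\<exists>b\<in>B. {y, b} \<in> induced_edges E W))"
      by (rule 3[OF x, THEN conjunct2])
  qed (use 1 A'(2) Q in auto)
qed

text \<open>A shedding vertex cannot lie in \<open>Q\<close>, and removing any other one, with
  or without its neighbours, preserves the obstruction.\<close>

lemma vertex_decomposable_no_obstruction:
  assumes "vertex_decomposable V E"
    and "\<And>e. e \<in> E \<Longrightarrow> \<exists>u v. e = {u, v}"
  shows "\<not> shedding_obstruction V E A Q"
  using assms
proof (induction arbitrary: A)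
  case (no_edges V)
  show ?case
  proof
    assume ob: "shedding_obstruction V {} A Q"
    then obtain x where "x \<in> Q" using shedding_obstructionD(3) by blast
    then show False using shedding_obstructionD(8)[OF ob] by blast
  qed
next
  case (shedding x V E)
  have pairs: "\<And>e. e \<in> induced_edges E W \<Longrightarrow> \<exists>u v. e = {u, v}" for W
    using shedding.prems by (simp add: induced_edges_def)
  show ?case
  proof
    assume ob: "shedding_obstruction V E A Q"
    then have sub: "A \<subseteq> V" "Q \<subseteq> V" and disj: "A \<inter> Q = {}"
      and indepA: "\<And>u v. u \<in> A \<Longrightarrow> v \<in> A \<Longrightarrow> {u, v} \<notin> E"
      and AQ: "\<And>q a. q \<in> Q \<Longrightarrow> a \<in> A \<Longrightarrow> {q, a} \<notin> E"
      and dom: "\<And>q r. q \<in> Q \<Longrightarrow> {q, r} \<in> E \<Longrightarrow> r \<notin> Q \<Longrightarrow> \<exists>a\<in>A. {r, a} \<in> E"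
      by (blast dest: shedding_obstructionD)+
    consider "x \<in> Q" | "x \<in> A" | "x \<notin> Q" "x \<notin> A" by blast
    then show False
    proof cases
      case 1
      let ?W = "V - closed_nbhd E x"
      obtain B where B: "B \<subseteq> Q" "\<forall>b\<in>B. b \<noteq> x \<and> {x, b} \<notin> E" "\<forall>b\<in>B. \<forall>c\<in>B. {b, c} \<notin> E"
        "\<forall>y\<in>Q. {x, y} \<in> E \<longrightarrow> (\<exists>b\<in>B. {y, b} \<in> E)"
        using shedding_obstructionD(9)[OF ob 1] by blast
      have "independent_set ?W (induced_edges E ?W) (A \<union> B)"
        unfolding independent_set_def
      proof (intro conjI ballI notI)
        show "A \<union> B \<subseteq> ?W"
          using sub B(1,2) AQ 1 disj by (auto simp: closed_nbhd_def nbhd_def)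
        fix e assume e: "e \<in> induced_edges E ?W" "e \<subseteq> A \<union> B"
        then have eE: "e \<in> E" by (simp add: induced_edges_def)
        then obtain u v where uv: "e = {u, v}" using shedding.prems by blast
        have "{u, v} \<in> E" "{v, u} \<in> E" using eE uv by (simp_all add: insert_commute)
        moreover have "u \<in> A \<or> u \<in> Q" "v \<in> A \<or> v \<in> Q" using e(2) uv B(1) by auto
        moreover have "u \<in> A \<or> u \<in> B" "v \<in> A \<or> v \<in> B" using e(2) uv by auto
        ultimately show False using indepA AQ B(1,3) by blast
      qed
      from shedding.hyps(4)[OF this] obtain y where y: "y \<in> nbhd E x"
        and ind: "independent_set (V - {x}) (induced_edges E (V - {x})) (insert y (A \<union> B))" by blast
      have "\<exists>c\<in>A \<union> B. {y, c} \<in> E"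
      proof (cases "y \<in> Q")
        case True
        then show ?thesis using B(4) y by (auto simp: nbhd_def)
      next
        case False
        then show ?thesis using dom[OF 1] y by (auto simp: nbhd_def)
      qed
      then obtain c where c: "c \<in> A \<union> B" "{y, c} \<in> E" ..
      have sub': "insert y (A \<union> B) \<subseteq> V - {x}"
        and indep: "\<forall>e\<in>induced_edges E (V - {x}). \<not> e \<subseteq> insert y (A \<union> B)"
        using ind by (simp_all add: independent_set_def)
      have yc: "{y, c} \<subseteq> insert y (A \<union> B)" using c(1) by auto
      then have "{y, c} \<in> induced_edges E (V - {x})"
        using c(2) sub' unfolding induced_edges_def by (intro CollectI conjI) (auto intro: subset_trans)
      from bspec[OF indep this] yc show False by contradiction
    next
      case 2
      let ?W = "V - closed_nbhd E x"
      have "shedding_obstruction ?W (induced_edges E ?W) (A - {x}) Q"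
      proof (rule shedding_obstruction_induced[OF ob])
        show "A - {x} \<subseteq> ?W" using sub indepA[OF 2] by (auto simp: closed_nbhd_def nbhd_def)
        have "{x, q} \<notin> E" if "q \<in> Q" for q using AQ[OF that 2] by (simp add: insert_commute)
        then show "Q \<subseteq> ?W" using sub 2 disj by (auto simp: closed_nbhd_def nbhd_def)
        fix r a assume r: "r \<in> ?W" "a \<in> A" "{r, a} \<in> E"
        have "a \<noteq> x" using r by (auto simp: closed_nbhd_def nbhd_def insert_commute)
        then show "\<exists>a\<in>A - {x}. {r, a} \<in> E" using r by blast
      qed auto
      moreover have "\<not> shedding_obstruction ?W (induced_edges E ?W) (A - {x}) Q"
        by (rule shedding.IH(2)) (rule pairs)
      ultimately show False by contradiction
    next
      case 3
      have "shedding_obstruction (V - {x}) (induced_edges E (V - {x})) A Q"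
        by (rule shedding_obstruction_induced[OF ob]) (use sub 3 in auto)
      moreover have "\<not> shedding_obstruction (V - {x}) (induced_edges E (V - {x})) A Q"
        by (rule shedding.IH(1)) (rule pairs)
      ultimately show False by contradiction
    qed
  qed
qed

locale cycle_in_graph =
  fixes E :: "'v::finite set set" and vs :: "'v list" and n :: nat
  assumes graph: "simple_graph UNIV E"
    and vs: "distinct vs" "length vs = n" "3 \<le> n"
    and cycle: "cycle_edges vs \<subseteq> E"
    and only_cycle: "\<And>C k. is_cycle E k C \<Longrightarrow> C = cycle_edges vs"
begin

abbreviation "Q \<equiv> set vs"
abbreviation "C \<equiv> cycle_edges vs"

text \<open>Indexing the cycle periodically makes \<open>q k\<close> and \<open>q (Suc (Suc k))\<close> the neighbours of \<open>q (Suc k)\<close>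
  without a special case at the ends of the list.\<close>

definition q :: "nat \<Rightarrow> 'v" where "q i = vs ! (i mod n)"

lemma edge_pair: "e \<in> E \<Longrightarrow> \<exists>u v. u \<noteq> v \<and> e = {u, v}"
  using graph unfolding simple_graph_def by blast

lemma noloop: "{u, u} \<notin> E"
  using edge_pair[of "{u, u}"] by (auto simp: doubleton_eq_iff)

lemma q_eq_iff: "q i = q j \<longleftrightarrow> i mod n = j mod n"
  using vs by (simp add: q_def nth_eq_iff_index_eq)

lemma q_eq_dvd: "q (i + d) = q i \<longleftrightarrow> n dvd d"
  using mod_eq_dvd_iff_nat[of i "i + d" n] by (simp add: q_eq_iff)

lemma q_Suc_cong: "q i = q j \<Longrightarrow> q (Suc i) = q (Suc j)"
  unfolding q_eq_iff by (metis mod_Suc_eq)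

lemma q_pred_cong:
  assumes "q (Suc i) = q (Suc j)" shows "q i = q j"
proof -
  have wlog: "q a = q b" if "q (Suc a) = q (Suc b)" "a \<le> b" for a b
  proof -
    obtain d where d: "b = a + d" using \<open>a \<le> b\<close> le_Suc_ex by blast
    have "q (Suc a + d) = q (Suc a)" using that(1) by (simp add: d)
    then have "q (a + d) = q a" by (simp only: q_eq_dvd)
    then show ?thesis by (simp add: d)
  qed
  show ?thesis
  proof (cases "i \<le> j")
    case True
    then show ?thesis by (rule wlog[OF assms])
  next
    case False
    then have "q j = q i" by (intro wlog[OF assms[symmetric]]) simp
    then show ?thesis by simp
  qed
qed

lemma q_in: "q i \<in> Q" using vs by (simp add: q_def)

lemma in_Q: "x \<in> Q \<Longrightarrow> \<exists>k\<ge>n. x = q k"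
proof -
  assume "x \<in> Q"
  then obtain k where k: "k < n" "x = vs ! k" using vs by (auto simp: in_set_conv_nth)
  then have "x = q (k + n)" by (simp add: q_def)
  then show ?thesis using le_add2 by blast
qed

lemma C_eq: "C = (\<lambda>i. {q i, q (Suc i)}) ` {..<n}"
  unfolding cycle_edges_def vs(2) by (auto simp: q_def image_iff)

lemma edge_q: "{q i, q (Suc i)} \<in> C"
proof -
  have "{q i, q (Suc i)} = {q (i mod n), q (Suc (i mod n))}"
    using q_Suc_cong[of i "i mod n"] by (simp add: q_eq_iff) (simp add: q_def)
  then show ?thesis unfolding C_eq using vs(3) by auto
qed

lemma small_not_dvd: "\<not> n dvd 1" "\<not> n dvd 2"
  using vs(3) by (auto dest: dvd_imp_le)

lemma C_sub: "e \<in> C \<Longrightarrow> e \<subseteq> Q"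
  unfolding C_eq using q_in by auto

lemma Q_nonempty: "Q \<noteq> {}" using vs(2,3) by (cases vs) auto

lemma card_Q: "card Q = n" using vs distinct_card by blast

lemma card_C: "card C = n"
proof -
  have "inj_on (\<lambda>i. {q i, q (Suc i)}) {..<n}"
  proof (rule inj_onI)
    fix i j assume ij: "i \<in> {..<n}" "j \<in> {..<n}" "{q i, q (Suc i)} = {q j, q (Suc j)}"
    from ij(3) consider "q i = q j" | "q i = q (Suc j)" "q (Suc i) = q j" by (auto simp: doubleton_eq_iff)
    then show "i = j"
    proof cases
      case 1
      then show ?thesis using ij(1,2) by (simp add: q_eq_iff)
    next
      case 2
      then have "q (i + 2) = q i" using q_Suc_cong[OF 2(2)] by simp
      then show ?thesis using q_eq_dvd small_not_dvd by blast
    qed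
  qed
  then show ?thesis unfolding C_eq by (simp add: card_image)
qed

text \<open>Removing one edge of the only cycle leaves a forest, so the bound for forests grows by one.\<close>

lemma edge_count:
  assumes "W \<noteq> {}" shows "card {e \<in> E. e \<subseteq> W} \<le> card W"
proof -
  let ?e = "{q 0, q (Suc 0)}"
  let ?F = "E - {?e}"
  have "\<nexists>C' k. is_cycle ?F k C'"
  proof
    assume "\<exists>C' k. is_cycle ?F k C'"
    then obtain C' k where c: "is_cycle ?F k C'" by blast
    then have "is_cycle E k C'" by (auto simp: is_cycle_def)
    then have "C' = C" by (rule only_cycle)
    with c edge_q[of 0] show False by (auto simp: is_cycle_def)
  qed
  then have "finite {e \<in> ?F. e \<subseteq> W} \<and> card {e \<in> ?F. e \<subseteq> W} < card W"
    using edge_pair assms by (intro forest_edge_count) auto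
  moreover have "card {e \<in> E. e \<subseteq> W} \<le> card (insert ?e {e \<in> ?F. e \<subseteq> W})"
    by (rule card_mono) auto
  moreover have "card (insert ?e {e \<in> ?F. e \<subseteq> W}) \<le> Suc (card {e \<in> ?F. e \<subseteq> W})"
    by (simp add: card_insert_if)
  ultimately show ?thesis by linarith
qed

text \<open>Any set of vertices spans at most as many edges as it has vertices, and the cycle alone already
  attains this bound.\<close>

lemma extra_edges:
  assumes X: "X \<inter> Q = {}" and Y: "Y \<subseteq> E" "\<And>e. e \<in> Y \<Longrightarrow> e \<subseteq> Q \<union> X \<and> e \<inter> X \<noteq> {}"
  shows "card Y \<le> card X"
proof -
  have "C \<inter> Y = {}" using C_sub Y(2) X by blast
  then have "n + card Y = card (C \<union> Y)" using card_C by (simp add: card_Un_disjoint)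
  also have "\<dots> \<le> card {e \<in> E. e \<subseteq> Q \<union> X}"
  proof (rule card_mono)
    have "e \<subseteq> Q \<union> X" if "e \<in> C \<union> Y" for e using that C_sub[of e] Y(2)[of e] by blast
    then show "C \<union> Y \<subseteq> {e \<in> E. e \<subseteq> Q \<union> X}" using cycle Y(1) by blast
  qed simp
  also have "\<dots> \<le> card (Q \<union> X)" by (rule edge_count) (use Q_nonempty in simp)
  also have "\<dots> = n + card X" using card_Q X by (simp add: card_Un_disjoint Int_commute)
  finally show ?thesis by simp
qed

lemma chordless:
  assumes "{u, v} \<in> E" "u \<in> Q" "v \<in> Q" shows "{u, v} \<in> C"
proof -
  have "C \<subseteq> {e \<in> E. e \<subseteq> Q}" using cycle C_sub by blast
  moreover have "card {e \<in> E. e \<subseteq> Q} \<le> card C" using edge_count[OF Q_nonempty] by (simp add: card_Q card_C)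
  ultimately have "C = {e \<in> E. e \<subseteq> Q}" by (intro card_seteq) auto
  then show ?thesis using assms by auto
qed

lemma single_attachment:
  assumes "r \<notin> Q" "a \<in> Q" "b \<in> Q" "{r, a} \<in> E" "{r, b} \<in> E"
  shows "a = b"
proof (rule ccontr)
  assume "a \<noteq> b"
  then have "card {{r, a}, {r, b}} = 2" by (auto simp: card_insert_if doubleton_eq_iff)
  moreover have "card {{r, a}, {r, b}} \<le> card {r}"
    by (rule extra_edges) (use assms in auto)
  ultimately show False by simp
qed

text \<open>Otherwise two vertices off the cycle would bring three edges.\<close>

lemma child_not_attached:
  assumes "r \<notin> Q" "a \<in> Q" "{r, a} \<in> E" "z \<notin> Q" "{r, z} \<in> E" "b \<in> Q"
  shows "{b, z} \<notin> E"
proof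
  assume zb: "{b, z} \<in> E"
  have "z \<noteq> r" using assms(5) noloop by auto
  then have "card {{r, a}, {r, z}, {b, z}} = 3"
    using assms by (auto simp: card_insert_if doubleton_eq_iff)
  moreover have "card {{r, a}, {r, z}, {b, z}} \<le> card {r, z}"
    by (rule extra_edges) (use assms zb in auto)
  moreover have "card {r, z} \<le> 2" by (simp add: card_insert_if)
  ultimately show False by simp
qed

text \<open>Otherwise four vertices off the cycle would bring five edges.\<close>

lemma children_independent:
  assumes r: "r \<notin> Q" "a \<in> Q" "{r, a} \<in> E" "z \<notin> Q" "{r, z} \<in> E"
    and r': "r' \<notin> Q" "a' \<in> Q" "{r', a'} \<in> E" "z' \<notin> Q" "{r', z'} \<in> E" and "r \<noteq> r'"
  shows "{z, z'} \<notin> E"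
proof
  assume zz: "{z, z'} \<in> E"
  have ne: "z \<noteq> z'" "z \<noteq> r" "z' \<noteq> r'" using zz r(5) r'(5) noloop by auto
  have "{a', z} \<notin> E" "{a, z'} \<notin> E"
    using child_not_attached[OF r r'(2)] child_not_attached[OF r' r(2)] by auto
  then have ne': "z \<noteq> r'" "z' \<noteq> r" using r(3) r'(3) by (auto simp: insert_commute)
  have "card {{r, a}, {r', a'}, {r, z}, {r', z'}, {z, z'}} = 5"
    using r r' ne ne' \<open>r \<noteq> r'\<close> by (auto simp: card_insert_if doubleton_eq_iff)
  moreover have "card {{r, a}, {r', a'}, {r, z}, {r', z'}, {z, z'}} \<le> card {r, r', z, z'}"
    by (rule extra_edges) (use r r' zz in auto)
  moreover have "card {r, r', z, z'} \<le> 4" by (simp add: card_insert_if)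
  ultimately show False by simp
qed

lemma cycle_neighbours:
  assumes "{q (Suc k), y} \<in> E" "y \<in> Q"
  shows "y = q k \<or> y = q (Suc (Suc k))"
proof -
  have "{q (Suc k), y} \<in> C" using chordless assms q_in by blast
  then obtain i where "{q (Suc k), y} = {q i, q (Suc i)}" unfolding C_eq by blast
  then consider "q (Suc k) = q i" "y = q (Suc i)" | "q (Suc k) = q (Suc i)" "y = q i"
    by (auto simp: doubleton_eq_iff)
  then show ?thesis
  proof cases
    case 1
    then show ?thesis using q_Suc_cong[OF 1(1)] by simp
  next
    case 2
    then show ?thesis using q_pred_cong[OF 2(1)] by simp
  qed
qed

text \<open>The set \<open>B\<close> consists of the two vertices at distance 2 from \<open>x\<close> along the cycle.  They avoid the
  neighbours of \<open>x\<close> unless \<open>n = 3\<close>, and they are not adjacent to each other unless \<open>n = 3\<close> or \<open>n = 5\<close>.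
  They coincide for \<open>n = 4\<close>.\<close>

lemma cycle_not_sheddable:
  assumes n: "n \<noteq> 3" "n \<noteq> 5" and x: "x \<in> Q"
  shows "\<exists>B\<subseteq>Q. (\<forall>b\<in>B. b \<noteq> x \<and> {x, b} \<notin> E) \<and> (\<forall>b\<in>B. \<forall>c\<in>B. {b, c} \<notin> E) \<and>
               (\<forall>y\<in>Q. {x, y} \<in> E \<longrightarrow> (\<exists>b\<in>B. {y, b} \<in> E))"
proof -
  obtain k where k: "n \<le> k" "x = q k" using in_Q[OF x] by blast
  \<comment> \<open>\<open>k \<ge> n \<ge> 3\<close> leaves room for the indices \<open>k - 1\<close> and \<open>k - 2\<close> without truncated subtraction\<close>
  obtain m where m: "k = m + 3" using k(1) vs(3) by (metis add.commute le_Suc_ex le_trans)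
  have dvd3: "\<not> n dvd 3"
  proof
    assume "n dvd 3"
    then have "n \<le> 3" by (rule dvd_imp_le) simp
    with n vs(3) show False by simp
  qed
  have dvd5: "\<not> n dvd 5"
  proof
    assume d: "n dvd 5"
    then have "n \<le> 5" by (rule dvd_imp_le) simp
    with n vs(3) have "n = 4" by simp
    with d show False by simp
  qed
  have diff: "q i \<noteq> q j" if "j = i + d" "\<not> n dvd d" for i j d
    using q_eq_dvd[of i d] that by metis
  let ?b = "q (m + 1)" and ?c = "q (m + 5)"
  have bc: "{?b, ?c} \<notin> E"
  proof
    assume "{?b, ?c} \<in> E"
    then have "?c = q m \<or> ?c = q (m + 2)"
      using cycle_neighbours[of m ?c] q_in by (simp add: eval_nat_numeral)
    then show False using diff[of "m + 5" m 5] diff[of "m + 5" "m + 2" 3] dvd3 dvd5 by auto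
  qed
  have xb: "{x, ?b} \<notin> E"
  proof
    assume "{x, ?b} \<in> E"
    then have "{q (m + 3), ?b} \<in> E" by (simp add: k(2) m)
    then have "?b = q (m + 2) \<or> ?b = q (m + 4)"
      using cycle_neighbours[of "m + 2" ?b] q_in by (simp add: eval_nat_numeral)
    then show False using diff[of "m + 2" "m + 1" 1] diff[of "m + 4" "m + 1" 3] dvd3 small_not_dvd by auto
  qed
  have xc: "{x, ?c} \<notin> E"
  proof
    assume "{x, ?c} \<in> E"
    then have "{q (m + 3), ?c} \<in> E" by (simp add: k(2) m)
    then have "?c = q (m + 2) \<or> ?c = q (m + 4)"
      using cycle_neighbours[of "m + 2" ?c] q_in by (simp add: eval_nat_numeral)
    then show False using diff[of "m + 5" "m + 2" 3] diff[of "m + 5" "m + 4" 1] dvd3 small_not_dvd by auto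
  qed
  have ne: "?b \<noteq> x" "?c \<noteq> x"
    using diff[of "m + 3" "m + 1" 2] diff[of "m + 5" "m + 3" 2] small_not_dvd by (auto simp: k(2) m)
  have near: "\<exists>b\<in>{?b, ?c}. {y, b} \<in> E" if "y \<in> Q" "{x, y} \<in> E" for y
  proof -
    have "{q (m + 3), y} \<in> E" using that(2) by (simp add: k(2) m)
    then have "y = q (m + 2) \<or> y = q (m + 4)"
      using cycle_neighbours[of "m + 2" y] that(1) by (simp add: eval_nat_numeral)
    moreover have "{q (m + 2), ?b} \<in> E" using edge_q[of "m + 1"] cycle by (auto simp: insert_commute)
    moreover have "{q (m + 4), ?c} \<in> E" using edge_q[of "m + 4"] cycle by (auto simp: eval_nat_numeral)
    ultimately show ?thesis by blast
  qed
  have "{?c, ?b} \<notin> E" using bc by (simp add: insert_commute)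
  then show ?thesis
    using bc xb xc ne near noloop q_in by (intro exI[of _ "{?b, ?c}"]) auto
qed

text \<open>If no neighbour of the cycle is a leaf, choosing for each of them a further neighbour \<open>\<zeta> r\<close>
  gives the independent set that cuts off the cycle.\<close>

lemma cycle_vertex_with_leaf:
  assumes vd: "vertex_decomposable UNIV E" and n: "n \<noteq> 3" "n \<noteq> 5"
  shows "\<exists>x\<in>Q. \<exists>y. {x, y} \<in> E \<and> (\<forall>u. {u, y} \<in> E \<longrightarrow> u = x)"
proof (rule ccontr)
  assume no_leaf: "\<not> ?thesis"
  \<comment> \<open>the neighbours of the cycle off the cycle\<close>
  define R where "R = {r. r \<notin> Q \<and> (\<exists>a\<in>Q. {r, a} \<in> E)}"
  have "\<exists>z. z \<notin> Q \<and> {r, z} \<in> E" if r: "r \<in> R" for r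
  proof (rule ccontr)
    assume no: "\<nexists>z. z \<notin> Q \<and> {r, z} \<in> E"
    obtain a where a: "a \<in> Q" "{r, a} \<in> E" "r \<notin> Q" using r by (auto simp: R_def)
    have "u = a" if "{u, r} \<in> E" for u
    proof -
      have ru: "{r, u} \<in> E" using that by (simp add: insert_commute)
      then have "u \<in> Q" using no by blast
      then show ?thesis using single_attachment[OF a(3) _ a(1) ru a(2)] by simp
    qed
    moreover have "{a, r} \<in> E" using a(2) by (simp add: insert_commute)
    ultimately show False using no_leaf a(1) by blast
  qed
  then obtain \<zeta> where \<zeta>: "\<And>r. r \<in> R \<Longrightarrow> \<zeta> r \<notin> Q \<and> {r, \<zeta> r} \<in> E" by metis
  have "shedding_obstruction UNIV E (\<zeta> ` R) Q"
    unfolding shedding_obstruction_def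
  proof (intro conjI ballI allI impI)
    show "Q \<noteq> {}" by (rule Q_nonempty)
    show "\<zeta> ` R \<inter> Q = {}" using \<zeta> by blast
    fix u v assume "u \<in> \<zeta> ` R" "v \<in> \<zeta> ` R"
    then obtain r r' where r: "r \<in> R" "u = \<zeta> r" and r': "r' \<in> R" "v = \<zeta> r'" by blast
    show "{u, v} \<notin> E"
    proof (cases "r = r'")
      case True
      then show ?thesis using r r' noloop by simp
    next
      case False
      obtain a a' where "a \<in> Q" "{r, a} \<in> E" "r \<notin> Q" "a' \<in> Q" "{r', a'} \<in> E" "r' \<notin> Q"
        using r(1) r'(1) by (auto simp: R_def)
      then show ?thesis using children_independent[of r a u r' a' v] \<zeta> r r' False by blast
    qed
  next
    fix c z assume c: "c \<in> Q" "z \<in> \<zeta> ` R"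
    then obtain r where r: "r \<in> R" "z = \<zeta> r" by blast
    then obtain a where "a \<in> Q" "{r, a} \<in> E" "r \<notin> Q" by (auto simp: R_def)
    then show "{c, z} \<notin> E" using child_not_attached[of r a z c] \<zeta> r c by blast
  next
    fix c r assume "c \<in> Q" "{c, r} \<in> E" "r \<notin> Q"
    then have "r \<in> R" by (auto simp: R_def insert_commute)
    then show "\<exists>a\<in>\<zeta> ` R. {r, a} \<in> E" using \<zeta> by blast
  next
    fix x assume x: "x \<in> Q"
    then obtain k where "x = q k" using in_Q by blast
    then show "\<exists>y\<in>Q. {x, y} \<in> E" using edge_q[of k] cycle q_in by blast
    show "\<exists>B\<subseteq>Q. (\<forall>b\<in>B. b \<noteq> x \<and> {x, b} \<notin> E) \<and> (\<forall>b\<in>B. \<forall>c\<in>B. {b, c} \<notin> E) \<and>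
               (\<forall>y\<in>Q. {x, y} \<in> E \<longrightarrow> (\<exists>b\<in>B. {y, b} \<in> E))"
      by (rule cycle_not_sheddable[OF n x])
  qed auto
  moreover have "\<not> shedding_obstruction UNIV E (\<zeta> ` R) Q"
    by (rule vertex_decomposable_no_obstruction[OF vd]) (use edge_pair in blast)
  ultimately show False by blast
qed

text \<open>Every cycle of the graph passes through \<open>x\<close>.\<close>

lemma forest_off_cycle_vertex:
  assumes x: "x \<in> Q" and U: "U \<noteq> {}" "x \<notin> U"
  shows "\<exists>u\<in>U. card {v \<in> U. {u, v} \<in> E} \<le> 1"
proof (rule ccontr)
  assume neg: "\<not> ?thesis"
  let ?F = "{e \<in> E. e \<subseteq> U}"
  have "\<exists>C' k. is_cycle ?F k C'"
  proof (rule min_degree_two_has_cycle[of U])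
    show "{u} \<notin> ?F" for u using noloop[of u] by simp
    fix u assume u: "u \<in> U"
    have "{v \<in> U. {u, v} \<in> ?F} = {v \<in> U. {u, v} \<in> E}" using u by auto
    then show "2 \<le> card {v \<in> U. {u, v} \<in> ?F}" using neg u by force
  qed (use U in auto)
  then obtain C' k where c: "is_cycle ?F k C'" by blast
  then have "is_cycle E k C'" by (auto simp: is_cycle_def)
  then have "C' = C" by (rule only_cycle)
  moreover obtain i where "x = q i" using in_Q[OF x] by blast
  ultimately have "{x, q (Suc i)} \<in> ?F" using c edge_q[of i] by (auto simp: is_cycle_def)
  then show False using U(2) by simp
qed

end

theorem corollary4p4:
  fixes E :: "'v::finite set set" and C :: "'v set set" and n :: nat
  assumes "unicyclic UNIV E"
    and "is_cycle E n C"
    and "n \<noteq> 3" and "n \<noteq> 5"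
    and "vertex_decomposable UNIV E"
  shows "\<forall>s\<ge>1. componentwise_linear
           (symbolic_power (vertex_cover_ideal E :: ('v, 'k::field) mpoly set) s)"
proof -
  from assms(2) obtain vs where vs: "distinct vs" "length vs = n" "3 \<le> n" "C = cycle_edges vs" "C \<subseteq> E"
    unfolding is_cycle_def by blast
  have graph: "simple_graph UNIV E" using assms(1) by (simp add: unicyclic_def)
  interpret cycle_in_graph E vs n
  proof
    fix C' k assume "is_cycle E k C'"
    then show "C' = cycle_edges vs" using assms(1,2) vs(4) unfolding unicyclic_def by blast
  qed (use vs graph in auto)
  obtain x y where xy: "x \<in> set vs" "{x, y} \<in> E" "\<And>u. {u, y} \<in> E \<Longrightarrow> u = x"
    using cycle_vertex_with_leaf[OF assms(5,3,4)] by blast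
  show ?thesis
    using whiskered_forest_componentwise_linear[OF graph xy(2,3) forest_off_cycle_vertex[OF xy(1)]] by blast
qed

end
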